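(* Suppose that $|\eta|\le K$ and $\mathbb{E}\eta=0$. Let $\boldsymbol{\eta}=(\eta_1,\dots,\eta_N)$ be $N$ independent copies of $\eta$, let $\mu_t$ be the law of $X_t$ and, for $\boldsymbol{y}\in\mathbb{R}^{Nd}$, let $\mu^{\boldsymbol{y}}_t$ be the law of $X^{\boldsymbol{y}}_t$. Then for all $N\in\mathbb{N}$ and $t\in(0,1)$, $$\mathbb{E}\Big(\|\mu^{\boldsymbol{y}}_t-\mu_t\|_{\mathrm{var}}^2\big|_{\boldsymbol{y}=\boldsymbol{\eta}}\Big)\le\frac{8K^2}{N}\,\mathbb{E}\left(\frac{e^{\beta_t(2|\eta|^2+\mathbb{E}|\eta|^2)/(2\varepsilon\sigma_t)}}{2|\eta|^2+\mathbb{E}|\eta|^2}\right).$$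
   Context: Let $\varepsilon,\gamma>0$; $\sigma,\beta:[0,1]\to[0,1]$ are $C^1$ with $\beta'_t>0$ on $(0,1)$, $\beta_0=0$, $\beta_1=1$, $\sigma_t+\beta_t=1$; $\ell_t=\varepsilon\beta_t+\gamma\sigma_t$. $\eta$ is an $\mathbb{R}^d$-valued random variable with law $\nu$, and $$\mathcal{C}_t(x,y)=e^{-|x-\beta_ty|^2/(2\ell_t\sigma_t)}.$$ $X$ solves $\mathrm{d}X_t=b_t(X_t)\,\mathrm{d}t+\sqrt{\varepsilon\beta'_t}\,\mathrm{d}W_t$, $X_0\sim N(0,\gamma\mathbb{I}_d)$, with $$b_t(x)=\frac{\sigma'_t\,\mathbb{E}[(x-\eta)\mathcal{C}_t(x,\eta)]}{\sigma_t\,\mathbb{E}\,\mathcal{C}_t(x,\eta)}.$$ For $\boldsymbol{y}=(y_1,\dots,y_N)\in\mathbb{R}^{Nd}$, $X^{\boldsymbol{y}}$ solves $\mathrm{d}X^{\boldsymbol{y}}_t=b^{\boldsymbol{y}}_t(X^{\boldsymbol{y}}_t)\,\mathrm{d}t+\sqrt{\varepsilon\beta'_t}\,\mathrm{d}W_t$, $X_0^{\boldsymbol{y}}\sim N(0,\gamma\mathbb{I}_d)$, with $$b^{\boldsymbol{y}}_t(x)=\frac{\sigma'_t\sum_{i=1}^N(x-y_i)\mathcal{C}_t(x,y_i)}{\sigma_t\sum_{i=1}^N\mathcal{C}_t(x,y_i)}.$$ Here $t\in[0,1)$, $W$ is a $d$-dimensional standard Brownian motion independent of the initial values. For a signed measure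 $\mu$, $\|\mu\|_{\mathrm{var}}=\sup_{\|f\|_\infty\le1}|\int f\,\mathrm{d}\mu|$. *)

theory Defs
  imports "HOL-Probability.Probability"
begin

text \<open>
  The centred isotropic normal law \<open>N(0, v I)\<close> with variance \<open>v > 0\<close>.
\<close>
definition gaussian_measure :: "real \<Rightarrow> 'v::euclidean_space measure" where
  "gaussian_measure v = density lborel
     (\<lambda>x. ennreal ((2 * pi * v) powr (- real DIM('v) / 2) * exp (- (norm x)\<^sup>2 / (2 * v))))"

definition brownian_motion ::
  "'a measure \<Rightarrow> (real \<Rightarrow> 'a \<Rightarrow> 'v::euclidean_space) \<Rightarrow> bool" where
  "brownian_motion M W \<longleftrightarrow>
     (\<forall>t\<ge>0. W t \<in> borel_measurable M) \<and>
     (AE \<omega> in M. W 0 \<omega> = 0) \<and>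
     (AE \<omega> in M. continuous_on {0..} (\<lambda>t. W t \<omega>)) \<and>
     (\<forall>s t. 0 \<le> s \<and> s < t \<longrightarrow>
        distr M borel (\<lambda>\<omega>. W t \<omega> - W s \<omega>) = gaussian_measure (t - s)) \<and>
     (\<forall>n (p :: nat \<Rightarrow> real). 0 \<le> p 0 \<and> strict_mono p \<longrightarrow>
        prob_space.indep_vars M (\<lambda>_. borel) (\<lambda>i \<omega>. W (p (Suc i)) \<omega> - W (p i) \<omega>) {..<n})"

text \<open>
  A triple \<open>(n, p, c)\<close> encodes the step function taking the value \<open>c i\<close> on
  \<open>(p i, p (i + 1)]\<close> for \<open>i < n\<close>, and \<open>0\<close> elsewhere.
\<close>
type_synonym step = "nat \<times> (nat \<Rightarrow> real) \<times> (nat \<Rightarrow> real)"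

definition step_on :: "real \<Rightarrow> step \<Rightarrow> bool" where
  "step_on t = (\<lambda>(n, p, c). 0 \<le> p 0 \<and> (\<forall>i<n. p i \<le> p (Suc i)) \<and> p n \<le> t)"

definition step_fun :: "step \<Rightarrow> real \<Rightarrow> real" where
  "step_fun = (\<lambda>(n, p, c) s. \<Sum>i<n. c i * indicator {p i<..p (Suc i)} s)"

definition step_integral ::
  "(real \<Rightarrow> 'a \<Rightarrow> 'v::euclidean_space) \<Rightarrow> step \<Rightarrow> 'a \<Rightarrow> 'v" where
  "step_integral W = (\<lambda>(n, p, c) \<omega>. \<Sum>i<n. c i *\<^sub>R (W (p (Suc i)) \<omega> - W (p i) \<omega>))"

text \<open>
  \<open>I\<close> is a version of the stochastic integral of the deterministic function \<open>g\<close> over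
  \<open>[0, t]\<close> with respect to \<open>W\<close>: the \<open>L\<^sup>2(M)\<close>-limit of the elementary integrals of step
  functions which converge to \<open>g\<close> in \<open>L\<^sup>2[0, t]\<close>. By the isometry property, the limit is
  almost surely independent of the choice of the step functions.
\<close>
definition has_wiener_integral ::
  "'a measure \<Rightarrow> (real \<Rightarrow> 'a \<Rightarrow> 'v::euclidean_space) \<Rightarrow> (real \<Rightarrow> real) \<Rightarrow> real \<Rightarrow>
   ('a \<Rightarrow> 'v) \<Rightarrow> bool" where
  "has_wiener_integral M W g t I \<longleftrightarrow>
     I \<in> borel_measurable M \<and>
     (\<exists>S :: nat \<Rightarrow> step. (\<forall>k. step_on t (S k)) \<and>
        (\<lambda>k. \<integral>\<^sup>+ s. ennreal ((g s - step_fun (S k) s)\<^sup>2) * indicator {0..t} s \<partial>lborel)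
          \<longlonglongrightarrow> 0 \<and>
        (\<lambda>k. \<integral>\<^sup>+ \<omega>. ennreal ((norm (I \<omega> - step_integral W (S k) \<omega>))\<^sup>2) \<partial>M)
          \<longlonglongrightarrow> 0)"

text \<open>
  \<open>X\<close> solves \<open>dX = b(t, X) dt + g(t) dW\<close> on \<open>[0, T)\<close>, driven by the Brownian motion \<open>W\<close>,
  with initial value independent of \<open>W\<close>. As \<open>g\<close> is deterministic, the stochastic integral
  makes sense without reference to a filtration.
\<close>
definition sde_solution ::
  "'a measure \<Rightarrow> (real \<Rightarrow> 'a \<Rightarrow> 'v::euclidean_space) \<Rightarrow> (real \<Rightarrow> 'v \<Rightarrow> 'v) \<Rightarrow>
   (real \<Rightarrow> real) \<Rightarrow> real \<Rightarrow> (real \<Rightarrow> 'a \<Rightarrow> 'v) \<Rightarrow> bool" where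
  "sde_solution M W b g T X \<longleftrightarrow>
     brownian_motion M W \<and>
     (\<forall>t\<in>{0..<T}. X t \<in> borel_measurable M) \<and>
     prob_space.indep_set M
       (sets (vimage_algebra (space M) (X 0) borel))
       (sets (vimage_algebra (space M) (\<lambda>\<omega>. \<lambda>s\<in>{0..}. W s \<omega>) (PiM {0..} (\<lambda>_. borel)))) \<and>
     (AE \<omega> in M. continuous_on {0..<T} (\<lambda>t. X t \<omega>)) \<and>
     (\<forall>t\<in>{0..<T}.
        (AE \<omega> in M. set_integrable lborel {0..t} (\<lambda>s. b s (X s \<omega>))) \<and>
        (\<exists>I. has_wiener_integral M W g t I \<and>
          (AE \<omega> in M. X t \<omega> = X 0 \<omega> + (LINT s:{0..t}|lborel. b s (X s \<omega>)) + I \<omega>)))"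

text \<open>
  \<open>\<C>\<^sub>t(x, y)\<close>, where the factor \<open>\<epsilon> * \<beta> t + \<gamma> * \<sigma> t\<close> is \<open>\<ell>\<^sub>t\<close>.
\<close>
definition kern ::
  "real \<Rightarrow> real \<Rightarrow> (real \<Rightarrow> real) \<Rightarrow> (real \<Rightarrow> real) \<Rightarrow> real \<Rightarrow>
   'v::euclidean_space \<Rightarrow> 'v \<Rightarrow> real" where
  "kern \<epsilon> \<gamma> \<sigma> \<beta> t x y =
     exp (- (norm (x - \<beta> t *\<^sub>R y))\<^sup>2 / (2 * (\<epsilon> * \<beta> t + \<gamma> * \<sigma> t) * \<sigma> t))"

text \<open>In the following two drifts, \<open>\<sigma>'\<close> stands for the derivative of \<open>\<sigma>\<close>.\<close>
definition drift ::
  "real \<Rightarrow> real \<Rightarrow> (real \<Rightarrow> real) \<Rightarrow> (real \<Rightarrow> real) \<Rightarrow> (real \<Rightarrow> real) \<Rightarrow>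
   'a measure \<Rightarrow> ('a \<Rightarrow> 'v::euclidean_space) \<Rightarrow> real \<Rightarrow> 'v \<Rightarrow> 'v" where
  "drift \<epsilon> \<gamma> \<sigma> \<sigma>' \<beta> M \<eta> t x =
     (\<sigma>' t / (\<sigma> t * (\<integral>\<omega>. kern \<epsilon> \<gamma> \<sigma> \<beta> t x (\<eta> \<omega>) \<partial>M))) *\<^sub>R
     (\<integral>\<omega>. kern \<epsilon> \<gamma> \<sigma> \<beta> t x (\<eta> \<omega>) *\<^sub>R (x - \<eta> \<omega>) \<partial>M)"

definition empirical_drift ::
  "real \<Rightarrow> real \<Rightarrow> (real \<Rightarrow> real) \<Rightarrow> (real \<Rightarrow> real) \<Rightarrow> (real \<Rightarrow> real) \<Rightarrow>
   nat \<Rightarrow> (nat \<Rightarrow> 'v::euclidean_space) \<Rightarrow> real \<Rightarrow> 'v \<Rightarrow> 'v" where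
  "empirical_drift \<epsilon> \<gamma> \<sigma> \<sigma>' \<beta> N y t x =
     (\<sigma>' t / (\<sigma> t * (\<Sum>i=1..N. kern \<epsilon> \<gamma> \<sigma> \<beta> t x (y i)))) *\<^sub>R
     (\<Sum>i=1..N. kern \<epsilon> \<gamma> \<sigma> \<beta> t x (y i) *\<^sub>R (x - y i))"

text \<open>
  \<open>\<parallel>\<mu> - \<nu>\<parallel>\<close> in the variation norm, for finite Borel measures \<open>\<mu>\<close> and \<open>\<nu>\<close>. There is no
  factor \<open>1/2\<close>: mutually singular probability measures are at distance \<open>2\<close>.
\<close>
definition var_dist :: "'v::euclidean_space measure \<Rightarrow> 'v measure \<Rightarrow> real" where
  "var_dist \<mu> \<nu> = (SUP f\<in>{f \<in> borel_measurable borel. \<forall>x. \<bar>f x\<bar> \<le> 1}.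
     \<bar>(\<integral>x. f x \<partial>\<mu>) - (\<integral>x. f x \<partial>\<nu>)\<bar>)"

end

theory Submission imports Defs
begin

text \<open>
  If the data consist of a single point \<open>y\<close>, the drift is \<open>(\<sigma>' / \<sigma>) (x - y)\<close>, the equation is linear, and its solution started
  from \<open>N(0, \<gamma> I)\<close> has at time \<open>t\<close> the law \<open>N(\<beta>\<^sub>t y, v\<^sub>t I)\<close> with \<open>v\<^sub>t = \<sigma>\<^sub>t \<ell>\<^sub>t\<close>. The kernel \<open>\<C>\<^sub>t(x, y)\<close> is proportional to the density of this
  law, so the drift for a general data law \<open>\<nu>\<close> is the conditional expectation of the linear drifts given the position, when the data
  point is drawn from \<open>\<nu>\<close>. The mixture of the laws \<open>N(\<beta>\<^sub>t y, v\<^sub>t I)\<close> under \<open>\<nu>\<close> therefore satisfies the same Fokker-Planck equation as the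
  law of the solution, and the two coincide (\<open>marginal_law\<close>). This applies to the law of \<open>\<eta>\<close> and to the empirical law of a sample, and
  reduces the theorem to an estimate for the mean deviation of a sample average of Gaussian densities from its expectation.

  The marginal law is identified through the Euler scheme. On the one hand, let \<open>u\<close> be Lipschitz and let one step of the scheme start from the mixture at time \<open>s\<close>. If the step
  used the drift towards the true \<open>y\<close>, it would produce the mixture at the end of the step up to a variance defect of second order.
  The actual step uses the posterior mean of \<open>y\<close>. The noise of the step smooths \<open>u\<close> (\<open>gauss_smoothing_expansion\<close>), the first-order
  effect of this replacement averages to zero, and the second-order effect is of size \<open>h\<^sup>2 / \<surd>h\<close> for an increment \<open>h\<close> of \<open>\<beta>\<close>
  (\<open>euler_step_weak_error\<close>). The posterior mean is Lipschitz in the position (\<open>post_mean_lipschitz\<close>), so the steps of the scheme preserve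
  Lipschitz functions with controlled constants, and the errors add up to something that vanishes with the mesh
  (\<open>euler_scheme_weak_error\<close>). On the other hand, the scheme converges to the solution: the solution satisfies its integral equation path
  by path, the noise of the scheme approaches the Wiener integral by the isometry (\<open>wiener_integral_step_error\<close>), and a discrete Gronwall
  inequality compares the two (\<open>euler_path_error\<close>).

  For the estimate, let \<open>g\<close> be the density of \<open>N(0, v\<^sub>t I)\<close>. By the Cauchy-Schwarz inequality, the squared variation distance of the two
  mixtures is at most the integral of the squared difference of their densities divided by \<open>g\<close>. Its expectation is \<open>1 / N\<close> times
  an integrated variance (\<open>empirical_mixture_error\<close>), which is at most \<open>E exp (\<beta>\<^sub>t\<^sup>2 |\<eta>|\<^sup>2 / v\<^sub>t)\<close> (\<open>chi_square_le\<close>).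
\<close>

section \<open>The standard Gaussian measure\<close>

definition gauss_density :: "real \<Rightarrow> 'v::euclidean_space \<Rightarrow> real" where
  "gauss_density v x = (2 * pi * v) powr (- real DIM('v) / 2) * exp (- (norm x)\<^sup>2 / (2 * v))"

abbreviation std_gauss :: "'v::euclidean_space measure" where
  "std_gauss \<equiv> gaussian_measure 1"

lemma gaussian_measure_density:
  "gaussian_measure v = density lborel (\<lambda>x. ennreal (gauss_density v x))"
  by (simp add: gaussian_measure_def gauss_density_def)

lemma sets_gaussian_measure [simp, measurable_cong]: "sets (gaussian_measure v) = sets borel"
  and space_gaussian_measure [simp]: "space (gaussian_measure v) = UNIV"
  by (simp_all add: gaussian_measure_def)

lemma gauss_density_measurable [measurable]: "gauss_density v \<in> borel_measurable borel"
  unfolding gauss_density_def by measurable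

lemma gauss_density_pos: "v > 0 \<Longrightarrow> gauss_density v x > 0"
  and gauss_density_nonneg [simp]: "gauss_density v x \<ge> 0"
  by (simp_all add: gauss_density_def)

lemma gauss_density_prod:
  assumes "v > 0"
  shows "gauss_density v (x :: 'v::euclidean_space) = (\<Prod>b\<in>Basis. normal_density 0 (sqrt v) (x \<bullet> b))"
proof -
  have "(2 * pi * v) powr (- real DIM('v) / 2) = (1 / sqrt (2 * pi * v)) ^ DIM('v)"
  proof -
    have "(2 * pi * v) powr (- real DIM('v) / 2) = ((2 * pi * v) powr (-1/2)) powr real DIM('v)"
      by (simp add: powr_powr)
    also have "(2 * pi * v) powr (-1/2) = 1 / sqrt (2 * pi * v)"
      using assms by (simp add: powr_minus_divide powr_half_sqrt)
    finally show ?thesis using assms by (simp add: powr_realpow)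
  qed
  moreover have "(norm x)\<^sup>2 = (\<Sum>b\<in>Basis. (x \<bullet> b)\<^sup>2)"
    by (simp only: power2_norm_eq_inner euclidean_inner[of x x]) (simp add: power2_eq_square)
  ultimately show ?thesis
    using assms
    by (simp add: gauss_density_def normal_density_def prod_dividef exp_sum[symmetric]
        sum_negf sum_divide_distrib power_divide)
qed

lemma nn_integral_gauss_density:
  assumes "v > 0"
  shows "(\<integral>\<^sup>+x. ennreal (gauss_density v (x :: 'v::euclidean_space)) \<partial>lborel) = 1"
proof -
  have *: "(\<integral>\<^sup>+x. ennreal (normal_density 0 (sqrt v) x) \<partial>lborel) = 1"
    using assms by (subst nn_integral_eq_integral) auto
  have "(\<integral>\<^sup>+x. ennreal (gauss_density v (x :: 'v)) \<partial>lborel)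
      = (\<integral>\<^sup>+x. (\<Prod>b\<in>Basis. ennreal (normal_density 0 (sqrt v) ((x :: 'v) \<bullet> b))) \<partial>lborel)"
    using assms by (simp add: gauss_density_prod prod_ennreal)
  also have "\<dots> = 1"
    by (subst nn_integral_lborel_prod) (simp_all add: *)
  finally show ?thesis .
qed

lemma prob_space_gaussian_measure: "v > 0 \<Longrightarrow> prob_space (gaussian_measure v)"
  by (rule prob_spaceI)
     (simp add: gaussian_measure_density emeasure_density nn_integral_gauss_density)

interpretation std_gauss: prob_space "std_gauss :: 'v::euclidean_space measure"
  by (rule prob_space_gaussian_measure) simp

lemma nn_integral_lborel_affine:
  fixes F :: "'v::euclidean_space \<Rightarrow> ennreal"
  assumes [measurable]: "F \<in> borel_measurable borel" and "r > 0"
  shows "(\<integral>\<^sup>+x. F x \<partial>lborel) = (\<integral>\<^sup>+w. ennreal (r ^ DIM('v)) * F (c + r *\<^sub>R w) \<partial>lborel)"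
  using assms(2)
  by (subst lborel_affine[of r c])
     (simp_all add: nn_integral_density nn_integral_distr)

lemma gauss_density_scale:
  assumes "r > 0" "v > 0"
  shows "r ^ DIM('v) * gauss_density (v * r\<^sup>2) (r *\<^sub>R (w :: 'v::euclidean_space)) = gauss_density v w"
proof -
  have "(2 * pi * (v * r\<^sup>2)) powr (- real DIM('v) / 2)
      = (2 * pi * v) powr (- real DIM('v) / 2) * (r\<^sup>2) powr (- real DIM('v) / 2)"
    using assms by (simp add: powr_mult mult.assoc)
  also have "(r\<^sup>2) powr (- real DIM('v) / 2) = inverse (r ^ DIM('v))"
  proof -
    have "(r\<^sup>2) powr (- real DIM('v) / 2) = (r powr 2) powr (- real DIM('v) / 2)"
      using assms by (simp add: powr_realpow)
    also have "\<dots> = r powr (- real DIM('v))"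
      by (simp only: powr_powr) simp
    also have "\<dots> = inverse (r ^ DIM('v))"
      using assms by (simp add: powr_minus powr_realpow)
    finally show ?thesis .
  qed
  finally have "(2 * pi * (v * r\<^sup>2)) powr (- real DIM('v) / 2)
      = (2 * pi * v) powr (- real DIM('v) / 2) * inverse (r ^ DIM('v))" .
  then show ?thesis
    using assms by (simp add: gauss_density_def power_mult_distrib)
qed

lemma distr_std_gauss_affine:
  assumes "r > 0"
  shows "distr std_gauss borel (\<lambda>w. c + r *\<^sub>R w :: 'v::euclidean_space)
    = density lborel (\<lambda>x. ennreal (gauss_density (r\<^sup>2) (x - c)))"
proof (rule measure_eqI)
  fix A :: "'v set" assume "A \<in> sets (distr std_gauss borel (\<lambda>w. c + r *\<^sub>R w))"
  then have [measurable]: "A \<in> sets borel" by simp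
  have "emeasure (density lborel (\<lambda>x. ennreal (gauss_density (r\<^sup>2) (x - c)))) A
      = (\<integral>\<^sup>+w. ennreal (r ^ DIM('v)) * (ennreal (gauss_density (r\<^sup>2) (r *\<^sub>R w)) * indicator A (c + r *\<^sub>R w)) \<partial>lborel)"
    using assms
    by (subst emeasure_density, simp, simp, subst nn_integral_lborel_affine[where c = c and r = r]) simp_all
  also have "\<dots> = (\<integral>\<^sup>+w. ennreal (gauss_density 1 w) * indicator A (c + r *\<^sub>R w) \<partial>lborel)"
    using gauss_density_scale[OF assms, of 1, where 'v = 'v] assms
    by (simp add: mult.assoc[symmetric] ennreal_mult[symmetric])
  also have "\<dots> = emeasure (distr std_gauss borel (\<lambda>w. c + r *\<^sub>R w)) A"
    by (simp add: gaussian_measure_density nn_integral_density nn_integral_distr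
        flip: nn_integral_indicator)
  finally show "emeasure (distr std_gauss borel (\<lambda>w. c + r *\<^sub>R w)) A
      = emeasure (density lborel (\<lambda>x. ennreal (gauss_density (r\<^sup>2) (x - c)))) A" by simp
qed simp

lemma distr_gaussian_scale:
  assumes "r > 0" "v > 0"
  shows "distr (gaussian_measure v) borel (\<lambda>w. r *\<^sub>R w :: 'v::euclidean_space) = gaussian_measure (r\<^sup>2 * v)"
proof -
  have g: "gaussian_measure u = distr std_gauss borel (\<lambda>w. sqrt u *\<^sub>R w :: 'v)" if "u > 0" for u
    using distr_std_gauss_affine[of "sqrt u" "0 :: 'v"] that by (simp add: gaussian_measure_density)
  have "distr (gaussian_measure v) borel (\<lambda>w. r *\<^sub>R w :: 'v)
      = distr std_gauss borel (\<lambda>w. sqrt (r\<^sup>2 * v) *\<^sub>R w :: 'v)"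
    unfolding g[OF assms(2)] using assms by (simp add: distr_distr o_def real_sqrt_mult)
  also have "\<dots> = gaussian_measure (r\<^sup>2 * v)" using assms by (intro g[symmetric]) simp
  finally show ?thesis .
qed

text \<open>
  The Cameron-Martin formula, by completing the square in the density. It moves a displacement of the
  argument of a function onto the measure, where everything is smooth.
\<close>

lemma distr_std_gauss_shift:
  "distr std_gauss borel (\<lambda>w. w + a) = density std_gauss (\<lambda>w. ennreal (exp (a \<bullet> w - (norm a)\<^sup>2 / 2)))"
proof -
  have *: "gauss_density 1 (x - a) = gauss_density 1 x * exp (a \<bullet> x - (norm a)\<^sup>2 / 2)" for x
  proof -
    have "- (norm (x - a))\<^sup>2 / (2 * 1) = - (norm x)\<^sup>2 / (2 * 1) + (a \<bullet> x - (norm a)\<^sup>2 / 2)"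
      by (simp add: power2_norm_eq_inner inner_diff inner_commute)
    then show ?thesis unfolding gauss_density_def mult.assoc exp_add[symmetric] by simp
  qed
  show ?thesis
    using distr_std_gauss_affine[of 1 a]
    by (simp add: gaussian_measure_density density_density_eq * ennreal_mult add.commute)
qed

text \<open>
  With \<open>s = a\<^sup>2 + b\<^sup>2\<close>, completing the square in \<open>w\<close> factors the joint density into the density
  of variance \<open>s\<close> at \<open>x\<close> and a normalised Gaussian in \<open>w\<close> centred at \<open>(b / s) x\<close>.
\<close>

lemma gauss_density_convolution:
  assumes "a > 0" "b > 0"
  shows "(\<integral>\<^sup>+w. ennreal (gauss_density (a\<^sup>2) (x - b *\<^sub>R w)) \<partial>std_gauss)
    = ennreal (gauss_density (a\<^sup>2 + b\<^sup>2) (x :: 'v::euclidean_space))"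
proof -
  define s where "s = a\<^sup>2 + b\<^sup>2"
  have s: "s > 0" using assms by (simp add: s_def add_pos_pos)
  have e: "- (norm (x - b *\<^sub>R w))\<^sup>2 / (2 * a\<^sup>2) - (norm w)\<^sup>2 / 2
      = - (norm x)\<^sup>2 / (2 * s) - (norm (w - (b / s) *\<^sub>R x))\<^sup>2 / (2 * (a\<^sup>2 / s))" for w
  proof -
    have "(norm (x - b *\<^sub>R w))\<^sup>2 = (norm x)\<^sup>2 - 2 * b * (x \<bullet> w) + b\<^sup>2 * (norm w)\<^sup>2"
      by (simp add: power2_norm_eq_inner inner_diff inner_commute) (simp add: power2_eq_square)
    moreover have "(norm (w - (b / s) *\<^sub>R x))\<^sup>2 = (norm w)\<^sup>2 - 2 * (b / s) * (x \<bullet> w) + (b / s)\<^sup>2 * (norm x)\<^sup>2"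
      by (simp add: power2_norm_eq_inner inner_diff inner_commute) (simp add: power2_eq_square)
    moreover have "- (X - 2 * b * Y + b\<^sup>2 * Z) / (2 * p) - Z / 2
        = - X / (2 * s) - (Z - 2 * (b / s) * Y + (b / s)\<^sup>2 * X) / (2 * (p / s))"
      if "p > 0" "s = p + b\<^sup>2" for X Y Z p :: real
    proof -
      have "- X / (2 * s) - (Z - 2 * (b / s) * Y + (b / s)\<^sup>2 * X) / (2 * (p / s))
          = - (X * (p + b\<^sup>2) / s + s * Z - 2 * b * Y) / (2 * p)"
        using that(1) s by (simp add: field_simps power2_eq_square)
      also have "X * (p + b\<^sup>2) / s = X" using that(2) s by simp
      also have "- (X + s * Z - 2 * b * Y) / (2 * p) = - (X - 2 * b * Y + b\<^sup>2 * Z) / (2 * p) - Z / 2"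
        using that by (simp add: field_simps)
      finally show ?thesis by simp
    qed
    ultimately show ?thesis using assms by (simp add: s_def)
  qed
  have c: "(2 * pi * a\<^sup>2) powr p * (2 * pi) powr p = (2 * pi * s) powr p * (2 * pi * (a\<^sup>2 / s)) powr p" for p
    using s assms by (simp add: powr_mult[symmetric] field_simps)
  have "gauss_density (a\<^sup>2) (x - b *\<^sub>R w) * gauss_density 1 w
      = gauss_density s x * gauss_density (a\<^sup>2 / s) (w - (b / s) *\<^sub>R x)"
    (is "?l = ?r") for w
  proof -
    have "?l = ((2 * pi * a\<^sup>2) powr (- real DIM('v) / 2) * (2 * pi) powr (- real DIM('v) / 2))
        * (exp (- (norm (x - b *\<^sub>R w))\<^sup>2 / (2 * a\<^sup>2)) * exp (- ((norm w)\<^sup>2 / 2)))"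
      by (simp add: gauss_density_def)
    also have "\<dots> = ((2 * pi * a\<^sup>2) powr (- real DIM('v) / 2) * (2 * pi) powr (- real DIM('v) / 2))
        * exp (- (norm (x - b *\<^sub>R w))\<^sup>2 / (2 * a\<^sup>2) - (norm w)\<^sup>2 / 2)"
      by (simp add: exp_add[symmetric] del: exp_add)
    also have "\<dots> = ((2 * pi * s) powr (- real DIM('v) / 2) * (2 * pi * (a\<^sup>2 / s)) powr (- real DIM('v) / 2))
        * exp (- (norm x)\<^sup>2 / (2 * s) + - (norm (w - (b / s) *\<^sub>R x))\<^sup>2 / (2 * (a\<^sup>2 / s)))"
      unfolding c e by simp
    also have "\<dots> = ?r"
      unfolding exp_add gauss_density_def by (simp only: mult.assoc mult.left_commute mult.commute)
    finally show ?thesis .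
  qed
  then have "(\<integral>\<^sup>+w. ennreal (gauss_density (a\<^sup>2) (x - b *\<^sub>R w)) \<partial>std_gauss)
    = (\<integral>\<^sup>+w. ennreal (gauss_density s x) * ennreal (gauss_density (a\<^sup>2 / s) (w - (b / s) *\<^sub>R x)) \<partial>lborel)"
    by (simp add: gaussian_measure_density nn_integral_density mult.commute[of "ennreal (gauss_density 1 _)"]
        flip: ennreal_mult)
  also have "\<dots> = ennreal (gauss_density s x) * (\<integral>\<^sup>+w. ennreal (gauss_density (a\<^sup>2 / s) (w - (b / s) *\<^sub>R x)) \<partial>lborel)"
    by (rule nn_integral_cmult) simp
  also have "(\<integral>\<^sup>+w. ennreal (gauss_density (a\<^sup>2 / s) (w - (b / s) *\<^sub>R x)) \<partial>lborel)
      = (\<integral>\<^sup>+w. ennreal (gauss_density (a\<^sup>2 / s) (w :: 'v)) \<partial>lborel)"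
    by (subst nn_integral_lborel_affine[where r = 1 and c = "(b / s) *\<^sub>R x"]) simp_all
  also have "\<dots> = 1" using s assms by (intro nn_integral_gauss_density) simp
  finally show ?thesis by (simp add: s_def)
qed

lemma std_gauss_convolution:
  assumes "a > 0" "b > 0"
  shows "distr (std_gauss \<Otimes>\<^sub>M std_gauss) borel (\<lambda>(w, w'). a *\<^sub>R w + b *\<^sub>R w' :: 'v::euclidean_space)
    = distr std_gauss borel (\<lambda>w. sqrt (a\<^sup>2 + b\<^sup>2) *\<^sub>R w)"
proof (rule measure_eqI)
  interpret pair_sigma_finite "std_gauss :: 'v measure" "lborel :: 'v measure" ..
  interpret pp: pair_sigma_finite "std_gauss :: 'v measure" "std_gauss :: 'v measure" ..
  fix A :: "'v set"
  assume "A \<in> sets (distr (std_gauss \<Otimes>\<^sub>M std_gauss) borel (\<lambda>(w, w'). a *\<^sub>R w + b *\<^sub>R w'))"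
  then have [measurable]: "A \<in> sets borel" by simp
  have *: "(\<integral>\<^sup>+w. indicator A (a *\<^sub>R w + b *\<^sub>R w') \<partial>std_gauss)
      = (\<integral>\<^sup>+x. ennreal (gauss_density (a\<^sup>2) (x - b *\<^sub>R w')) * indicator A x \<partial>lborel)" for w'
  proof -
    have "(\<integral>\<^sup>+w. indicator A (a *\<^sub>R w + b *\<^sub>R w') \<partial>std_gauss)
        = (\<integral>\<^sup>+x. indicator A x \<partial>distr std_gauss borel (\<lambda>w. b *\<^sub>R w' + a *\<^sub>R w))"
      by (simp add: nn_integral_distr add.commute del: nn_integral_indicator)
    then show ?thesis
      using assms by (simp add: distr_std_gauss_affine nn_integral_density del: nn_integral_indicator)
  qed
  have "emeasure (distr (std_gauss \<Otimes>\<^sub>M std_gauss) borel (\<lambda>(w, w'). a *\<^sub>R w + b *\<^sub>R w')) A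
      = (\<integral>\<^sup>+w'. \<integral>\<^sup>+w. indicator A (a *\<^sub>R w + b *\<^sub>R w') \<partial>std_gauss \<partial>std_gauss)"
  proof -
    have "emeasure (distr (std_gauss \<Otimes>\<^sub>M std_gauss) borel (\<lambda>(w, w'). a *\<^sub>R w + b *\<^sub>R w')) A
        = (\<integral>\<^sup>+p. indicator A (a *\<^sub>R fst p + b *\<^sub>R snd p) \<partial>(std_gauss \<Otimes>\<^sub>M std_gauss))"
      by (subst nn_integral_indicator[symmetric], simp, subst nn_integral_distr) (simp_all add: split_beta)
    then show ?thesis
      by (simp add: pp.nn_integral_snd[symmetric] del: nn_integral_indicator)
  qed
  also have "\<dots> = (\<integral>\<^sup>+w'. \<integral>\<^sup>+x. ennreal (gauss_density (a\<^sup>2) (x - b *\<^sub>R w')) * indicator A x \<partial>lborel \<partial>std_gauss)"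
    by (simp add: *)
  also have "\<dots> = (\<integral>\<^sup>+x. \<integral>\<^sup>+w'. ennreal (gauss_density (a\<^sup>2) (x - b *\<^sub>R w')) * indicator A x \<partial>std_gauss \<partial>lborel)"
    by (rule Fubini'[symmetric]) measurable
  also have "\<dots> = (\<integral>\<^sup>+x. ennreal (gauss_density (a\<^sup>2 + b\<^sup>2) x) * indicator A x \<partial>lborel)"
    using assms by (simp add: nn_integral_multc gauss_density_convolution)
  also have "\<dots> = emeasure (distr std_gauss borel (\<lambda>w. 0 + sqrt (a\<^sup>2 + b\<^sup>2) *\<^sub>R w)) A"
    using assms by (subst distr_std_gauss_affine) (simp_all add: emeasure_density add_pos_pos)
  finally show "emeasure (distr (std_gauss \<Otimes>\<^sub>M std_gauss) borel (\<lambda>(w, w'). a *\<^sub>R w + b *\<^sub>R w')) A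
      = emeasure (distr std_gauss borel (\<lambda>w. sqrt (a\<^sup>2 + b\<^sup>2) *\<^sub>R w)) A" by simp
qed simp

section \<open>Gaussian smoothing of Lipschitz functions\<close>

text \<open>
  Second moments are bounded by exponential ones, which the shift formula yields exactly.
\<close>

lemma exp_plus_exp_minus_ge: "2 + x\<^sup>2 \<le> exp x + exp (- x)" for x :: real
proof -
  have "\<bar>x / 2\<bar> \<le> \<bar>(exp (x / 2) - inverse (exp (x / 2))) / 2\<bar>" by (rule real_le_abs_sinh)
  then have "\<bar>x\<bar> \<le> \<bar>exp (x / 2) - exp (- (x / 2))\<bar>" by (simp add: exp_minus)
  then have "x\<^sup>2 \<le> (exp (x / 2) - exp (- (x / 2)))\<^sup>2" by (simp add: abs_le_square_iff)
  also have "\<dots> = exp (x / 2) * exp (x / 2) - 2 * (exp (x / 2) * exp (- (x / 2))) + exp (- (x / 2)) * exp (- (x / 2))"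
    by (simp only: power2_diff power2_eq_square) (simp add: algebra_simps)
  also have "\<dots> = exp x - 2 + exp (- x)"
    unfolding exp_add[symmetric] by simp
  finally show ?thesis by simp
qed

lemma distr_std_gauss_uminus: "distr std_gauss borel uminus = (std_gauss :: 'v::euclidean_space measure)"
proof (rule measure_eqI)
  fix A :: "'v set" assume "A \<in> sets (distr std_gauss borel uminus)"
  then have [measurable]: "A \<in> sets borel" by simp
  have "emeasure std_gauss A = (\<integral>\<^sup>+x. ennreal (gauss_density 1 x) * indicator A x \<partial>lborel)"
    by (simp add: gaussian_measure_density emeasure_density)
  also have "\<dots> = (\<integral>\<^sup>+x. ennreal (gauss_density 1 x) * indicator A (- x) \<partial>lborel)"
    by (subst lborel_affine[of "-1" 0])
       (simp_all add: nn_integral_density nn_integral_distr gauss_density_def)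
  also have "\<dots> = emeasure (distr std_gauss borel uminus) A"
    by (subst nn_integral_indicator[symmetric], simp, subst nn_integral_distr)
       (simp_all add: gaussian_measure_density nn_integral_density del: nn_integral_indicator)
  finally show "emeasure (distr std_gauss borel uminus) A = emeasure std_gauss A" by simp
qed simp

lemma measure_std_gauss_UNIV [simp]: "measure std_gauss UNIV = 1"
  using std_gauss.prob_space by simp

lemma std_gauss_exp_moment:
  fixes a :: "'v::euclidean_space"
  shows integrable_std_gauss_exp: "integrable std_gauss (\<lambda>w. exp (a \<bullet> w))"
    and integral_std_gauss_exp: "(\<integral>w. exp (a \<bullet> w) \<partial>std_gauss) = exp ((norm a)\<^sup>2 / 2)"
proof -
  have "(\<integral>\<^sup>+w. ennreal (exp (a \<bullet> w - (norm a)\<^sup>2 / 2)) \<partial>std_gauss) = emeasure (distr std_gauss borel (\<lambda>w. w + a)) UNIV"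
    by (simp add: distr_std_gauss_shift emeasure_density)
  also have "\<dots> = 1" using std_gauss.emeasure_space_1 by (simp add: emeasure_distr)
  finally have 1: "(\<integral>\<^sup>+w. ennreal (exp (a \<bullet> w - (norm a)\<^sup>2 / 2)) \<partial>std_gauss) = 1" .
  have "(\<integral>\<^sup>+w. ennreal (exp (a \<bullet> w)) \<partial>std_gauss)
      = (\<integral>\<^sup>+w. ennreal (exp ((norm a)\<^sup>2 / 2)) * ennreal (exp (a \<bullet> w - (norm a)\<^sup>2 / 2)) \<partial>std_gauss)"
    by (simp add: exp_diff flip: ennreal_mult)
  also have "\<dots> = ennreal (exp ((norm a)\<^sup>2 / 2))"
    by (subst nn_integral_cmult) (simp_all add: 1)
  finally have "has_bochner_integral std_gauss (\<lambda>w. exp (a \<bullet> w)) (exp ((norm a)\<^sup>2 / 2))"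
    by (intro has_bochner_integral_nn_integral) simp_all
  then show "integrable std_gauss (\<lambda>w. exp (a \<bullet> w))"
    and "(\<integral>w. exp (a \<bullet> w) \<partial>std_gauss) = exp ((norm a)\<^sup>2 / 2)"
    by (auto simp: has_bochner_integral_iff)
qed

lemma std_gauss_inner_sq:
  fixes a :: "'v::euclidean_space"
  shows integrable_std_gauss_inner_sq: "integrable std_gauss (\<lambda>w. (a \<bullet> w)\<^sup>2)"
    and integral_std_gauss_inner_sq_le: "(\<integral>w. (a \<bullet> w)\<^sup>2 \<partial>std_gauss) \<le> 2 * exp ((norm a)\<^sup>2 / 2) - 2"
proof -
  have le: "(a \<bullet> w)\<^sup>2 \<le> exp (a \<bullet> w) + exp ((- a) \<bullet> w) - 2" for w
    using exp_plus_exp_minus_ge[of "a \<bullet> w"] by simp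
  have int: "integrable std_gauss (\<lambda>w. exp (a \<bullet> w) + exp ((- a) \<bullet> w) - 2)"
    by (intro Bochner_Integration.integrable_add Bochner_Integration.integrable_diff integrable_std_gauss_exp) simp
  show i: "integrable std_gauss (\<lambda>w. (a \<bullet> w)\<^sup>2)"
    by (rule Bochner_Integration.integrable_bound[OF int]) (use le in \<open>auto intro: order_trans[OF _ abs_ge_self]\<close>)
  have "(\<integral>w. (a \<bullet> w)\<^sup>2 \<partial>std_gauss) \<le> (\<integral>w. exp (a \<bullet> w) + exp ((- a) \<bullet> w) - 2 \<partial>std_gauss)"
    by (rule integral_mono[OF i int le])
  also have "\<dots> = 2 * exp ((norm a)\<^sup>2 / 2) - 2"
    using integral_std_gauss_exp[of a] integral_std_gauss_exp[of "- a"]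
      integrable_std_gauss_exp[of a] integrable_std_gauss_exp[of "- a"]
    by (subst Bochner_Integration.integral_diff, force, force, subst Bochner_Integration.integral_add)
       simp_all
  finally show "(\<integral>w. (a \<bullet> w)\<^sup>2 \<partial>std_gauss) \<le> 2 * exp ((norm a)\<^sup>2 / 2) - 2" .
qed

lemma integrable_std_gauss_norm_sq: "integrable std_gauss (\<lambda>w :: 'v::euclidean_space. (norm w)\<^sup>2)"
proof -
  have "(norm w)\<^sup>2 = (\<Sum>b\<in>Basis. (b \<bullet> w)\<^sup>2)" for w :: 'v
    by (simp only: power2_norm_eq_inner euclidean_inner[of w w]) (simp add: power2_eq_square inner_commute)
  then show ?thesis by (simp add: integrable_std_gauss_inner_sq)
qed

lemma integrable_std_gauss_norm: "integrable std_gauss (\<lambda>w :: 'v::euclidean_space. norm w)"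
proof (rule Bochner_Integration.integrable_bound)
  show "integrable std_gauss (\<lambda>w :: 'v. 1 + (norm w)\<^sup>2)" by (simp add: integrable_std_gauss_norm_sq)
  have "x \<le> 1 + x\<^sup>2" for x :: real
    using zero_le_power2[of "x - 1/2"] by (simp add: power2_eq_square algebra_simps)
  then show "AE w in std_gauss. norm (norm (w :: 'v)) \<le> norm (1 + (norm w)\<^sup>2)" by simp
qed simp

lemma integrable_std_gauss_id: "integrable std_gauss (\<lambda>w :: 'v::euclidean_space. w)"
  using integrable_std_gauss_norm by (rule integrable_norm_cancel) simp

lemma integrable_std_gauss_inner: "integrable std_gauss (\<lambda>w. (a :: 'v::euclidean_space) \<bullet> w)"
  by (rule integrable_inner_right) (rule integrable_std_gauss_id)

lemma integral_std_gauss_inner: "(\<integral>w. (a :: 'v::euclidean_space) \<bullet> w \<partial>std_gauss) = 0"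
proof -
  have "(\<integral>w. a \<bullet> w \<partial>std_gauss) = (\<integral>w. a \<bullet> w \<partial>distr std_gauss borel uminus)"
    by (simp add: distr_std_gauss_uminus)
  also have "\<dots> = - (\<integral>w. a \<bullet> w \<partial>std_gauss)" by (subst integral_distr) simp_all
  finally show ?thesis by simp
qed

lemma integral_std_gauss_shift:
  fixes F :: "'v::euclidean_space \<Rightarrow> real"
  assumes [measurable]: "F \<in> borel_measurable borel"
  shows "(\<integral>w. F (w + a) \<partial>std_gauss) = (\<integral>w. exp (a \<bullet> w - (norm a)\<^sup>2 / 2) * F w \<partial>std_gauss)"
proof -
  have "(\<integral>w. F (w + a) \<partial>std_gauss) = (\<integral>w. F w \<partial>distr std_gauss borel (\<lambda>w. w + a))"
    by (subst integral_distr) simp_all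
  then show ?thesis by (simp add: distr_std_gauss_shift integral_density)
qed

text \<open>
  The error of the first-order expansion in \<open>a\<close> of the Cameron-Martin density.
\<close>

definition shift_remainder :: "'v::euclidean_space \<Rightarrow> 'v \<Rightarrow> real" where
  "shift_remainder a w = exp (a \<bullet> w - (norm a)\<^sup>2 / 2) - 1 - a \<bullet> w"

lemma shift_remainder_measurable [measurable]: "shift_remainder a \<in> borel_measurable borel"
  unfolding shift_remainder_def by measurable

text \<open>
  All moments come from exponential ones. In the mean of the square, the terms of order \<open>|a|\<^sup>2\<close> cancel.
\<close>

lemma shift_remainder_moments:
  fixes a :: "'v::euclidean_space"
  shows integrable_shift_remainder: "integrable std_gauss (shift_remainder a)"
    and integral_shift_remainder: "(\<integral>w. shift_remainder a w \<partial>std_gauss) = 0"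
    and integrable_shift_remainder_sq: "integrable std_gauss (\<lambda>w. (shift_remainder a w)\<^sup>2)"
    and integral_shift_remainder_sq:
      "norm a \<le> 1 \<Longrightarrow> (\<integral>w. (shift_remainder a w)\<^sup>2 \<partial>std_gauss) \<le> 3 / 2 * (norm a) ^ 4"
proof -
  define s where "s = (norm a)\<^sup>2"
  define R where "R w = exp (a \<bullet> w - s / 2)" for w
  have R_eq: "R w = exp (a \<bullet> w) * exp (- s / 2)" for w by (simp add: R_def flip: exp_add)
  have R2_eq: "(R w)\<^sup>2 = exp ((2 *\<^sub>R a) \<bullet> w) * exp (- s)" for w
    by (simp add: R_def power2_eq_square flip: exp_add)
  have iR: "integrable std_gauss R" unfolding R_eq by (simp add: integrable_std_gauss_exp)
  have eR: "(\<integral>w. R w \<partial>std_gauss) = 1"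
    unfolding R_eq using integral_std_gauss_exp[of a] by (simp add: s_def exp_minus)
  have iR2: "integrable std_gauss (\<lambda>w. (R w)\<^sup>2)"
    unfolding R2_eq using integrable_std_gauss_exp[of "2 *\<^sub>R a"] by simp
  have eR2: "(\<integral>w. (R w)\<^sup>2 \<partial>std_gauss) = exp s"
  proof -
    have "(\<integral>w. exp ((2 *\<^sub>R a) \<bullet> w) * exp (- s) \<partial>std_gauss) = exp (2 * s) * exp (- s)"
      using integral_std_gauss_exp[of "2 *\<^sub>R a"] by (simp add: s_def)
    then show ?thesis unfolding R2_eq by (simp flip: exp_add)
  qed
  have il: "integrable std_gauss (\<lambda>w. a \<bullet> w)" by (rule integrable_std_gauss_inner)
  have [measurable]: "R \<in> borel_measurable borel" unfolding R_def[abs_def] by measurable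
  have iRl: "integrable std_gauss (\<lambda>w. R w * (a \<bullet> w))"
  proof (rule Bochner_Integration.integrable_bound)
    show "integrable std_gauss (\<lambda>w. (R w)\<^sup>2 + (a \<bullet> w)\<^sup>2)"
      using iR2 integrable_std_gauss_inner_sq[of a] by simp
    have "\<bar>x * y\<bar> \<le> x\<^sup>2 + y\<^sup>2" for x y :: real
    proof -
      have "2 * \<bar>x * y\<bar> \<le> x\<^sup>2 + y\<^sup>2"
        using sum_squares_bound[of "\<bar>x\<bar>" "\<bar>y\<bar>"] by (simp add: abs_mult)
      then show ?thesis by linarith
    qed
    then show "AE w in std_gauss. norm (R w * (a \<bullet> w)) \<le> norm ((R w)\<^sup>2 + (a \<bullet> w)\<^sup>2)" by simp
  qed simp
  have eRl: "(\<integral>w. R w * (a \<bullet> w) \<partial>std_gauss) = s"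
  proof -
    have "(\<integral>w. R w * (a \<bullet> w) \<partial>std_gauss) = (\<integral>w. a \<bullet> (w + a) \<partial>std_gauss)"
      unfolding R_def s_def by (rule integral_std_gauss_shift[symmetric]) simp
    then show ?thesis
      using il by (simp add: inner_add_right integral_std_gauss_inner s_def power2_norm_eq_inner)
  qed
  have eq: "shift_remainder a w = R w - 1 - a \<bullet> w" for w by (simp add: shift_remainder_def R_def s_def)
  show "integrable std_gauss (shift_remainder a)"
    unfolding shift_remainder_def[abs_def] using iR il by (simp add: R_def[abs_def] s_def)
  show "(\<integral>w. shift_remainder a w \<partial>std_gauss) = 0"
    unfolding eq using iR il by (simp add: eR integral_std_gauss_inner)
  have sq: "(shift_remainder a w)\<^sup>2
      = (R w)\<^sup>2 + (a \<bullet> w)\<^sup>2 + 1 - 2 * R w - 2 * (R w * (a \<bullet> w)) + 2 * (a \<bullet> w)" for w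
    unfolding eq by (simp add: power2_eq_square algebra_simps)
  show "integrable std_gauss (\<lambda>w. (shift_remainder a w)\<^sup>2)"
    unfolding sq using iR iR2 il iRl integrable_std_gauss_inner_sq[of a] by simp
  assume a: "norm a \<le> 1"
  have s1: "0 \<le> s" "s \<le> 1" using a by (simp_all add: s_def power_le_one)
  have "(\<integral>w. (shift_remainder a w)\<^sup>2 \<partial>std_gauss)
      = exp s + (\<integral>w. (a \<bullet> w)\<^sup>2 \<partial>std_gauss) + 1 - 2 - 2 * s"
    unfolding sq using iR iR2 il iRl integrable_std_gauss_inner_sq[of a]
    by (simp add: eR eR2 eRl integral_std_gauss_inner)
  also have "\<dots> \<le> exp s + (2 * exp (s / 2) - 2) + 1 - 2 - 2 * s"
    using integral_std_gauss_inner_sq_le[of a] by (simp add: s_def)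
  also have "\<dots> \<le> 3 / 2 * s\<^sup>2"
    using exp_bound[of s] exp_bound[of "s / 2"] s1 by (simp add: power_divide)
  finally show "(\<integral>w. (shift_remainder a w)\<^sup>2 \<partial>std_gauss) \<le> 3 / 2 * (norm a) ^ 4"
    by (simp add: s_def flip: power_mult)
qed

text \<open>
  The mean square of a standard Gaussian vector, that is \<open>DIM('v)\<close>; it enters every estimate as a constant.
\<close>

definition gauss_moment2 :: "'v::euclidean_space itself \<Rightarrow> real" where
  "gauss_moment2 _ = (\<integral>w. (norm (w :: 'v))\<^sup>2 \<partial>std_gauss)"

lemma gauss_moment2_nonneg: "gauss_moment2 TYPE('v::euclidean_space) \<ge> 0"
  unfolding gauss_moment2_def by simp

text \<open>
  A Lipschitz function smoothed at scale \<open>r\<close> has a first-order expansion with gradient \<open>D\<close> and a second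
  derivative of size \<open>L / r\<close>. The displacement \<open>e = r a\<close> is moved onto the Gaussian by the shift formula,
  and \<open>D\<close> collects the linear part of the density. The remainder of the density has mean zero, so
  \<open>u c\<close> may be subtracted from \<open>u (c + r w)\<close>; the difference is at most \<open>L r |w|\<close>.
\<close>

lemma gauss_smoothing_expansion:
  fixes u :: "'v::euclidean_space \<Rightarrow> real"
  assumes lip: "L-lipschitz_on UNIV u" and bdd: "\<And>x. \<bar>u x\<bar> \<le> B" and r: "r > 0"
  obtains D where "\<And>e. norm e \<le> r \<Longrightarrow>
    \<bar>(\<integral>w. u (c + e + r *\<^sub>R w) \<partial>std_gauss) - (\<integral>w. u (c + r *\<^sub>R w) \<partial>std_gauss) - D \<bullet> e\<bar>
      \<le> (gauss_moment2 TYPE('v) + 1) * L * (norm e)\<^sup>2 / r"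
proof
  have L: "L \<ge> 0" using lip by (rule lipschitz_on_nonneg)
  have [measurable]: "u \<in> borel_measurable borel"
    by (intro borel_measurable_continuous_onI lipschitz_on_continuous_on[OF lip])
  define D where "D = (1 / r) *\<^sub>R (\<integral>w. u (c + r *\<^sub>R w) *\<^sub>R w \<partial>std_gauss)"
  have ib: "integrable std_gauss (\<lambda>w. u (f w) * g w)"
    if "integrable std_gauss g" "f \<in> borel_measurable borel" for f :: "'v \<Rightarrow> 'v" and g :: "'v \<Rightarrow> real"
  proof (rule Bochner_Integration.integrable_bound)
    show "integrable std_gauss (\<lambda>w. B * g w)" using that by simp
    show "AE w in std_gauss. norm (u (f w) * g w) \<le> norm (B * g w)"
    proof (rule AE_I2)
      fix w
      have "\<bar>u (f w)\<bar> \<le> \<bar>B\<bar>" using bdd[of "f w"] by linarith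
      then show "norm (u (f w) * g w) \<le> norm (B * g w)" by (simp add: abs_mult mult_right_mono)
    qed
    have [measurable]: "f \<in> borel_measurable borel" "g \<in> borel_measurable borel"
      using that borel_measurable_integrable[OF that(1)] by simp_all
    show "(\<lambda>w. u (f w) * g w) \<in> borel_measurable std_gauss" by simp
  qed
  fix e :: 'v assume e: "norm e \<le> r"
  show "\<bar>(\<integral>w. u (c + e + r *\<^sub>R w) \<partial>std_gauss) - (\<integral>w. u (c + r *\<^sub>R w) \<partial>std_gauss) - D \<bullet> e\<bar>
      \<le> (gauss_moment2 TYPE('v) + 1) * L * (norm e)\<^sup>2 / r"
  proof (cases "e = 0")
    case False
    define a where "a = (1 / r) *\<^sub>R e"
    define s where "s = (norm a)\<^sup>2"
    have a: "norm a \<le> 1" and s: "s > 0" using e r False by (simp_all add: a_def s_def)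
    have "(\<integral>w. u (c + e + r *\<^sub>R w) \<partial>std_gauss) = (\<integral>w. u (c + r *\<^sub>R (w + a)) \<partial>std_gauss)"
      using r by (simp add: a_def scaleR_add_right algebra_simps)
    also have "\<dots> = (\<integral>w. exp (a \<bullet> w - (norm a)\<^sup>2 / 2) * u (c + r *\<^sub>R w) \<partial>std_gauss)"
      by (rule integral_std_gauss_shift) simp
    finally have 1: "(\<integral>w. u (c + e + r *\<^sub>R w) \<partial>std_gauss)
      = (\<integral>w. u (c + r *\<^sub>R w) * exp (a \<bullet> w - (norm a)\<^sup>2 / 2) \<partial>std_gauss)" by (simp add: mult.commute)
    have iw: "integrable std_gauss (\<lambda>w. u (c + r *\<^sub>R w) *\<^sub>R w)"
    proof -
      have "integrable std_gauss (\<lambda>w. norm (u (c + r *\<^sub>R w) *\<^sub>R w))"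
        using integrable_norm[OF ib[OF integrable_std_gauss_norm, of "\<lambda>w. c + r *\<^sub>R w"]]
        by (simp add: abs_mult)
      then show ?thesis by (rule integrable_norm_cancel) simp
    qed
    have "D \<bullet> e = (\<integral>w. u (c + r *\<^sub>R w) *\<^sub>R w \<partial>std_gauss) \<bullet> a" by (simp add: D_def a_def)
    also have "\<dots> = (\<integral>w. (u (c + r *\<^sub>R w) *\<^sub>R w) \<bullet> a \<partial>std_gauss)"
      using iw by (intro integral_inner_left[symmetric])
    also have "\<dots> = (\<integral>w. u (c + r *\<^sub>R w) * (a \<bullet> w) \<partial>std_gauss)" by (simp add: inner_commute)
    finally have 2: "D \<bullet> e = (\<integral>w. u (c + r *\<^sub>R w) * (a \<bullet> w) \<partial>std_gauss)" .
    have ie: "integrable std_gauss (\<lambda>w. exp (a \<bullet> w - (norm a)\<^sup>2 / 2))"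
      using integrable_std_gauss_exp[of a] by (simp add: exp_diff)
    have i1: "integrable std_gauss (\<lambda>w. u (c + r *\<^sub>R w) * exp (a \<bullet> w - (norm a)\<^sup>2 / 2))"
      by (rule ib[OF ie]) simp
    have i2: "integrable std_gauss (\<lambda>w. u (c + r *\<^sub>R w) * (a \<bullet> w))"
      by (intro ib integrable_std_gauss_inner) simp
    have i3: "integrable std_gauss (\<lambda>w. u (c + r *\<^sub>R w))"
      using ib[of "\<lambda>_. 1" "\<lambda>w. c + r *\<^sub>R w"] by simp
    have i4: "integrable std_gauss (\<lambda>w. (u (c + r *\<^sub>R w) - u c) * shift_remainder a w)"
      using ib[OF integrable_shift_remainder, of "\<lambda>w. c + r *\<^sub>R w" a] integrable_shift_remainder[of a]
      by (simp add: left_diff_distrib)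
    have "(\<integral>w. u (c + e + r *\<^sub>R w) \<partial>std_gauss) - (\<integral>w. u (c + r *\<^sub>R w) \<partial>std_gauss) - D \<bullet> e
        = (\<integral>w. u (c + r *\<^sub>R w) * shift_remainder a w \<partial>std_gauss)"
      unfolding 1 2 shift_remainder_def right_diff_distrib using i1 i2 i3 by simp
    also have "\<dots> = (\<integral>w. (u (c + r *\<^sub>R w) - u c) * shift_remainder a w \<partial>std_gauss)"
      unfolding left_diff_distrib
      using ib[OF integrable_shift_remainder, of "\<lambda>w. c + r *\<^sub>R w" a]
      by (simp add: integrable_shift_remainder integral_shift_remainder)
    also have "\<bar>\<dots>\<bar> \<le> (\<integral>w. L * r * (s * (norm w)\<^sup>2 / 2 + (shift_remainder a w)\<^sup>2 / (2 * s)) \<partial>std_gauss)"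
    proof (rule order_trans[OF integral_abs_bound], rule integral_mono)
      show "integrable std_gauss (\<lambda>w. \<bar>(u (c + r *\<^sub>R w) - u c) * shift_remainder a w\<bar>)"
        using i4 by (rule integrable_abs)
      show "integrable std_gauss (\<lambda>w. L * r * (s * (norm w)\<^sup>2 / 2 + (shift_remainder a w)\<^sup>2 / (2 * s)))"
        by (simp add: integrable_std_gauss_norm_sq integrable_shift_remainder_sq)
      fix w
      have "\<bar>u (c + r *\<^sub>R w) - u c\<bar> \<le> L * r * norm w"
        using lipschitz_onD[OF lip, of "c + r *\<^sub>R w" c] r by (simp add: dist_norm)
      then have "\<bar>(u (c + r *\<^sub>R w) - u c) * shift_remainder a w\<bar> \<le> L * r * norm w * \<bar>shift_remainder a w\<bar>"
        by (simp add: abs_mult mult_right_mono)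
      also have "\<dots> = L * r * (norm w * \<bar>shift_remainder a w\<bar>)" by simp
      also have "\<dots> \<le> L * r * (s * (norm w)\<^sup>2 / 2 + (shift_remainder a w)\<^sup>2 / (2 * s))"
      proof -
        have "x * y \<le> s * x\<^sup>2 / 2 + y\<^sup>2 / (2 * s)" for x y :: real
        proof -
          have "0 \<le> (s * x - y)\<^sup>2 / (2 * s)" using s by simp
          then show ?thesis using s by (simp add: power2_eq_square field_simps)
        qed
        from this[of "norm w" "\<bar>shift_remainder a w\<bar>"] show ?thesis
          using L r by (intro mult_left_mono) simp_all
      qed
      finally show "\<bar>(u (c + r *\<^sub>R w) - u c) * shift_remainder a w\<bar>
        \<le> L * r * (s * (norm w)\<^sup>2 / 2 + (shift_remainder a w)\<^sup>2 / (2 * s))" .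
    qed
    also have "\<dots> = L * r * (s * gauss_moment2 TYPE('v) / 2 + (\<integral>w. (shift_remainder a w)\<^sup>2 \<partial>std_gauss) / (2 * s))"
      by (simp add: integrable_std_gauss_norm_sq integrable_shift_remainder_sq gauss_moment2_def)
    also have "\<dots> \<le> L * r * (s * gauss_moment2 TYPE('v) + s)"
    proof -
      have "(\<integral>w. (shift_remainder a w)\<^sup>2 \<partial>std_gauss) / (2 * s) \<le> (3 / 2 * s\<^sup>2) / (2 * s)"
        using integral_shift_remainder_sq[OF a] s
        by (intro divide_right_mono) (simp_all add: s_def flip: power_mult)
      also have "\<dots> = 3 / 4 * s" using s by (simp add: power2_eq_square)
      finally have "(\<integral>w. (shift_remainder a w)\<^sup>2 \<partial>std_gauss) / (2 * s) \<le> s" using s by simp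
      moreover have "s * gauss_moment2 TYPE('v) \<ge> 0"
        using s gauss_moment2_nonneg[where 'v = 'v] by (intro mult_nonneg_nonneg) simp_all
      ultimately show ?thesis using L r by (intro mult_left_mono) simp_all
    qed
    also have "\<dots> = (gauss_moment2 TYPE('v) + 1) * L * (norm e)\<^sup>2 / r"
      using r by (simp add: s_def a_def power_mult_distrib power_divide field_simps power2_eq_square)
    finally show ?thesis .
  qed simp
qed

section \<open>Gaussian mixtures and posterior means\<close>

text \<open>
  The density at \<open>x\<close> of a Gaussian with mean \<open>b y\<close> and variance \<open>v\<close>, scaled to have maximum \<open>1\<close>.
\<close>

definition gkern :: "real \<Rightarrow> real \<Rightarrow> 'v::euclidean_space \<Rightarrow> 'v \<Rightarrow> real" where
  "gkern b v x y = exp (- (norm (x - b *\<^sub>R y))\<^sup>2 / (2 * v))"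

text \<open>
  The conditional mean of \<open>y\<close> given \<open>b y + \<surd>v G = x\<close>, where \<open>y\<close> has the prior law \<open>\<nu>\<close> and
  \<open>G\<close> is an independent standard Gaussian.
\<close>

definition post_mean :: "'v::euclidean_space measure \<Rightarrow> real \<Rightarrow> real \<Rightarrow> 'v \<Rightarrow> 'v" where
  "post_mean \<nu> b v x = (1 / (\<integral>y. gkern b v x y \<partial>\<nu>)) *\<^sub>R (\<integral>y. gkern b v x y *\<^sub>R y \<partial>\<nu>)"

definition gauss_mixture :: "'v::euclidean_space measure \<Rightarrow> real \<Rightarrow> real \<Rightarrow> 'v measure" where
  "gauss_mixture \<nu> b v = distr (\<nu> \<Otimes>\<^sub>M std_gauss) borel (\<lambda>(y, w). b *\<^sub>R y + sqrt v *\<^sub>R w)"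

definition gauss_smooth :: "real \<Rightarrow> ('v::euclidean_space \<Rightarrow> real) \<Rightarrow> 'v \<Rightarrow> real" where
  "gauss_smooth r u x = (\<integral>w. u (x + r *\<^sub>R w) \<partial>std_gauss)"

lemma gkern_pos: "gkern b v x y > 0"
  and gkern_le_1: "v > 0 \<Longrightarrow> gkern b v x y \<le> 1"
  by (simp_all add: gkern_def)

lemma gauss_density_gkern:
  "gauss_density v (x - b *\<^sub>R y) = (2 * pi * v) powr (- real DIM('v) / 2) * gkern b v x (y :: 'v::euclidean_space)"
  by (simp add: gauss_density_def gkern_def)

lemma gkern_measurable [measurable]:
  "(\<lambda>p. gkern b v (fst p) (snd p)) \<in> borel_measurable (borel \<Otimes>\<^sub>M borel)"
  "gkern b v x \<in> borel_measurable borel"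
  unfolding gkern_def[abs_def] by measurable

text \<open>
  Seen as a weight in \<open>y\<close>, moving the observation from \<open>x'\<close> to \<open>x\<close> is an exponential tilt, because the
  term quadratic in \<open>y\<close> does not depend on the observation.
\<close>

lemma gkern_tilt:
  assumes "v \<noteq> 0"
  shows "gkern b v x y = exp (((norm x')\<^sup>2 - (norm x)\<^sup>2) / (2 * v)) * (gkern b v x' y * exp (((b / v) *\<^sub>R (x - x')) \<bullet> y))"
proof -
  have "- (norm (x - b *\<^sub>R y))\<^sup>2 / (2 * v) = ((norm x')\<^sup>2 - (norm x)\<^sup>2) / (2 * v)
      + (- (norm (x' - b *\<^sub>R y))\<^sup>2 / (2 * v) + ((b / v) *\<^sub>R (x - x')) \<bullet> y)"
  proof -
    have *: "(norm (c - b *\<^sub>R y))\<^sup>2 = (norm c)\<^sup>2 - 2 * b * (c \<bullet> y) + b\<^sup>2 * (norm y)\<^sup>2" for c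
      by (simp add: power2_norm_eq_inner inner_diff inner_commute) (simp add: power2_eq_square)
    show ?thesis
      unfolding * using assms by (simp add: inner_diff_left diff_divide_distrib add_divide_distrib right_diff_distrib)
  qed
  then show ?thesis unfolding gkern_def exp_add[symmetric] by simp
qed

lemma abs_exp_minus_1_le:
  assumes "\<bar>u\<bar> \<le> (1 :: real)"
  shows "\<bar>exp u - 1\<bar> \<le> exp 1 * \<bar>u\<bar>"
proof -
  have 1: "u \<le> exp u - 1" using exp_ge_add_one_self[of u] by linarith
  have "exp u * (1 - u) \<le> exp u * exp (- u)"
    using exp_ge_add_one_self[of "- u"] by (intro mult_left_mono) simp_all
  then have "exp u * (1 - u) \<le> 1" by (simp add: exp_minus)
  then have 2: "exp u - 1 \<le> exp u * u" by (simp add: algebra_simps)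
  have 3: "exp u * u \<le> exp 1 * \<bar>u\<bar>"
  proof -
    have "exp u * u \<le> exp u * \<bar>u\<bar>" by (intro mult_left_mono) simp_all
    also have "\<dots> \<le> exp 1 * \<bar>u\<bar>" using assms by (intro mult_right_mono) simp_all
    finally show ?thesis .
  qed
  have "\<bar>u\<bar> \<le> exp 1 * \<bar>u\<bar>" using mult_right_mono[of 1 "exp 1" "\<bar>u\<bar>"] by simp
  then show ?thesis using 1 2 3 by linarith
qed

locale bounded_law = prob_space \<nu> for \<nu> :: "'v::euclidean_space measure" +
  fixes K :: real
  assumes sets_law [simp, measurable_cong]: "sets \<nu> = sets borel"
    and bounded: "AE y in \<nu>. norm y \<le> K"
begin

lemma space_law [simp]: "space \<nu> = UNIV"
  using sets_eq_imp_space_eq[OF sets_law] by simp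

lemma K_nonneg: "K \<ge> 0"
proof -
  have "AE y in \<nu>. 0 \<le> K" using bounded by eventually_elim (meson norm_ge_zero order_trans)
  then show ?thesis by simp
qed

lemma integrable_gkern: "v > 0 \<Longrightarrow> integrable \<nu> (gkern b v x)"
  by (rule integrable_const_bound[of _ 1]) (simp_all add: gkern_le_1 gkern_pos less_imp_le)

lemma integral_gkern_pos:
  assumes "v > 0" shows "(\<integral>y. gkern b v x y \<partial>\<nu>) > 0"
proof -
  have "emeasure \<nu> {y. gkern b v x y > 0} = 1"
    using emeasure_space_1 by (simp add: gkern_pos)
  then show ?thesis
    using integral_less_AE_space[of "\<lambda>_. 0" "gkern b v x"] integrable_gkern[OF assms, of b x] emeasure_space_1
    by (simp add: gkern_pos)
qed

lemma integrable_gkern_mult: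
  fixes f :: "'v \<Rightarrow> 'b::{banach, second_countable_topology}"
  assumes "v > 0" and [measurable]: "f \<in> borel_measurable borel" and "AE y in \<nu>. norm (f y) \<le> B"
  shows "integrable \<nu> (\<lambda>y. gkern b v x y *\<^sub>R f y)"
proof (rule integrable_const_bound)
  show "AE y in \<nu>. norm (gkern b v x y *\<^sub>R f y) \<le> B"
    using assms(3)
  proof eventually_elim
    case (elim y)
    have "gkern b v x y * norm (f y) \<le> 1 * norm (f y)"
      using gkern_le_1[OF assms(1)] by (intro mult_right_mono) simp_all
    then show ?case using elim gkern_pos[of b v x y] by simp
  qed
qed simp

lemma norm_integral_gkern_le:
  fixes f :: "'v \<Rightarrow> 'b::{banach, second_countable_topology}"
  assumes "v > 0" and [measurable]: "f \<in> borel_measurable borel" and B: "AE y in \<nu>. norm (f y) \<le> B"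
  shows "norm (\<integral>y. gkern b v x y *\<^sub>R f y \<partial>\<nu>) \<le> B * (\<integral>y. gkern b v x y \<partial>\<nu>)"
proof -
  have "norm (\<integral>y. gkern b v x y *\<^sub>R f y \<partial>\<nu>) \<le> (\<integral>y. gkern b v x y * B \<partial>\<nu>)"
  proof (rule order_trans[OF integral_norm_bound integral_mono_AE])
    show "integrable \<nu> (\<lambda>y. norm (gkern b v x y *\<^sub>R f y))"
      by (intro integrable_norm integrable_gkern_mult[OF assms])
    show "integrable \<nu> (\<lambda>y. gkern b v x y * B)" using integrable_gkern[OF assms(1)] by simp
    show "AE y in \<nu>. norm (gkern b v x y *\<^sub>R f y) \<le> gkern b v x y * B"
      using B by eventually_elim (simp add: gkern_pos less_imp_le mult_left_mono)
  qed
  then show ?thesis by (simp add: mult.commute)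
qed

lemma norm_post_mean_le:
  assumes "v > 0" shows "norm (post_mean \<nu> b v x) \<le> K"
  using norm_integral_gkern_le[OF assms _ bounded, of b x] integral_gkern_pos[OF assms, of b x]
  by (simp add: post_mean_def field_simps)

lemma post_mean_centred:
  assumes "v > 0" shows "(\<integral>y. gkern b v x y *\<^sub>R (y - post_mean \<nu> b v x) \<partial>\<nu>) = 0"
proof -
  have "(\<integral>y. gkern b v x y *\<^sub>R (y - post_mean \<nu> b v x) \<partial>\<nu>)
      = (\<integral>y. gkern b v x y *\<^sub>R y \<partial>\<nu>) - (\<integral>y. gkern b v x y \<partial>\<nu>) *\<^sub>R post_mean \<nu> b v x"
    using integrable_gkern_mult[OF assms _ bounded] integrable_gkern[OF assms]
    by (simp add: scaleR_diff_right)
  then show ?thesis using integral_gkern_pos[OF assms, of b x] by (simp add: post_mean_def)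
qed

lemma AE_norm_diff_post_mean: "v > 0 \<Longrightarrow> AE y in \<nu>. norm (y - post_mean \<nu> b v x) \<le> 2 * K"
  using bounded
proof eventually_elim
  case (elim y)
  then show ?case using norm_triangle_ineq4[of y "post_mean \<nu> b v x"] norm_post_mean_le[of v b x] by linarith
qed

text \<open>
  Moving the observation tilts the posterior by \<open>exp (z \<bullet> y)\<close> with \<open>z = (b / v) (x - x')\<close>. If \<open>|z| K \<le> 1\<close>, centring at
  the old mean \<open>m'\<close> leaves only \<open>exp (z \<bullet> y) - 1\<close>, which is of order \<open>|z| K\<close>; otherwise the bound
  \<open>2 K\<close> for the distance of two posterior means is already small enough.
\<close>

lemma post_mean_lipschitz:
  assumes v: "v > 0" and b: "b \<ge> 0"
  shows "(2 * (exp 1)\<^sup>2 * K\<^sup>2 * (b / v))-lipschitz_on UNIV (post_mean \<nu> b v)"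
proof (rule lipschitz_onI)
  fix x x' :: 'v
  define z where "z = (b / v) *\<^sub>R (x - x')"
  define m' where "m' = post_mean \<nu> b v x'"
  have nz: "norm z = (b / v) * norm (x - x')" using v b by (simp add: z_def)
  have "norm (post_mean \<nu> b v x - m') \<le> 2 * (exp 1)\<^sup>2 * K\<^sup>2 * norm z"
  proof (cases "norm z * K \<le> 1")
    case False
    have e: "1 \<le> (exp (1 :: real))\<^sup>2" by (simp add: one_le_power)
    have "norm (post_mean \<nu> b v x - m') \<le> 2 * K * 1"
      using norm_triangle_ineq4[of "post_mean \<nu> b v x" m'] norm_post_mean_le[OF v, of b x] norm_post_mean_le[OF v, of b x']
      unfolding m'_def by linarith
    also have "\<dots> \<le> 2 * K * (norm z * K)" using False K_nonneg by (intro mult_left_mono) simp_all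
    also have "\<dots> = 1 * (2 * K * (norm z * K))" by simp
    also have "\<dots> \<le> (exp 1)\<^sup>2 * (2 * K * (norm z * K))"
      using e K_nonneg by (intro mult_right_mono) simp_all
    also have "\<dots> = 2 * (exp 1)\<^sup>2 * K\<^sup>2 * norm z" by (simp add: power2_eq_square)
    finally show ?thesis .
  next
    case True
    define c where "c = exp (((norm x')\<^sup>2 - (norm x)\<^sup>2) / (2 * v))"
    define k where "k y = gkern b v x' y" for y
    define I where "I = (\<integral>y. k y \<partial>\<nu>)"
    have I: "I > 0" unfolding I_def k_def by (rule integral_gkern_pos[OF v])
    have c: "c > 0" by (simp add: c_def)
    have g: "gkern b v x y = c * (k y * exp (z \<bullet> y))" for y
      unfolding c_def k_def z_def using v by (intro gkern_tilt) simp
    have zy: "AE y in \<nu>. \<bar>z \<bullet> y\<bar> \<le> norm z * K \<and> \<bar>z \<bullet> y\<bar> \<le> 1"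
      using bounded
    proof eventually_elim
      case (elim y)
      have "\<bar>z \<bullet> y\<bar> \<le> norm z * norm y" by (rule Cauchy_Schwarz_ineq2)
      also have "\<dots> \<le> norm z * K" using elim by (intro mult_left_mono) simp_all
      finally show ?case using True by simp
    qed
    have dm: "AE y in \<nu>. norm (y - m') \<le> 2 * K" unfolding m'_def by (rule AE_norm_diff_post_mean[OF v])
    have bd1: "AE y in \<nu>. norm (exp (z \<bullet> y) *\<^sub>R (y - m')) \<le> exp 1 * (2 * K)"
      using zy dm
    proof eventually_elim
      case (elim y)
      have "exp (z \<bullet> y) * norm (y - m') \<le> exp 1 * (2 * K)" using elim by (intro mult_mono) auto
      then show ?case by simp
    qed
    have bd2: "AE y in \<nu>. norm ((exp (z \<bullet> y) - 1) *\<^sub>R (y - m')) \<le> exp 1 * (norm z * K) * (2 * K)"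
      using zy dm
    proof eventually_elim
      case (elim y)
      have "\<bar>exp (z \<bullet> y) - 1\<bar> \<le> exp 1 * \<bar>z \<bullet> y\<bar>" using elim by (intro abs_exp_minus_1_le) simp
      also have "\<dots> \<le> exp 1 * (norm z * K)" using elim by (intro mult_left_mono) simp_all
      finally have "\<bar>exp (z \<bullet> y) - 1\<bar> * norm (y - m') \<le> (exp 1 * (norm z * K)) * (2 * K)"
        using elim K_nonneg by (intro mult_mono) auto
      then show ?case by simp
    qed
    define J where "J = (\<integral>y. k y * exp (z \<bullet> y) \<partial>\<nu>)"
    have iJ: "integrable \<nu> (\<lambda>y. k y * exp (z \<bullet> y))"
      using integrable_gkern[OF v, of b x] c unfolding g[abs_def] by simp
    have J: "exp (- 1) * I \<le> J"
    proof -
      have "(\<integral>y. k y * exp (- 1) \<partial>\<nu>) \<le> J"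
        unfolding J_def
      proof (rule integral_mono_AE)
        show "integrable \<nu> (\<lambda>y. k y * exp (- 1))" unfolding k_def using integrable_gkern[OF v] by simp
        show "integrable \<nu> (\<lambda>y. k y * exp (z \<bullet> y))" by (rule iJ)
        show "AE y in \<nu>. k y * exp (- 1) \<le> k y * exp (z \<bullet> y)"
          using zy
        proof eventually_elim
          case (elim y)
          have "- 1 \<le> z \<bullet> y" using elim by linarith
          then show ?case unfolding k_def using gkern_pos[of b v x' y] by simp
        qed
      qed
      then show ?thesis by (simp add: I_def mult.commute)
    qed
    have Jpos: "J > 0" using J I by (smt (verit) exp_gt_zero mult_pos_pos)
    have int1: "integrable \<nu> (\<lambda>y. k y *\<^sub>R (exp (z \<bullet> y) *\<^sub>R (y - m')))"
      unfolding k_def using bd1 by (intro integrable_gkern_mult[OF v]) measurable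
    have int0: "integrable \<nu> (\<lambda>y. k y *\<^sub>R (y - m'))"
      unfolding k_def using dm by (intro integrable_gkern_mult[OF v]) measurable
    have 0: "(\<integral>y. k y *\<^sub>R (y - m') \<partial>\<nu>) = 0" unfolding k_def m'_def by (rule post_mean_centred[OF v])
    have "(c * J) *\<^sub>R (post_mean \<nu> b v x - m') = (\<integral>y. c *\<^sub>R (k y *\<^sub>R (exp (z \<bullet> y) *\<^sub>R (y - m'))) \<partial>\<nu>)"
    proof -
      have "(\<integral>y. gkern b v x y *\<^sub>R (y - m') \<partial>\<nu>)
          = (\<integral>y. gkern b v x y *\<^sub>R y \<partial>\<nu>) - (\<integral>y. gkern b v x y \<partial>\<nu>) *\<^sub>R m'"
        using integrable_gkern_mult[OF v _ bounded] integrable_gkern[OF v] by (simp add: scaleR_diff_right)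
      moreover have "(\<integral>y. gkern b v x y \<partial>\<nu>) = c * J" by (simp add: g J_def)
      ultimately show ?thesis
        using Jpos c by (simp add: post_mean_def g scaleR_diff_right mult.assoc)
    qed
    also have "\<dots> = c *\<^sub>R (\<integral>y. k y *\<^sub>R (exp (z \<bullet> y) *\<^sub>R (y - m')) \<partial>\<nu>)"
      by (rule integral_scaleR_right)
    also have "(\<integral>y. k y *\<^sub>R (exp (z \<bullet> y) *\<^sub>R (y - m')) \<partial>\<nu>)
        = (\<integral>y. k y *\<^sub>R ((exp (z \<bullet> y) - 1) *\<^sub>R (y - m')) \<partial>\<nu>)"
    proof -
      have "(\<integral>y. k y *\<^sub>R ((exp (z \<bullet> y) - 1) *\<^sub>R (y - m')) \<partial>\<nu>)
        = (\<integral>y. k y *\<^sub>R (exp (z \<bullet> y) *\<^sub>R (y - m')) - k y *\<^sub>R (y - m') \<partial>\<nu>)"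
      proof -
        have "p *\<^sub>R ((q - 1) *\<^sub>R d) = p *\<^sub>R (q *\<^sub>R d) - p *\<^sub>R d" for p q :: real and d :: 'v
          by (simp add: scaleR_diff_left scaleR_diff_right)
        then show ?thesis by simp
      qed
      also have "\<dots> = (\<integral>y. k y *\<^sub>R (exp (z \<bullet> y) *\<^sub>R (y - m')) \<partial>\<nu>)"
        unfolding Bochner_Integration.integral_diff[OF int1 int0] 0 by simp
      finally show ?thesis ..
    qed
    finally have "c *\<^sub>R (J *\<^sub>R (post_mean \<nu> b v x - m'))
        = c *\<^sub>R (\<integral>y. k y *\<^sub>R ((exp (z \<bullet> y) - 1) *\<^sub>R (y - m')) \<partial>\<nu>)"
      by (simp only: scaleR_scaleR)
    then have *: "J *\<^sub>R (post_mean \<nu> b v x - m') = (\<integral>y. k y *\<^sub>R ((exp (z \<bullet> y) - 1) *\<^sub>R (y - m')) \<partial>\<nu>)"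
      using c by (subst (asm) scaleR_cancel_left) simp
    have "J * norm (post_mean \<nu> b v x - m') = norm (J *\<^sub>R (post_mean \<nu> b v x - m'))" using Jpos by simp
    also have "\<dots> \<le> exp 1 * (norm z * K) * (2 * K) * I"
      unfolding * k_def I_def using bd2 by (intro norm_integral_gkern_le[OF v]) measurable
    also have "\<dots> \<le> exp 1 * (norm z * K) * (2 * K) * (exp 1 * J)"
    proof -
      have "I \<le> exp 1 * J" using J by (simp add: exp_minus field_simps)
      then show ?thesis using K_nonneg by (intro mult_left_mono) simp_all
    qed
    finally have "J * norm (post_mean \<nu> b v x - m') \<le> J * (2 * (exp 1)\<^sup>2 * K\<^sup>2 * norm z)"
      by (simp add: power2_eq_square mult_ac)
    then show ?thesis using Jpos by simp
  qed
  then show "dist (post_mean \<nu> b v x) (post_mean \<nu> b v x') \<le> 2 * (exp 1)\<^sup>2 * K\<^sup>2 * (b / v) * dist x x'"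
    unfolding m'_def nz by (simp add: dist_norm mult_ac)
qed (use v b in simp)

lemma post_mean_measurable [measurable (raw)]:
  assumes "v > 0" "b \<ge> 0" shows "post_mean \<nu> b v \<in> borel_measurable borel"
  by (intro borel_measurable_continuous_onI lipschitz_on_continuous_on[OF post_mean_lipschitz[OF assms]])

end

section \<open>The weak error of one Euler step\<close>

lemma gauss_smooth_lipschitz:
  assumes lip: "L-lipschitz_on UNIV (u :: 'v::euclidean_space \<Rightarrow> real)" and bdd: "\<And>x. \<bar>u x\<bar> \<le> B"
  shows "L-lipschitz_on UNIV (gauss_smooth r u)"
proof (rule lipschitz_onI)
  have [measurable]: "u \<in> borel_measurable borel"
    by (intro borel_measurable_continuous_onI lipschitz_on_continuous_on[OF lip])
  have int: "integrable std_gauss (\<lambda>w. u (x + r *\<^sub>R w))" for x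
    by (rule std_gauss.integrable_const_bound[of _ B]) (simp_all add: bdd)
  fix x y :: 'v
  have "\<bar>(\<integral>w. u (x + r *\<^sub>R w) - u (y + r *\<^sub>R w) \<partial>std_gauss)\<bar> \<le> (\<integral>w. L * dist x y \<partial>(std_gauss :: 'v measure))"
  proof (rule order_trans[OF integral_abs_bound], rule integral_mono)
    show "integrable std_gauss (\<lambda>w. \<bar>u (x + r *\<^sub>R w) - u (y + r *\<^sub>R w)\<bar>)"
      using int[of x] int[of y] by simp
    fix w :: 'v
    show "\<bar>u (x + r *\<^sub>R w) - u (y + r *\<^sub>R w)\<bar> \<le> L * dist x y"
      using lipschitz_onD[OF lip, of "x + r *\<^sub>R w" "y + r *\<^sub>R w"] by (simp add: dist_norm)
  qed simp
  then show "dist (gauss_smooth r u x) (gauss_smooth r u y) \<le> L * dist x y"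
    using int[of x] int[of y] by (simp add: gauss_smooth_def dist_real_def)
qed (rule lipschitz_on_nonneg[OF lip])

lemma gauss_smooth_bounded:
  assumes [measurable]: "u \<in> borel_measurable borel" and bdd: "\<And>x. \<bar>u x\<bar> \<le> B"
  shows "\<bar>gauss_smooth r u (x :: 'v::euclidean_space)\<bar> \<le> B"
proof -
  have "\<bar>gauss_smooth r u x\<bar> \<le> (\<integral>w. B \<partial>(std_gauss :: 'v measure))"
    unfolding gauss_smooth_def
  proof (rule order_trans[OF integral_abs_bound], rule integral_mono)
    show "integrable std_gauss (\<lambda>w. \<bar>u (x + r *\<^sub>R w)\<bar>)"
      by (intro integrable_abs std_gauss.integrable_const_bound[of _ B]) (simp_all add: bdd)
  qed (simp_all add: bdd)
  then show ?thesis by simp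
qed

text \<open>
  The first moment of the Gaussian is bounded by one plus the second moment.
\<close>

lemma gauss_smooth_scale_diff:
  assumes lip: "L-lipschitz_on UNIV (u :: 'v::euclidean_space \<Rightarrow> real)" and bdd: "\<And>x. \<bar>u x\<bar> \<le> B"
  shows "\<bar>gauss_smooth r u x - gauss_smooth r' u x\<bar> \<le> L * \<bar>r - r'\<bar> * (gauss_moment2 TYPE('v) + 1)"
proof -
  have [measurable]: "u \<in> borel_measurable borel"
    by (intro borel_measurable_continuous_onI lipschitz_on_continuous_on[OF lip])
  have int: "integrable std_gauss (\<lambda>w. u (x + r *\<^sub>R w))" for r
    by (rule std_gauss.integrable_const_bound[of _ B]) (simp_all add: bdd)
  have L: "L \<ge> 0" by (rule lipschitz_on_nonneg[OF lip])
  have "\<bar>(\<integral>w. u (x + r *\<^sub>R w) - u (x + r' *\<^sub>R w) \<partial>std_gauss)\<bar>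
      \<le> (\<integral>w. L * \<bar>r - r'\<bar> * ((norm w)\<^sup>2 + 1) \<partial>(std_gauss :: 'v measure))"
  proof (rule order_trans[OF integral_abs_bound], rule integral_mono)
    show "integrable std_gauss (\<lambda>w. \<bar>u (x + r *\<^sub>R w) - u (x + r' *\<^sub>R w)\<bar>)"
      using int[of r] int[of r'] by simp
    show "integrable std_gauss (\<lambda>w. L * \<bar>r - r'\<bar> * ((norm (w :: 'v))\<^sup>2 + 1))"
      by (simp add: integrable_std_gauss_norm_sq)
    fix w :: 'v
    have "\<bar>u (x + r *\<^sub>R w) - u (x + r' *\<^sub>R w)\<bar> \<le> L * \<bar>r - r'\<bar> * norm w"
      using lipschitz_onD[OF lip, of "x + r *\<^sub>R w" "x + r' *\<^sub>R w"]
      by (simp add: dist_norm mult.assoc flip: scaleR_diff_left)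
    also have "\<dots> \<le> L * \<bar>r - r'\<bar> * ((norm w)\<^sup>2 + 1)"
    proof -
      have "z \<le> z\<^sup>2 + 1" for z :: real
        using zero_le_power2[of "z - 1/2"] by (simp add: power2_eq_square algebra_simps)
      then show ?thesis using L by (intro mult_left_mono) simp_all
    qed
    finally show "\<bar>u (x + r *\<^sub>R w) - u (x + r' *\<^sub>R w)\<bar> \<le> L * \<bar>r - r'\<bar> * ((norm w)\<^sup>2 + 1)" .
  qed
  also have "\<dots> = L * \<bar>r - r'\<bar> * (gauss_moment2 TYPE('v) + 1)"
    by (simp add: integrable_std_gauss_norm_sq gauss_moment2_def)
  finally show ?thesis using int[of r] int[of r'] by (simp add: gauss_smooth_def)
qed

lemma gauss_smooth_gauss_smooth:
  fixes u :: "'v::euclidean_space \<Rightarrow> real"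
  assumes "a > 0" "b > 0" and [measurable]: "u \<in> borel_measurable borel" and bdd: "\<And>x. \<bar>u x\<bar> \<le> B"
  shows "(\<integral>w. gauss_smooth b u (x + a *\<^sub>R w) \<partial>std_gauss) = gauss_smooth (sqrt (a\<^sup>2 + b\<^sup>2)) u x"
proof -
  interpret pair_prob_space "std_gauss :: 'v measure" "std_gauss :: 'v measure" ..
  have int: "integrable (std_gauss \<Otimes>\<^sub>M std_gauss) (\<lambda>(w, w'). u (x + a *\<^sub>R w + b *\<^sub>R w'))"
    by (rule integrable_const_bound[of _ B]) (simp_all add: bdd split_beta)
  have "(\<integral>w. gauss_smooth b u (x + a *\<^sub>R w) \<partial>std_gauss)
      = (\<integral>w. \<integral>w'. u (x + a *\<^sub>R w + b *\<^sub>R w') \<partial>std_gauss \<partial>std_gauss)"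
    by (simp add: gauss_smooth_def)
  also have "\<dots> = (\<integral>p. (case p of (w, w') \<Rightarrow> u (x + a *\<^sub>R w + b *\<^sub>R w')) \<partial>(std_gauss \<Otimes>\<^sub>M std_gauss))"
    using integral_fst'[OF int] by simp
  also have "\<dots> = (\<integral>z. u (x + z) \<partial>distr (std_gauss \<Otimes>\<^sub>M std_gauss) borel (\<lambda>(w, w'). a *\<^sub>R w + b *\<^sub>R w'))"
    by (subst integral_distr) (simp_all add: case_prod_unfold add.assoc)
  also have "\<dots> = gauss_smooth (sqrt (a\<^sup>2 + b\<^sup>2)) u x"
    by (simp add: std_gauss_convolution[OF assms(1,2)] integral_distr gauss_smooth_def)
  finally show ?thesis .
qed

text \<open>
  The deterministic part of an Euler step: \<open>x\<close> moves the fraction \<open>\<delta>\<close> of the way to its posterior mean.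
  When \<open>b\<close> grows by \<open>h\<close>, the step has \<open>\<delta> = h / (1 - b)\<close>.
\<close>

definition euler_mean :: "'v::euclidean_space measure \<Rightarrow> real \<Rightarrow> real \<Rightarrow> real \<Rightarrow> 'v \<Rightarrow> 'v" where
  "euler_mean \<nu> b v \<delta> x = (1 - \<delta>) *\<^sub>R x + \<delta> *\<^sub>R post_mean \<nu> b v x"

context bounded_law
begin

lemma euler_mean_lipschitz:
  assumes "v > 0" "b \<ge> 0" "0 \<le> \<delta>" "\<delta> \<le> 1"
  shows "((1 - \<delta>) + \<delta> * (2 * (exp 1)\<^sup>2 * K\<^sup>2 * (b / v)))-lipschitz_on UNIV (euler_mean \<nu> b v \<delta>)"
proof -
  have "(\<bar>1 - \<delta>\<bar> * 1 + \<bar>\<delta>\<bar> * (2 * (exp 1)\<^sup>2 * K\<^sup>2 * (b / v)))-lipschitz_on UNIV (\<lambda>x. (1 - \<delta>) *\<^sub>R x + \<delta> *\<^sub>R post_mean \<nu> b v x)"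
    using assms by (intro lipschitz_on_add lipschitz_on_cmult lipschitz_on_id post_mean_lipschitz)
  then show ?thesis using assms by (simp add: euler_mean_def[abs_def])
qed

lemma prob_space_gauss_mixture: "prob_space (gauss_mixture \<nu> b v)"
proof -
  interpret pair_prob_space \<nu> "std_gauss :: 'v measure" ..
  show ?thesis unfolding gauss_mixture_def by (rule prob_space_distr) simp
qed

lemma sets_gauss_mixture [simp, measurable_cong]: "sets (gauss_mixture \<nu> b v) = sets borel"
  by (simp add: gauss_mixture_def)

lemma integral_gauss_mixture:
  fixes u :: "'v \<Rightarrow> real"
  assumes [measurable]: "u \<in> borel_measurable borel" and bdd: "\<And>x. \<bar>u x\<bar> \<le> B"
  shows "(\<integral>z. u z \<partial>gauss_mixture \<nu> b v) = (\<integral>y. gauss_smooth (sqrt v) u (b *\<^sub>R y) \<partial>\<nu>)"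
proof -
  interpret pair_prob_space \<nu> "std_gauss :: 'v measure" ..
  have int: "integrable (\<nu> \<Otimes>\<^sub>M std_gauss) (\<lambda>(y, w). u (b *\<^sub>R y + sqrt v *\<^sub>R w))"
    by (rule integrable_const_bound[of _ B]) (simp_all add: bdd split_beta)
  have "(\<integral>z. u z \<partial>gauss_mixture \<nu> b v) = (\<integral>p. (case p of (y, w) \<Rightarrow> u (b *\<^sub>R y + sqrt v *\<^sub>R w)) \<partial>(\<nu> \<Otimes>\<^sub>M std_gauss))"
    unfolding gauss_mixture_def by (subst integral_distr) (simp_all add: case_prod_unfold)
  then show ?thesis using integral_fst'[OF int] by (simp add: gauss_smooth_def)
qed

lemma integrable_pair_gauss_density:
  fixes G :: "'v \<Rightarrow> 'v \<Rightarrow> real"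
  assumes "v > 0" and [measurable]: "case_prod G \<in> borel_measurable (borel \<Otimes>\<^sub>M borel)" and bdd: "\<And>z y. \<bar>G z y\<bar> \<le> B"
  shows "integrable (\<nu> \<Otimes>\<^sub>M lborel) (\<lambda>(y, z). gauss_density v (z - b *\<^sub>R y) * G z y)"
proof -
  interpret pair_sigma_finite \<nu> "lborel :: 'v measure" ..
  have "(\<integral>\<^sup>+p. ennreal (gauss_density v (snd p - b *\<^sub>R fst p)) \<partial>(\<nu> \<Otimes>\<^sub>M lborel))
      = (\<integral>\<^sup>+y. \<integral>\<^sup>+z. ennreal (gauss_density v (z - b *\<^sub>R y)) \<partial>lborel \<partial>\<nu>)"
    by (subst lborel.nn_integral_fst[symmetric]) simp_all
  also have "\<dots> = (\<integral>\<^sup>+y. \<integral>\<^sup>+z. ennreal (gauss_density v (z :: 'v)) \<partial>lborel \<partial>\<nu>)"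
  proof (rule nn_integral_cong)
    fix y :: 'v
    show "(\<integral>\<^sup>+z. ennreal (gauss_density v (z - b *\<^sub>R y)) \<partial>lborel) = (\<integral>\<^sup>+z. ennreal (gauss_density v (z :: 'v)) \<partial>lborel)"
      by (subst nn_integral_lborel_affine[where r = 1 and c = "b *\<^sub>R y"]) simp_all
  qed
  also have "\<dots> = 1"
    using emeasure_space_1 by (simp add: nn_integral_gauss_density[OF assms(1)])
  finally have "integrable (\<nu> \<Otimes>\<^sub>M lborel) (\<lambda>p. gauss_density v (snd p - b *\<^sub>R fst p))"
    by (intro integrableI_nonneg) simp_all
  then have "integrable (\<nu> \<Otimes>\<^sub>M lborel) (\<lambda>p. B * gauss_density v (snd p - b *\<^sub>R fst p))" by simp
  then show ?thesis
  proof (rule Bochner_Integration.integrable_bound)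
    have "gauss_density v (z - b *\<^sub>R y) * \<bar>G z y\<bar> \<le> \<bar>B\<bar> * gauss_density v (z - b *\<^sub>R y)" for y z
    proof -
      have "\<bar>G z y\<bar> \<le> \<bar>B\<bar>" using bdd[of z y] by linarith
      then show ?thesis
        using mult_right_mono[OF _ gauss_density_nonneg[of v "z - b *\<^sub>R y"]] by (simp add: mult.commute)
    qed
    then show "AE p in \<nu> \<Otimes>\<^sub>M lborel. norm (case p of (y, z) \<Rightarrow> gauss_density v (z - b *\<^sub>R y) * G z y)
        \<le> norm (B * gauss_density v (snd p - b *\<^sub>R fst p))"
      by (auto simp: abs_mult)
  qed (simp add: split_beta)
qed

text \<open>
  Drawing \<open>y\<close> first and then the position \<open>z\<close>, or \<open>z\<close> first and then \<open>y\<close> from its posterior.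
\<close>

lemma gauss_mixture_disintegration:
  fixes G :: "'v \<Rightarrow> 'v \<Rightarrow> real"
  assumes v: "v > 0" and [measurable]: "case_prod G \<in> borel_measurable (borel \<Otimes>\<^sub>M borel)" and bdd: "\<And>z y. \<bar>G z y\<bar> \<le> B"
  shows "(\<integral>y. \<integral>w. G (b *\<^sub>R y + sqrt v *\<^sub>R w) y \<partial>std_gauss \<partial>\<nu>)
    = (\<integral>z. \<integral>y. gauss_density v (z - b *\<^sub>R y) * G z y \<partial>\<nu> \<partial>lborel)"
proof -
  interpret pair_sigma_finite \<nu> "lborel :: 'v measure" ..
  have "(\<integral>w. G (b *\<^sub>R y + sqrt v *\<^sub>R w) y \<partial>std_gauss) = (\<integral>z. gauss_density v (z - b *\<^sub>R y) * G z y \<partial>lborel)" for y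
  proof -
    have "(\<integral>w. G (b *\<^sub>R y + sqrt v *\<^sub>R w) y \<partial>std_gauss) = (\<integral>z. G z y \<partial>distr std_gauss borel (\<lambda>w. b *\<^sub>R y + sqrt v *\<^sub>R w))"
      by (subst integral_distr) simp_all
    also have "\<dots> = (\<integral>z. gauss_density v (z - b *\<^sub>R y) * G z y \<partial>lborel)"
      using v by (subst distr_std_gauss_affine) (simp_all add: integral_density)
    finally show ?thesis .
  qed
  then have "(\<integral>y. \<integral>w. G (b *\<^sub>R y + sqrt v *\<^sub>R w) y \<partial>std_gauss \<partial>\<nu>)
    = (\<integral>y. \<integral>z. gauss_density v (z - b *\<^sub>R y) * G z y \<partial>lborel \<partial>\<nu>)" by simp
  also have "\<dots> = (\<integral>z. \<integral>y. gauss_density v (z - b *\<^sub>R y) * G z y \<partial>\<nu> \<partial>lborel)"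
    using Fubini_integral[OF integrable_pair_gauss_density[OF assms], of b] by simp
  finally show ?thesis .
qed

text \<open>
  The average is taken over \<open>y\<close> given the position first, and over the position afterwards.
\<close>

lemma gauss_mixture_average_le:
  fixes G :: "'v \<Rightarrow> 'v \<Rightarrow> real"
  assumes v: "v > 0" and G [measurable]: "case_prod G \<in> borel_measurable (borel \<Otimes>\<^sub>M borel)" and bdd: "\<And>z y. \<bar>G z y\<bar> \<le> B"
    and le: "\<And>z. \<bar>\<integral>y. gkern b v z y * G z y \<partial>\<nu>\<bar> \<le> c * (\<integral>y. gkern b v z y \<partial>\<nu>)"
  shows "\<bar>\<integral>y. \<integral>w. G (b *\<^sub>R y + sqrt v *\<^sub>R w) y \<partial>std_gauss \<partial>\<nu>\<bar> \<le> c"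
proof -
  interpret pair_sigma_finite \<nu> "lborel :: 'v measure" ..
  have 1: "case_prod (\<lambda>z y. 1 :: real) \<in> borel_measurable ((borel :: 'v measure) \<Otimes>\<^sub>M (borel :: 'v measure))" by simp
  have int: "integrable lborel (\<lambda>z. \<integral>y. gauss_density v (z - b *\<^sub>R y) * G z y \<partial>\<nu>)"
    using integrable_snd[OF integrable_pair_gauss_density[OF v G bdd], of b] by simp
  have int1: "integrable lborel (\<lambda>z. \<integral>y. gauss_density v (z - b *\<^sub>R y) \<partial>\<nu>)"
    using integrable_snd[OF integrable_pair_gauss_density[OF v 1, of 1], of b] by simp
  have "\<bar>\<integral>y. \<integral>w. G (b *\<^sub>R y + sqrt v *\<^sub>R w) y \<partial>std_gauss \<partial>\<nu>\<bar>
      = \<bar>\<integral>z. \<integral>y. gauss_density v (z - b *\<^sub>R y) * G z y \<partial>\<nu> \<partial>lborel\<bar>"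
    by (subst gauss_mixture_disintegration[OF v G bdd]) simp
  also have "\<dots> \<le> (\<integral>z. c * (\<integral>y. gauss_density v (z - b *\<^sub>R y) \<partial>\<nu>) \<partial>lborel)"
  proof (rule order_trans[OF integral_abs_bound], rule integral_mono)
    show "integrable lborel (\<lambda>z. \<bar>\<integral>y. gauss_density v (z - b *\<^sub>R y) * G z y \<partial>\<nu>\<bar>)"
      using int by (rule integrable_abs)
    show "integrable lborel (\<lambda>z. c * (\<integral>y. gauss_density v (z - b *\<^sub>R y) \<partial>\<nu>))" using int1 by simp
    fix z
    define C where "C = (2 * pi * v) powr (- real DIM('v) / 2)"
    have "C \<ge> 0" by (simp add: C_def)
    then have "\<bar>\<integral>y. C * (gkern b v z y * G z y) \<partial>\<nu>\<bar> \<le> c * (\<integral>y. C * gkern b v z y \<partial>\<nu>)"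
      using mult_left_mono[OF le[of z], of C] by (simp add: abs_mult mult_ac)
    then show "\<bar>\<integral>y. gauss_density v (z - b *\<^sub>R y) * G z y \<partial>\<nu>\<bar> \<le> c * (\<integral>y. gauss_density v (z - b *\<^sub>R y) \<partial>\<nu>)"
      by (simp add: gauss_density_gkern C_def mult.assoc)
  qed
  also have "\<dots> = c * (\<integral>y. \<integral>w. 1 \<partial>(std_gauss :: 'v measure) \<partial>\<nu>)"
    using gauss_mixture_disintegration[OF v 1, of 1 b] by simp
  also have "\<dots> = c" using prob_space by simp
  finally show ?thesis .
qed

lemma gauss_mixture_density:
  assumes v: "v > 0"
  shows "gauss_mixture \<nu> b v = density lborel (\<lambda>z. ennreal (\<integral>y. gauss_density v (z - b *\<^sub>R y) \<partial>\<nu>))"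
proof (rule measure_eqI)
  interpret pair_sigma_finite \<nu> "lborel :: 'v measure" ..
  interpret p: pair_prob_space \<nu> "std_gauss :: 'v measure" ..
  fix A assume "A \<in> sets (gauss_mixture \<nu> b v)"
  then have [measurable]: "A \<in> sets borel" by simp
  have *: "(\<integral>\<^sup>+w. indicator A (b *\<^sub>R y + sqrt v *\<^sub>R w) \<partial>std_gauss)
      = (\<integral>\<^sup>+z. ennreal (gauss_density v (z - b *\<^sub>R y)) * indicator A z \<partial>lborel)" for y
  proof -
    have "(\<integral>\<^sup>+w. indicator A (b *\<^sub>R y + sqrt v *\<^sub>R w) \<partial>std_gauss)
        = (\<integral>\<^sup>+z. indicator A z \<partial>distr std_gauss borel (\<lambda>w. b *\<^sub>R y + sqrt v *\<^sub>R w))"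
      by (subst nn_integral_distr) (simp_all del: nn_integral_indicator)
    then show ?thesis
      using v by (simp add: distr_std_gauss_affine nn_integral_density del: nn_integral_indicator)
  qed
  have "emeasure (gauss_mixture \<nu> b v) A = (\<integral>\<^sup>+p. indicator A (b *\<^sub>R fst p + sqrt v *\<^sub>R snd p) \<partial>(\<nu> \<Otimes>\<^sub>M std_gauss))"
    unfolding gauss_mixture_def
    by (subst nn_integral_indicator[symmetric], simp, subst nn_integral_distr) (simp_all add: split_beta)
  also have "\<dots> = (\<integral>\<^sup>+y. \<integral>\<^sup>+w. indicator A (b *\<^sub>R y + sqrt v *\<^sub>R w) \<partial>std_gauss \<partial>\<nu>)"
    by (subst std_gauss.nn_integral_fst[symmetric]) (simp_all del: nn_integral_indicator)
  also have "\<dots> = (\<integral>\<^sup>+y. \<integral>\<^sup>+z. ennreal (gauss_density v (z - b *\<^sub>R y)) * indicator A z \<partial>lborel \<partial>\<nu>)"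
    by (simp add: *)
  also have "\<dots> = (\<integral>\<^sup>+z. \<integral>\<^sup>+y. ennreal (gauss_density v (z - b *\<^sub>R y)) * indicator A z \<partial>\<nu> \<partial>lborel)"
    by (rule Fubini'[symmetric]) measurable
  also have "\<dots> = (\<integral>\<^sup>+z. ennreal (\<integral>y. gauss_density v (z - b *\<^sub>R y) \<partial>\<nu>) * indicator A z \<partial>lborel)"
  proof (rule nn_integral_cong)
    fix z
    have "integrable \<nu> (\<lambda>y. gauss_density v (z - b *\<^sub>R y))"
      unfolding gauss_density_gkern using integrable_gkern[OF v] by simp
    then have "(\<integral>\<^sup>+y. ennreal (gauss_density v (z - b *\<^sub>R y)) \<partial>\<nu>) = ennreal (\<integral>y. gauss_density v (z - b *\<^sub>R y) \<partial>\<nu>)"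
      by (intro nn_integral_eq_integral) simp_all
    then show "(\<integral>\<^sup>+y. ennreal (gauss_density v (z - b *\<^sub>R y)) * indicator A z \<partial>\<nu>)
        = ennreal (\<integral>y. gauss_density v (z - b *\<^sub>R y) \<partial>\<nu>) * indicator A z"
      by (simp add: nn_integral_multc)
  qed
  also have "\<dots> = emeasure (density lborel (\<lambda>z. ennreal (\<integral>y. gauss_density v (z - b *\<^sub>R y) \<partial>\<nu>))) A"
    by (simp add: emeasure_density)
  finally show "emeasure (gauss_mixture \<nu> b v) A = emeasure (density lborel (\<lambda>z. ennreal (\<integral>y. gauss_density v (z - b *\<^sub>R y) \<partial>\<nu>))) A" .
qed simp

text \<open>
  If the step were taken towards \<open>y\<close> itself, it would send the mixture to the mixture with centres
  \<open>((1 - \<delta>) b + \<delta>) y\<close> and variance \<open>(1 - \<delta>)\<^sup>2 v + r\<^sup>2\<close>. Replacing \<open>y\<close> by its posterior mean changes the position before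
  the noise by \<open>e = \<delta> (y - mean)\<close>. The noise smooths \<open>u\<close> at scale \<open>r\<close>, the linear term in \<open>e\<close> has posterior mean zero,
  and what is left is quadratic in \<open>\<delta>\<close>.
\<close>

lemma euler_step_weak_error:
  fixes u :: "'v \<Rightarrow> real"
  assumes lip: "L-lipschitz_on UNIV u" and bdd: "\<And>x. \<bar>u x\<bar> \<le> B"
    and v: "v > 0" and b: "b \<ge> 0" and \<delta>: "0 \<le> \<delta>" "\<delta> < 1" and r: "r > 0" and small: "\<delta> * (2 * K) \<le> r" and v': "v' \<ge> 0"
  shows "\<bar>(\<integral>z. gauss_smooth r u (euler_mean \<nu> b v \<delta> z) \<partial>gauss_mixture \<nu> b v)
        - (\<integral>z. u z \<partial>gauss_mixture \<nu> ((1 - \<delta>) * b + \<delta>) v')\<bar>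
    \<le> (gauss_moment2 TYPE('v) + 1) * L * ((\<delta> * (2 * K))\<^sup>2 / r + \<bar>sqrt ((1 - \<delta>)\<^sup>2 * v + r\<^sup>2) - sqrt v'\<bar>)"
proof -
  interpret p: pair_prob_space \<nu> "std_gauss :: 'v measure" ..
  define \<kappa> where "\<kappa> = gauss_moment2 TYPE('v) + 1"
  have \<kappa>: "\<kappa> \<ge> 0" using gauss_moment2_nonneg[where 'v = 'v] by (simp add: \<kappa>_def)
  have L: "L \<ge> 0" by (rule lipschitz_on_nonneg[OF lip])
  have um [measurable]: "u \<in> borel_measurable borel"
    by (intro borel_measurable_continuous_onI lipschitz_on_continuous_on[OF lip])
  define U where "U = gauss_smooth r u"
  have U_lip: "L-lipschitz_on UNIV U" unfolding U_def by (rule gauss_smooth_lipschitz[OF lip bdd])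
  have U_bdd: "\<bar>U x\<bar> \<le> B" for x unfolding U_def by (rule gauss_smooth_bounded[OF um bdd])
  have Um [measurable]: "U \<in> borel_measurable borel"
    by (intro borel_measurable_continuous_onI lipschitz_on_continuous_on[OF U_lip])
  have [measurable]: "post_mean \<nu> b v \<in> borel_measurable borel" by (rule post_mean_measurable[OF v b])
  define m where "m = euler_mean \<nu> b v \<delta>"
  have mm [measurable]: "m \<in> borel_measurable borel" unfolding m_def euler_mean_def[abs_def] by measurable
  define b' where "b' = (1 - \<delta>) * b + \<delta>"
  define \<rho> where "\<rho> = sqrt ((1 - \<delta>)\<^sup>2 * v + r\<^sup>2)"
  \<comment> \<open>the step taken with the true \<open>y\<close> in place of its posterior mean\<close>
  define T where "T = (\<integral>y. \<integral>w. U ((1 - \<delta>) *\<^sub>R (b *\<^sub>R y + sqrt v *\<^sub>R w) + \<delta> *\<^sub>R y) \<partial>std_gauss \<partial>\<nu>)"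
  have 1: "\<bar>(\<integral>z. U (m z) \<partial>gauss_mixture \<nu> b v) - T\<bar> \<le> \<kappa> * L * (\<delta> * (2 * K))\<^sup>2 / r"
  proof -
    define G where "G z y = U (m z) - U ((1 - \<delta>) *\<^sub>R z + \<delta> *\<^sub>R y)" for z y
    have Gm: "case_prod G \<in> borel_measurable (borel \<Otimes>\<^sub>M borel)" unfolding G_def[abs_def] by measurable
    have G_bdd: "\<bar>G z y\<bar> \<le> 2 * B" for z y
      unfolding G_def using U_bdd[of "m z"] U_bdd[of "(1 - \<delta>) *\<^sub>R z + \<delta> *\<^sub>R y"] by linarith
    have i1: "integrable (\<nu> \<Otimes>\<^sub>M std_gauss) (\<lambda>p. U (m (b *\<^sub>R fst p + sqrt v *\<^sub>R snd p)))"
      by (rule p.integrable_const_bound[of _ B]) (simp_all add: U_bdd)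
    have i2: "integrable (\<nu> \<Otimes>\<^sub>M std_gauss) (\<lambda>p. U ((1 - \<delta>) *\<^sub>R (b *\<^sub>R fst p + sqrt v *\<^sub>R snd p) + \<delta> *\<^sub>R fst p))"
      by (rule p.integrable_const_bound[of _ B]) (simp_all add: U_bdd)
    have "(\<integral>z. U (m z) \<partial>gauss_mixture \<nu> b v) = (\<integral>y. \<integral>w. U (m (b *\<^sub>R y + sqrt v *\<^sub>R w)) \<partial>std_gauss \<partial>\<nu>)"
      using integral_gauss_mixture[of "\<lambda>z. U (m z)" B b v] by (simp add: U_bdd gauss_smooth_def)
    then have "(\<integral>z. U (m z) \<partial>gauss_mixture \<nu> b v) - T = (\<integral>y. \<integral>w. G (b *\<^sub>R y + sqrt v *\<^sub>R w) y \<partial>std_gauss \<partial>\<nu>)"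
      unfolding T_def G_def using p.integral_fst'[OF i1] p.integral_fst'[OF i2]
        p.integral_fst'[OF Bochner_Integration.integrable_diff[OF i1 i2]]
        Bochner_Integration.integral_diff[OF i1 i2] by simp
    also have "\<bar>\<dots>\<bar> \<le> \<kappa> * L * (\<delta> * (2 * K))\<^sup>2 / r"
    proof (rule gauss_mixture_average_le[OF v Gm G_bdd])
      fix z
      obtain D where D: "\<And>e. norm e \<le> r \<Longrightarrow> \<bar>U (m z + e) - U (m z) - D \<bullet> e\<bar> \<le> \<kappa> * L * (norm e)\<^sup>2 / r"
        using gauss_smoothing_expansion[OF lip bdd r, of "m z"] unfolding U_def gauss_smooth_def \<kappa>_def by metis
      define e where "e y = \<delta> *\<^sub>R (y - post_mean \<nu> b v z)" for y
      have em [measurable]: "e \<in> borel_measurable borel" unfolding e_def[abs_def] by measurable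
      have eb: "AE y in \<nu>. norm (e y) \<le> \<delta> * (2 * K)"
        using AE_norm_diff_post_mean[OF v, of b z]
        by eventually_elim (use \<delta> in \<open>simp add: e_def mult_left_mono\<close>)
      have eq: "- G z y = (U (m z + e y) - U (m z) - D \<bullet> e y) + D \<bullet> e y" for y
        by (simp add: G_def m_def euler_mean_def e_def algebra_simps)
      have DG: "AE y in \<nu>. norm (- G z y - D \<bullet> e y) \<le> \<kappa> * L * (\<delta> * (2 * K))\<^sup>2 / r"
        using eb
      proof eventually_elim
        case (elim y)
        have "\<bar>- G z y - D \<bullet> e y\<bar> \<le> \<kappa> * L * (norm (e y))\<^sup>2 / r"
          using D[of "e y"] elim small unfolding eq by simp
        also have "\<dots> \<le> \<kappa> * L * (\<delta> * (2 * K))\<^sup>2 / r"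
          using elim r L \<kappa> by (intro divide_right_mono mult_left_mono power_mono) simp_all
        finally show ?case by simp
      qed
      have [measurable]: "(\<lambda>y. G z y) \<in> borel_measurable borel" unfolding G_def by measurable
      have "(\<integral>y. gkern b v z y *\<^sub>R (D \<bullet> e y) \<partial>\<nu>) = D \<bullet> (\<integral>y. gkern b v z y *\<^sub>R e y \<partial>\<nu>)"
        using integrable_gkern_mult[OF v em eb, of b z] by (subst integral_inner_right[symmetric]) simp_all
      also have "(\<integral>y. gkern b v z y *\<^sub>R e y \<partial>\<nu>) = (\<integral>y. \<delta> *\<^sub>R (gkern b v z y *\<^sub>R (y - post_mean \<nu> b v z)) \<partial>\<nu>)"
        by (simp add: e_def mult.commute)
      also have "\<dots> = 0" by (subst integral_scaleR_right) (simp add: post_mean_centred[OF v])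
      finally have z0: "(\<integral>y. gkern b v z y *\<^sub>R (D \<bullet> e y) \<partial>\<nu>) = 0" by simp
      have De: "AE y in \<nu>. norm (D \<bullet> e y) \<le> norm D * (\<delta> * (2 * K))"
        using eb
      proof eventually_elim
        case (elim y)
        show ?case using Cauchy_Schwarz_ineq2[of D "e y"] mult_left_mono[OF elim norm_ge_zero[of D]] by simp
      qed
      have iG: "integrable \<nu> (\<lambda>y. gkern b v z y *\<^sub>R G z y)"
        by (rule integrable_gkern_mult[OF v, of _ "2 * B"]) (simp_all add: G_bdd)
      have iD: "integrable \<nu> (\<lambda>y. gkern b v z y *\<^sub>R (D \<bullet> e y))"
        by (rule integrable_gkern_mult[OF v _ De]) simp
      have "(\<integral>y. gkern b v z y *\<^sub>R (- G z y - D \<bullet> e y) \<partial>\<nu>) = - (\<integral>y. gkern b v z y * G z y \<partial>\<nu>)"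
        using iG iD z0 by (simp add: right_diff_distrib)
      then show "\<bar>\<integral>y. gkern b v z y * G z y \<partial>\<nu>\<bar> \<le> \<kappa> * L * (\<delta> * (2 * K))\<^sup>2 / r * (\<integral>y. gkern b v z y \<partial>\<nu>)"
        using norm_integral_gkern_le[OF v _ DG, of b z] by simp
    qed
    finally show ?thesis .
  qed
  have T: "T = (\<integral>y. gauss_smooth \<rho> u (b' *\<^sub>R y) \<partial>\<nu>)"
  proof -
    have "(\<integral>w. U ((1 - \<delta>) *\<^sub>R (b *\<^sub>R y + sqrt v *\<^sub>R w) + \<delta> *\<^sub>R y) \<partial>std_gauss) = gauss_smooth \<rho> u (b' *\<^sub>R y)" for y
    proof -
      have "(1 - \<delta>) *\<^sub>R (b *\<^sub>R y + sqrt v *\<^sub>R w) + \<delta> *\<^sub>R y = b' *\<^sub>R y + ((1 - \<delta>) * sqrt v) *\<^sub>R w" for w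
        by (simp add: b'_def algebra_simps)
      then show ?thesis
        using gauss_smooth_gauss_smooth[of "(1 - \<delta>) * sqrt v" r u B "b' *\<^sub>R y"] \<delta> v r
        by (simp add: bdd U_def \<rho>_def power_mult_distrib)
    qed
    then show ?thesis by (simp add: T_def)
  qed
  have 2: "\<bar>T - (\<integral>z. u z \<partial>gauss_mixture \<nu> b' v')\<bar> \<le> L * \<bar>\<rho> - sqrt v'\<bar> * \<kappa>"
  proof -
    have ig: "integrable \<nu> (\<lambda>y. gauss_smooth r u (b' *\<^sub>R y))" for r
    proof (rule integrable_const_bound[of _ B])
      have [measurable]: "gauss_smooth r u \<in> borel_measurable borel"
        by (intro borel_measurable_continuous_onI lipschitz_on_continuous_on[OF gauss_smooth_lipschitz[OF lip bdd]])
      show "(\<lambda>y. gauss_smooth r u (b' *\<^sub>R y)) \<in> borel_measurable \<nu>" by simp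
    qed (simp add: gauss_smooth_bounded[OF um bdd])
    have "\<bar>T - (\<integral>z. u z \<partial>gauss_mixture \<nu> b' v')\<bar>
        = \<bar>\<integral>y. gauss_smooth \<rho> u (b' *\<^sub>R y) - gauss_smooth (sqrt v') u (b' *\<^sub>R y) \<partial>\<nu>\<bar>"
      unfolding T integral_gauss_mixture[OF um bdd] using ig by simp
    also have "\<dots> \<le> (\<integral>y. L * \<bar>\<rho> - sqrt v'\<bar> * \<kappa> \<partial>\<nu>)"
    proof (rule order_trans[OF integral_abs_bound], rule integral_mono)
      show "integrable \<nu> (\<lambda>y. \<bar>gauss_smooth \<rho> u (b' *\<^sub>R y) - gauss_smooth (sqrt v') u (b' *\<^sub>R y)\<bar>)"
        using ig by simp
      fix y
      show "\<bar>gauss_smooth \<rho> u (b' *\<^sub>R y) - gauss_smooth (sqrt v') u (b' *\<^sub>R y)\<bar> \<le> L * \<bar>\<rho> - sqrt v'\<bar> * \<kappa>"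
        unfolding \<kappa>_def by (rule gauss_smooth_scale_diff[OF lip bdd])
    qed simp
    also have "\<dots> = L * \<bar>\<rho> - sqrt v'\<bar> * \<kappa>" using prob_space by simp
    finally show ?thesis .
  qed
  have "\<bar>(\<integral>z. U (m z) \<partial>gauss_mixture \<nu> b v) - (\<integral>z. u z \<partial>gauss_mixture \<nu> b' v')\<bar>
      \<le> \<kappa> * L * (\<delta> * (2 * K))\<^sup>2 / r + L * \<bar>\<rho> - sqrt v'\<bar> * \<kappa>"
    using 1 2 by linarith
  also have "\<dots> = \<kappa> * L * ((\<delta> * (2 * K))\<^sup>2 / r + \<bar>\<rho> - sqrt v'\<bar>)" by (simp add: algebra_simps)
  finally show ?thesis unfolding U_def m_def b'_def \<rho>_def \<kappa>_def .
qed

end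

section \<open>The law of the Euler scheme\<close>

text \<open>
  The variance \<open>\<sigma>\<^sub>t \<ell>\<^sub>t\<close> of the kernel at the time where \<open>\<beta>\<^sub>t = b\<close> and \<open>\<sigma>\<^sub>t = 1 - b\<close>.
\<close>

definition mix_var :: "real \<Rightarrow> real \<Rightarrow> real \<Rightarrow> real" where
  "mix_var \<epsilon> \<gamma> b = (1 - b) * (\<epsilon> * b + \<gamma> * (1 - b))"

lemma mix_var_ge:
  assumes "0 < \<epsilon>" "0 < \<gamma>" "0 \<le> b" "b \<le> c" "c < 1"
  shows "(1 - c) * min \<epsilon> \<gamma> \<le> mix_var \<epsilon> \<gamma> b"
proof -
  have "min \<epsilon> \<gamma> * b + min \<epsilon> \<gamma> * (1 - b) \<le> \<epsilon> * b + \<gamma> * (1 - b)"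
    using assms by (intro add_mono mult_right_mono) simp_all
  then have "min \<epsilon> \<gamma> \<le> \<epsilon> * b + \<gamma> * (1 - b)" by (simp add: algebra_simps)
  then show ?thesis unfolding mix_var_def using assms by (intro mult_mono) simp_all
qed

lemma mix_var_pos:
  assumes "0 < \<epsilon>" "0 < \<gamma>" "0 \<le> b" "b < 1"
  shows "0 < mix_var \<epsilon> \<gamma> b"
proof -
  have "0 < (1 - b) * min \<epsilon> \<gamma>" using assms by simp
  then show ?thesis using mix_var_ge[of \<epsilon> \<gamma> b b] assms by linarith
qed

text \<open>
  With \<open>y\<close> known, the Euler step with increment \<open>h\<close> reproduces the mean of the mixture exactly and
  misses its variance only by a term of order \<open>h\<^sup>2\<close>.
\<close>

lemma euler_step_variance:
  assumes "b < 1"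
  shows "(1 - h / (1 - b))\<^sup>2 * mix_var \<epsilon> \<gamma> b + \<epsilon> * h = mix_var \<epsilon> \<gamma> (b + h) + \<epsilon> * h\<^sup>2 / (1 - b)"
proof -
  define s where "s = 1 - b"
  have s: "s \<noteq> 0" "b = 1 - s" using assms by (simp_all add: s_def)
  have "(1 - h / s)\<^sup>2 * (s * (\<epsilon> * (1 - s) + \<gamma> * s)) * s = (s - h)\<^sup>2 * (\<epsilon> * (1 - s) + \<gamma> * s)"
    using s by (simp add: power2_eq_square field_simps)
  then have "((1 - h / s)\<^sup>2 * (s * (\<epsilon> * (1 - s) + \<gamma> * s)) + \<epsilon> * h) * s
      = ((s - h) * (\<epsilon> * (1 - s + h) + \<gamma> * (s - h)) + \<epsilon> * h\<^sup>2 / s) * s"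
    using s by (simp add: distrib_right) (simp add: power2_eq_square algebra_simps)
  then have "(1 - h / s)\<^sup>2 * (s * (\<epsilon> * (1 - s) + \<gamma> * s)) + \<epsilon> * h
      = (s - h) * (\<epsilon> * (1 - s + h) + \<gamma> * (s - h)) + \<epsilon> * h\<^sup>2 / s"
    using s(1) by simp
  then show ?thesis unfolding mix_var_def s(2) by (simp add: algebra_simps)
qed

lemma sqrt_diff_le:
  assumes "0 < c" "c \<le> V" "0 \<le> d"
  shows "\<bar>sqrt (V + d) - sqrt V\<bar> \<le> d / sqrt c"
proof -
  have "sqrt c \<le> sqrt V" "0 < sqrt c" "0 \<le> sqrt (V + d)" "sqrt V \<le> sqrt (V + d)" using assms by simp_all
  then have "(sqrt (V + d) - sqrt V) * sqrt c \<le> (sqrt (V + d) - sqrt V) * (sqrt (V + d) + sqrt V)"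
    by (intro mult_left_mono) linarith+
  also have "\<dots> = d" using assms by (simp add: algebra_simps)
  finally show ?thesis using assms \<open>sqrt V \<le> sqrt (V + d)\<close> by (simp add: field_simps)
qed

context bounded_law
begin

text \<open>
  The constants \<open>step_lip\<close> and \<open>step_const\<close> bound the growth of Lipschitz constants and the weak error uniformly
  over all steps that end at a value of \<open>\<beta>\<close> not exceeding \<open>c < 1\<close>.
\<close>

definition step_lip :: "real \<Rightarrow> real \<Rightarrow> real \<Rightarrow> real" where
  "step_lip \<epsilon> \<gamma> c = 2 * (exp 1)\<^sup>2 * K\<^sup>2 / ((1 - c)\<^sup>2 * min \<epsilon> \<gamma>)"

definition step_const :: "real \<Rightarrow> real \<Rightarrow> real \<Rightarrow> real" where
  "step_const \<epsilon> \<gamma> c = (gauss_moment2 TYPE('v) + 1) *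
     ((2 * K)\<^sup>2 / ((1 - c)\<^sup>2 * sqrt \<epsilon>) + \<epsilon> / ((1 - c) * sqrt ((1 - c) * min \<epsilon> \<gamma>)))"

lemma euler_mean_step_lipschitz:
  assumes par: "0 < \<epsilon>" "0 < \<gamma>" "0 \<le> b" "b \<le> b'" "b' \<le> c" "c < 1"
  shows "(1 + step_lip \<epsilon> \<gamma> c * (b' - b))-lipschitz_on UNIV (euler_mean \<nu> b (mix_var \<epsilon> \<gamma> b) ((b' - b) / (1 - b)))"
proof (rule lipschitz_on_mono[OF euler_mean_lipschitz subset_refl])
  let ?v = "mix_var \<epsilon> \<gamma> b" and ?\<delta> = "(b' - b) / (1 - b)"
  show v: "?v > 0" using par by (intro mix_var_pos) simp_all
  show "0 \<le> b" by fact
  show \<delta>: "0 \<le> ?\<delta>" "?\<delta> \<le> 1" using par by simp_all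
  have "?\<delta> \<le> (b' - b) / (1 - c)" using par by (intro divide_left_mono) simp_all
  moreover have "b / ?v \<le> 1 / ((1 - c) * min \<epsilon> \<gamma>)"
    using mix_var_ge[of \<epsilon> \<gamma> b c] par v by (intro frac_le) simp_all
  ultimately have "?\<delta> * (2 * (exp 1)\<^sup>2 * K\<^sup>2 * (b / ?v))
      \<le> ((b' - b) / (1 - c)) * (2 * (exp 1)\<^sup>2 * K\<^sup>2 * (1 / ((1 - c) * min \<epsilon> \<gamma>)))"
    using par v by (intro mult_mono mult_left_mono) simp_all
  also have "\<dots> = step_lip \<epsilon> \<gamma> c * (b' - b)" by (simp add: step_lip_def power2_eq_square mult_ac)
  finally show "1 - ?\<delta> + ?\<delta> * (2 * (exp 1)\<^sup>2 * K\<^sup>2 * (b / ?v)) \<le> 1 + step_lip \<epsilon> \<gamma> c * (b' - b)"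
    using \<delta> by linarith
qed

lemma step_lip_nonneg: "0 < \<epsilon> \<Longrightarrow> 0 < \<gamma> \<Longrightarrow> c < 1 \<Longrightarrow> step_lip \<epsilon> \<gamma> c \<ge> 0"
  by (simp add: step_lip_def)

lemma step_const_nonneg: "0 < \<epsilon> \<Longrightarrow> 0 < \<gamma> \<Longrightarrow> c < 1 \<Longrightarrow> step_const \<epsilon> \<gamma> c \<ge> 0"
  unfolding step_const_def using gauss_moment2_nonneg[where 'v = 'v] by (intro mult_nonneg_nonneg add_nonneg_nonneg) simp_all

text \<open>
  Here \<open>\<delta>\<close> is of order \<open>h = b' - b\<close> and the noise has scale \<open>r = \<surd>(\<epsilon> h)\<close>, so the error \<open>\<delta>\<^sup>2 / r\<close> is of order \<open>h\<^bsup>3/2\<^esup>\<close>,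
  and the defect of the variance is of order \<open>h\<^sup>2\<close>. The exponent above \<open>1\<close> is what makes the sum over all steps small.
\<close>

lemma schedule_step_weak_error:
  fixes u :: "'v \<Rightarrow> real"
  assumes lip: "L-lipschitz_on UNIV u" and bdd: "\<And>x. \<bar>u x\<bar> \<le> B"
    and par: "0 < \<epsilon>" "0 < \<gamma>" "0 \<le> b" "b < b'" "b' \<le> c" "c < 1"
    and small: "(2 * K)\<^sup>2 * (b' - b) \<le> \<epsilon> * (1 - c)\<^sup>2"
  shows "\<bar>(\<integral>z. gauss_smooth (sqrt (\<epsilon> * (b' - b))) u (euler_mean \<nu> b (mix_var \<epsilon> \<gamma> b) ((b' - b) / (1 - b)) z)
          \<partial>gauss_mixture \<nu> b (mix_var \<epsilon> \<gamma> b))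
        - (\<integral>z. u z \<partial>gauss_mixture \<nu> b' (mix_var \<epsilon> \<gamma> b'))\<bar>
    \<le> L * step_const \<epsilon> \<gamma> c * ((b' - b) * sqrt (b' - b))"
proof -
  define h where "h = b' - b"
  define s where "s = 1 - b"
  define s0 where "s0 = 1 - c"
  define \<delta> where "\<delta> = h / s"
  define r where "r = sqrt (\<epsilon> * h)"
  have h: "0 < h" "h \<le> 1" "b' = b + h" and s: "0 < s0" "s0 \<le> s" "0 < s" "h < s" using par by (simp_all add: h_def s_def s0_def)
  have \<delta>: "0 \<le> \<delta>" "\<delta> < 1" using h s by (simp_all add: \<delta>_def)
  have \<delta>_le: "\<delta> \<le> h / s0" unfolding \<delta>_def using h s by (intro divide_left_mono) simp_all
  have r: "r > 0" using par h by (simp add: r_def)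
  have L: "L \<ge> 0" by (rule lipschitz_on_nonneg[OF lip])
  have sm: "(2 * K)\<^sup>2 * h \<le> \<epsilon> * s0\<^sup>2" using small unfolding h_def s0_def .
  have small': "\<delta> * (2 * K) \<le> r"
  proof -
    have "\<delta> * (2 * K) \<le> h / s0 * (2 * K)" using \<delta>_le K_nonneg by (intro mult_right_mono) simp_all
    also have "\<dots> \<le> r"
      unfolding r_def
    proof (rule real_le_rsqrt)
      have "(h / s0 * (2 * K))\<^sup>2 = h * ((2 * K)\<^sup>2 * h) / s0\<^sup>2"
        by (simp add: power_mult_distrib power_divide) (simp add: power2_eq_square)
      also have "\<dots> \<le> h * (\<epsilon> * s0\<^sup>2) / s0\<^sup>2"
        using sm h by (intro divide_right_mono mult_left_mono) auto
      also have "\<dots> = \<epsilon> * h" using s by simp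
      finally show "(h / s0 * (2 * K))\<^sup>2 \<le> \<epsilon> * h" .
    qed
    finally show ?thesis .
  qed
  define w where "w = s0 * min \<epsilon> \<gamma>"
  have v: "mix_var \<epsilon> \<gamma> b > 0" and v': "mix_var \<epsilon> \<gamma> b' \<ge> w"
    using par mix_var_ge[of \<epsilon> \<gamma> b' c] mix_var_pos[of \<epsilon> \<gamma> b] by (simp_all add: s0_def w_def)
  have c0: "w > 0" using s par by (simp add: w_def)
  have b': "(1 - \<delta>) * b + \<delta> = b'"
  proof -
    have "(1 - \<delta>) * b + \<delta> = b + \<delta> * s" by (simp add: s_def algebra_simps)
    then show ?thesis using s h by (simp add: \<delta>_def)
  qed
  have var: "(1 - \<delta>)\<^sup>2 * mix_var \<epsilon> \<gamma> b + r\<^sup>2 = mix_var \<epsilon> \<gamma> b' + \<epsilon> * h\<^sup>2 / s"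
    using euler_step_variance[of b h \<epsilon> \<gamma>] par h by (simp add: \<delta>_def s_def r_def)
  have hh: "h\<^sup>2 \<le> h * sqrt h"
  proof -
    have "h \<le> sqrt h" using h by (intro real_le_rsqrt) (simp add: power2_eq_square mult_left_le)
    then show ?thesis using h by (simp add: power2_eq_square)
  qed
  have A: "(\<delta> * (2 * K))\<^sup>2 / r \<le> (2 * K)\<^sup>2 / (s0\<^sup>2 * sqrt \<epsilon>) * (h * sqrt h)"
  proof -
    have "(\<delta> * (2 * K))\<^sup>2 / r \<le> (h / s0 * (2 * K))\<^sup>2 / r"
      using \<delta> \<delta>_le r K_nonneg by (intro divide_right_mono power_mono mult_right_mono) simp_all
    also have "\<dots> = (2 * K)\<^sup>2 / (s0\<^sup>2 * sqrt \<epsilon>) * (h\<^sup>2 / sqrt h)"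
      by (simp add: r_def real_sqrt_mult power_mult_distrib power_divide mult_ac)
    also have "h\<^sup>2 / sqrt h = h * sqrt h" 
    proof -
      have "h\<^sup>2 = (h * sqrt h) * sqrt h" using h by (simp add: power2_eq_square)
      then show ?thesis using h by simp
    qed
    finally show ?thesis .
  qed
  have "\<bar>sqrt ((1 - \<delta>)\<^sup>2 * mix_var \<epsilon> \<gamma> b + r\<^sup>2) - sqrt (mix_var \<epsilon> \<gamma> b')\<bar> \<le> (\<epsilon> * h\<^sup>2 / s) / sqrt (w)"
    unfolding var using c0 v' par s by (intro sqrt_diff_le) simp_all
  also have "\<dots> \<le> (\<epsilon> * (h * sqrt h) / s0) / sqrt (w)"
    using par hh s c0 h by (intro divide_right_mono frac_le mult_left_mono) simp_all
  also have "\<dots> = \<epsilon> / (s0 * sqrt (w)) * (h * sqrt h)" by simp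
  finally have Bd: "\<bar>sqrt ((1 - \<delta>)\<^sup>2 * mix_var \<epsilon> \<gamma> b + r\<^sup>2) - sqrt (mix_var \<epsilon> \<gamma> b')\<bar>
    \<le> \<epsilon> / (s0 * sqrt (w)) * (h * sqrt h)" .
  have "\<bar>(\<integral>z. gauss_smooth r u (euler_mean \<nu> b (mix_var \<epsilon> \<gamma> b) \<delta> z) \<partial>gauss_mixture \<nu> b (mix_var \<epsilon> \<gamma> b))
        - (\<integral>z. u z \<partial>gauss_mixture \<nu> b' (mix_var \<epsilon> \<gamma> b'))\<bar>
    \<le> (gauss_moment2 TYPE('v) + 1) * L * ((\<delta> * (2 * K))\<^sup>2 / r + \<bar>sqrt ((1 - \<delta>)\<^sup>2 * mix_var \<epsilon> \<gamma> b + r\<^sup>2) - sqrt (mix_var \<epsilon> \<gamma> b')\<bar>)"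
    using euler_step_weak_error[OF lip bdd v par(3) \<delta>(1,2) r small', of "mix_var \<epsilon> \<gamma> b'"] v' c0 unfolding b' by simp
  also have "\<dots> \<le> (gauss_moment2 TYPE('v) + 1) * L * ((2 * K)\<^sup>2 / (s0\<^sup>2 * sqrt \<epsilon>) * (h * sqrt h) + \<epsilon> / (s0 * sqrt (w)) * (h * sqrt h))"
    using A Bd L gauss_moment2_nonneg[where 'v = 'v] by (intro mult_left_mono add_mono) simp_all
  also have "\<dots> = L * step_const \<epsilon> \<gamma> c * (h * sqrt h)"
    unfolding step_const_def s0_def[symmetric] w_def[symmetric] by (simp add: algebra_simps)
  finally show ?thesis unfolding h_def r_def \<delta>_def s_def .
qed

text \<open>
  Induction over the steps, simultaneously for all Lipschitz functions: the expectation of \<open>f\<close> after a step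
  is the expectation of another Lipschitz function before it, and one more step error is committed.
\<close>

theorem euler_scheme_weak_error:
  fixes E :: "nat \<Rightarrow> 'a \<Rightarrow> 'v" and g :: "nat \<Rightarrow> real"
  assumes M: "prob_space M"
    and par: "0 < \<epsilon>" "0 < \<gamma>" "c < 1"
    and g0: "g 0 = 0" and g_incr: "\<And>i. i < n \<Longrightarrow> g i < g (Suc i)" and gn: "g n \<le> c"
    and small: "\<And>i. i < n \<Longrightarrow> (2 * K)\<^sup>2 * (g (Suc i) - g i) \<le> \<epsilon> * (1 - c)\<^sup>2"
    and E0: "distr M borel (E 0) = gaussian_measure \<gamma>"
    and E_meas: "\<And>i. i \<le> n \<Longrightarrow> E i \<in> borel_measurable M"
    and E_step: "\<And>i u. i < n \<Longrightarrow> u \<in> borel_measurable borel \<Longrightarrow> bounded (range u) \<Longrightarrow>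
      (\<integral>\<omega>. u (E (Suc i) \<omega>) \<partial>M) = (\<integral>\<omega>. gauss_smooth (sqrt (\<epsilon> * (g (Suc i) - g i))) u
        (euler_mean \<nu> (g i) (mix_var \<epsilon> \<gamma> (g i)) ((g (Suc i) - g i) / (1 - g i)) (E i \<omega>)) \<partial>M)"
    and lip: "L-lipschitz_on UNIV f" and bdd: "\<And>x. \<bar>f x\<bar> \<le> (B :: real)"
  shows "\<bar>(\<integral>\<omega>. f (E n \<omega>) \<partial>M) - (\<integral>z. f z \<partial>gauss_mixture \<nu> (g n) (mix_var \<epsilon> \<gamma> (g n)))\<bar>
    \<le> L * exp (step_lip \<epsilon> \<gamma> c * g n) * step_const \<epsilon> \<gamma> c * (\<Sum>i<n. (g (Suc i) - g i) * sqrt (g (Suc i) - g i))"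
proof -
  define C where "C = step_const \<epsilon> \<gamma> c"
  define \<Lambda> where "\<Lambda> = step_lip \<epsilon> \<gamma> c"
  define h where "h i = g (Suc i) - g i" for i
  have C: "C \<ge> 0" and \<Lambda>: "\<Lambda> \<ge> 0"
    unfolding C_def \<Lambda>_def using par by (simp_all add: step_const_nonneg step_lip_nonneg)
  have g_mono: "g i \<le> g j" if "i \<le> j" "j \<le> n" for i j
    using that
  proof (induction j rule: dec_induct)
    case (step j)
    then show ?case using g_incr[of j] by simp
  qed simp
  have "i \<le> n \<Longrightarrow> L-lipschitz_on UNIV f \<Longrightarrow> (\<And>x. \<bar>f x\<bar> \<le> B) \<Longrightarrow>
    \<bar>(\<integral>\<omega>. f (E i \<omega>) \<partial>M) - (\<integral>z. f z \<partial>gauss_mixture \<nu> (g i) (mix_var \<epsilon> \<gamma> (g i)))\<bar>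
      \<le> L * exp (\<Lambda> * g i) * C * (\<Sum>j<i. h j * sqrt (h j))" for i L f
  proof (induction i arbitrary: L f)
    case 0
    have [measurable]: "f \<in> borel_measurable borel"
      by (intro borel_measurable_continuous_onI lipschitz_on_continuous_on[OF 0(2)])
    have [measurable]: "E 0 \<in> borel_measurable M" by (rule E_meas) simp
    have "(\<integral>\<omega>. f (E 0 \<omega>) \<partial>M) = (\<integral>z. f z \<partial>gaussian_measure \<gamma>)"
      using integral_distr[of "E 0" M borel f] by (simp add: E0)
    also have "gaussian_measure \<gamma> = distr std_gauss borel (\<lambda>w :: 'v. sqrt \<gamma> *\<^sub>R w)"
      using distr_gaussian_scale[of "sqrt \<gamma>" 1, where 'v = 'v] par by simp
    also have "(\<integral>z. f z \<partial>\<dots>) = (\<integral>z. f z \<partial>gauss_mixture \<nu> (g 0) (mix_var \<epsilon> \<gamma> (g 0)))"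
    proof -
      have "f \<in> borel_measurable borel" by measurable
      from integral_gauss_mixture[OF this 0(3)] show ?thesis
        using prob_space by (simp add: integral_distr gauss_smooth_def g0 mix_var_def)
    qed
    finally show ?case by simp
  next
    case (Suc i)
    let ?b = "g i" and ?b' = "g (Suc i)"
    let ?m = "euler_mean \<nu> ?b (mix_var \<epsilon> \<gamma> ?b) (h i / (1 - ?b))"
    define P where "P x = gauss_smooth (sqrt (\<epsilon> * h i)) f (?m x)" for x
    have i: "i < n" using Suc.prems by simp
    have b: "0 \<le> ?b" "?b < ?b'" "?b' \<le> c" using g_mono[of 0 i] g_mono[of "Suc i" n] g_incr[OF i] i gn g0 by auto
    have hi: "h i > 0" using b by (simp add: h_def)
    have fm [measurable]: "f \<in> borel_measurable borel"
      by (intro borel_measurable_continuous_onI lipschitz_on_continuous_on[OF Suc.prems(2)])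
    have L: "L \<ge> 0" by (rule lipschitz_on_nonneg[OF Suc.prems(2)])
    have P_lip: "(L * (1 + \<Lambda> * h i))-lipschitz_on UNIV P"
    proof -
      have "L-lipschitz_on (?m ` UNIV) (gauss_smooth (sqrt (\<epsilon> * h i)) f)"
        using gauss_smooth_lipschitz[OF Suc.prems(2,3)] by (rule lipschitz_on_subset) simp
      from lipschitz_on_compose[OF euler_mean_step_lipschitz[of \<epsilon> \<gamma> ?b ?b' c, folded h_def \<Lambda>_def] this]
      show ?thesis using par b by (simp add: P_def[abs_def] o_def)
    qed
    have P_bdd: "\<bar>P x\<bar> \<le> B" for x unfolding P_def by (rule gauss_smooth_bounded[OF fm Suc.prems(3)])
    have "(\<integral>\<omega>. f (E (Suc i) \<omega>) \<partial>M) = (\<integral>\<omega>. P (E i \<omega>) \<partial>M)"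
    proof -
      have "bounded (range f)" using Suc.prems(3) by (auto simp: bounded_iff)
      then show ?thesis using E_step[OF i fm] by (simp add: P_def h_def)
    qed
    moreover have "\<bar>(\<integral>\<omega>. P (E i \<omega>) \<partial>M) - (\<integral>z. P z \<partial>gauss_mixture \<nu> ?b (mix_var \<epsilon> \<gamma> ?b))\<bar>
        \<le> (L * (1 + \<Lambda> * h i)) * exp (\<Lambda> * ?b) * C * (\<Sum>j<i. h j * sqrt (h j))"
      using i by (intro Suc.IH P_lip P_bdd) simp
    moreover have "\<bar>(\<integral>z. P z \<partial>gauss_mixture \<nu> ?b (mix_var \<epsilon> \<gamma> ?b)) - (\<integral>z. f z \<partial>gauss_mixture \<nu> ?b' (mix_var \<epsilon> \<gamma> ?b'))\<bar>
        \<le> L * C * (h i * sqrt (h i))"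
      unfolding P_def C_def h_def
      by (rule schedule_step_weak_error[OF Suc.prems(2,3) par(1,2) b par(3) small[OF i]])
    ultimately have "\<bar>(\<integral>\<omega>. f (E (Suc i) \<omega>) \<partial>M) - (\<integral>z. f z \<partial>gauss_mixture \<nu> ?b' (mix_var \<epsilon> \<gamma> ?b'))\<bar>
        \<le> (L * (1 + \<Lambda> * h i)) * exp (\<Lambda> * ?b) * C * (\<Sum>j<i. h j * sqrt (h j)) + L * C * (h i * sqrt (h i))"
      by linarith
    also have "\<dots> \<le> L * exp (\<Lambda> * ?b') * C * (\<Sum>j<i. h j * sqrt (h j)) + L * exp (\<Lambda> * ?b') * C * (h i * sqrt (h i))"
    proof (rule add_mono)
      have "(1 + \<Lambda> * h i) * exp (\<Lambda> * ?b) \<le> exp (\<Lambda> * h i) * exp (\<Lambda> * ?b)"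
        by (intro mult_right_mono exp_ge_add_one_self) simp
      also have "\<dots> = exp (\<Lambda> * ?b')" unfolding exp_add[symmetric] by (simp add: h_def algebra_simps)
      finally have "L * ((1 + \<Lambda> * h i) * exp (\<Lambda> * ?b)) \<le> L * exp (\<Lambda> * ?b')" using L by (rule mult_left_mono)
      moreover have "0 \<le> (\<Sum>j<i. h j * sqrt (h j))"
        using i g_incr by (intro sum_nonneg mult_nonneg_nonneg) (auto simp: h_def intro: less_imp_le)
      ultimately show "(L * (1 + \<Lambda> * h i)) * exp (\<Lambda> * ?b) * C * (\<Sum>j<i. h j * sqrt (h j))
          \<le> L * exp (\<Lambda> * ?b') * C * (\<Sum>j<i. h j * sqrt (h j))"
        using C by (intro mult_right_mono) (simp_all add: mult.assoc)
      have "1 \<le> exp (\<Lambda> * ?b')" using \<Lambda> b by simp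
      then have "L * 1 \<le> L * exp (\<Lambda> * ?b')" using L by (intro mult_left_mono)
      then show "L * C * (h i * sqrt (h i)) \<le> L * exp (\<Lambda> * ?b') * C * (h i * sqrt (h i))"
        using C hi by (intro mult_right_mono) simp_all
    qed
    also have "\<dots> = L * exp (\<Lambda> * ?b') * C * (\<Sum>j<Suc i. h j * sqrt (h j))" by (simp add: distrib_left)
    finally show ?case .
  qed
  from this[OF order_refl lip bdd] show ?thesis by (simp add: C_def \<Lambda>_def h_def)
qed

end

section \<open>Wiener integrals of step functions\<close>

lemma gaussian_inner:
  fixes Y :: "'a \<Rightarrow> 'v::euclidean_space"
  assumes M: "prob_space M" and [measurable]: "Y \<in> borel_measurable M"
    and law: "distr M borel Y = gaussian_measure v" and v: "v > 0"
  shows gaussian_norm_sq: "has_bochner_integral M (\<lambda>\<omega>. (norm (Y \<omega>))\<^sup>2) (v * gauss_moment2 TYPE('v))"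
    and gaussian_inner_mean: "has_bochner_integral M (\<lambda>\<omega>. a \<bullet> Y \<omega>) 0"
proof -
  have std: "gaussian_measure v = distr std_gauss borel (\<lambda>w :: 'v. sqrt v *\<^sub>R w)"
    using distr_gaussian_scale[of "sqrt v" 1, where 'v = 'v] v by simp
  have *: "has_bochner_integral M (\<lambda>\<omega>. f (Y \<omega>)) x"
    if "has_bochner_integral std_gauss (\<lambda>w. f (sqrt v *\<^sub>R w)) x" and [measurable]: "f \<in> borel_measurable borel"
    for f :: "'v \<Rightarrow> real" and x
  proof -
    have "has_bochner_integral (distr std_gauss borel (\<lambda>w. sqrt v *\<^sub>R w)) f x"
      using that by (simp add: has_bochner_integral_iff integrable_distr_eq integral_distr)
    then have "has_bochner_integral (distr M borel Y) f x" by (simp add: law std)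
    then show ?thesis by (simp add: has_bochner_integral_iff integrable_distr_eq integral_distr)
  qed
  have "has_bochner_integral std_gauss (\<lambda>w :: 'v. v * (norm w)\<^sup>2) (v * gauss_moment2 TYPE('v))"
    unfolding gauss_moment2_def
    by (intro has_bochner_integral_mult_right has_bochner_integral_integrable integrable_std_gauss_norm_sq)
  then show "has_bochner_integral M (\<lambda>\<omega>. (norm (Y \<omega>))\<^sup>2) (v * gauss_moment2 TYPE('v))"
    using v by (intro *) (simp_all add: power_mult_distrib)
  have "has_bochner_integral std_gauss (\<lambda>w :: 'v. sqrt v * (a \<bullet> w)) (sqrt v * 0)"
    using has_bochner_integral_integrable[OF integrable_std_gauss_inner[of a]]
    by (intro has_bochner_integral_mult_right) (simp add: integral_std_gauss_inner)
  then show "has_bochner_integral M (\<lambda>\<omega>. a \<bullet> Y \<omega>) 0"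
    by (intro *) simp_all
qed

locale brownian = prob_space M for M :: "'a measure" +
  fixes W :: "real \<Rightarrow> 'a \<Rightarrow> 'v::euclidean_space"
  assumes bm: "brownian_motion M W"
begin

lemma W_measurable [measurable]: "0 \<le> t \<Longrightarrow> W t \<in> borel_measurable M"
  using bm by (simp add: brownian_motion_def)

lemma increment_law: "0 \<le> s \<Longrightarrow> s < t \<Longrightarrow> distr M borel (\<lambda>\<omega>. W t \<omega> - W s \<omega>) = gaussian_measure (t - s)"
  using bm by (simp add: brownian_motion_def)

lemma increments_indep:
  "0 \<le> p 0 \<Longrightarrow> strict_mono p \<Longrightarrow> indep_vars (\<lambda>_. borel) (\<lambda>i \<omega>. W (p (Suc i)) \<omega> - W (p i) \<omega>) {..<n}"
  using bm by (simp add: brownian_motion_def)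

lemma increment_norm_sq:
  assumes "0 \<le> s" "s \<le> t"
  shows "has_bochner_integral M (\<lambda>\<omega>. (norm (W t \<omega> - W s \<omega>))\<^sup>2) ((t - s) * gauss_moment2 TYPE('v))"
proof (cases "s = t")
  case True
  then show ?thesis using has_bochner_integral_zero[of M] by simp
next
  case False
  then show ?thesis
    using assms by (intro gaussian_norm_sq[OF prob_space_axioms _ increment_law]) simp_all
qed

lemma increment_inner_integrable:
  assumes "0 \<le> a" "0 \<le> b" "0 \<le> c" "0 \<le> d"
  shows "integrable M (\<lambda>\<omega>. (W b \<omega> - W a \<omega>) \<bullet> (W d \<omega> - W c \<omega>))"
proof -
  have i: "integrable M (\<lambda>\<omega>. (norm (W t \<omega> - W s \<omega>))\<^sup>2)" if "0 \<le> s" "0 \<le> t" for s t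
    using increment_norm_sq[of s t] increment_norm_sq[of t s] that
    by (cases "s \<le> t") (auto simp: norm_minus_commute intro: has_bochner_integral_integrable integrable.intros)
  show ?thesis
  proof (rule Bochner_Integration.integrable_bound)
    show "integrable M (\<lambda>\<omega>. (norm (W b \<omega> - W a \<omega>))\<^sup>2 + (norm (W d \<omega> - W c \<omega>))\<^sup>2)"
      using assms by (intro Bochner_Integration.integrable_add i)
    have "\<bar>x \<bullet> y\<bar> \<le> (norm x)\<^sup>2 + (norm y)\<^sup>2" for x y :: 'v
    proof -
      have "2 * (norm x * norm y) \<le> (norm x)\<^sup>2 + (norm y)\<^sup>2"
        using sum_squares_bound[of "norm x" "norm y"] by simp
      moreover have "0 \<le> norm x * norm y" by simp
      ultimately show ?thesis using Cauchy_Schwarz_ineq2[of x y] by linarith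
    qed
    then show "AE \<omega> in M. norm ((W b \<omega> - W a \<omega>) \<bullet> (W d \<omega> - W c \<omega>))
        \<le> norm ((norm (W b \<omega> - W a \<omega>))\<^sup>2 + (norm (W d \<omega> - W c \<omega>))\<^sup>2)" by simp
  qed (use assms in measurable)
qed

lemma adjacent_increments_orthogonal:
  assumes "0 \<le> a" "a < b" "b < c"
  shows "(\<integral>\<omega>. (W b \<omega> - W a \<omega>) \<bullet> (W c \<omega> - W b \<omega>) \<partial>M) = 0"
proof -
  \<comment> \<open>the partition points after \<open>c\<close> only make the sequence strictly increasing\<close>
  define p where "p i = (if i = 0 then a else if i = 1 then b else c + real (i - 2))" for i :: nat
  have "strict_mono p" using assms by (auto simp: strict_mono_Suc_iff p_def)
  from increments_indep[OF _ this, of 2] have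
    ind: "indep_vars (\<lambda>_. borel) (\<lambda>i \<omega>. W (p (Suc i)) \<omega> - W (p i) \<omega>) {..<2::nat}"
    using assms by (simp add: p_def)
  let ?V = "\<lambda>i \<omega>. W (p (Suc i)) \<omega> - W (p i) \<omega>"
  have "indep_var borel ((\<lambda>f. f 0) \<circ> (\<lambda>\<omega>. \<lambda>i\<in>{0}. ?V i \<omega>)) borel ((\<lambda>f. f 1) \<circ> (\<lambda>\<omega>. \<lambda>i\<in>{1}. ?V i \<omega>))"
    by (rule indep_var_compose[OF indep_var_restrict[OF ind, of "{0}" "{1}"]]) auto
  then have "indep_var borel (\<lambda>\<omega>. W (p 1) \<omega> - W (p 0) \<omega>) borel (\<lambda>\<omega>. W (p 2) \<omega> - W (p 1) \<omega>)"
    by (simp add: o_def numeral_2_eq_2)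
  then have iv: "indep_var borel (\<lambda>\<omega>. W b \<omega> - W a \<omega>) borel (\<lambda>\<omega>. W c \<omega> - W b \<omega>)"
    by (simp add: p_def)
  have m: "has_bochner_integral M (\<lambda>\<omega>. e \<bullet> (W c \<omega> - W b \<omega>)) 0" "has_bochner_integral M (\<lambda>\<omega>. e \<bullet> (W b \<omega> - W a \<omega>)) 0" for e
    using assms by (auto intro!: gaussian_inner_mean[OF prob_space_axioms _ increment_law])
  have e: "(\<integral>\<omega>. (e \<bullet> (W b \<omega> - W a \<omega>)) * (e \<bullet> (W c \<omega> - W b \<omega>)) \<partial>M) = 0"
    "integrable M (\<lambda>\<omega>. (e \<bullet> (W b \<omega> - W a \<omega>)) * (e \<bullet> (W c \<omega> - W b \<omega>)))" for e
  proof -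
    have "indep_var borel ((\<lambda>x. e \<bullet> x) \<circ> (\<lambda>\<omega>. W b \<omega> - W a \<omega>)) borel ((\<lambda>x. e \<bullet> x) \<circ> (\<lambda>\<omega>. W c \<omega> - W b \<omega>))"
      by (rule indep_var_compose[OF iv]) simp_all
    then have i: "indep_var borel (\<lambda>\<omega>. e \<bullet> (W b \<omega> - W a \<omega>)) borel (\<lambda>\<omega>. e \<bullet> (W c \<omega> - W b \<omega>))"
      by (simp add: o_def)
    show "(\<integral>\<omega>. (e \<bullet> (W b \<omega> - W a \<omega>)) * (e \<bullet> (W c \<omega> - W b \<omega>)) \<partial>M) = 0"
      by (subst indep_var_lebesgue_integral[OF i]) (use m[of e] in \<open>simp_all add: has_bochner_integral_iff\<close>)
    show "integrable M (\<lambda>\<omega>. (e \<bullet> (W b \<omega> - W a \<omega>)) * (e \<bullet> (W c \<omega> - W b \<omega>)))"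
      by (rule indep_var_integrable[OF i]) (use m[of e] in \<open>simp_all add: has_bochner_integral_iff\<close>)
  qed
  have "(\<integral>\<omega>. (W b \<omega> - W a \<omega>) \<bullet> (W c \<omega> - W b \<omega>) \<partial>M)
      = (\<integral>\<omega>. (\<Sum>e\<in>Basis. (e \<bullet> (W b \<omega> - W a \<omega>)) * (e \<bullet> (W c \<omega> - W b \<omega>))) \<partial>M)"
    by (subst euclidean_inner) (simp add: inner_commute)
  also have "\<dots> = 0" using e by (simp add: Bochner_Integration.integral_sum)
  finally show ?thesis .
qed

text \<open>
  Both increments are differences of increments from time \<open>0\<close>, and
  \<open>E (W\<^sub>s - W\<^sub>0) \<bullet> (W\<^sub>t - W\<^sub>0)\<close> is proportional to \<open>min s t\<close> because successive increments are orthogonal.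
\<close>

lemma increment_covariance:
  assumes "0 \<le> a" "0 \<le> b" "0 \<le> c" "0 \<le> d"
  shows "(\<integral>\<omega>. (W b \<omega> - W a \<omega>) \<bullet> (W d \<omega> - W c \<omega>) \<partial>M)
    = gauss_moment2 TYPE('v) * (min b d - min b c - min a d + min a c)"
proof -
  have sym: "(\<integral>\<omega>. (W s \<omega> - W 0 \<omega>) \<bullet> (W t \<omega> - W 0 \<omega>) \<partial>M) = gauss_moment2 TYPE('v) * s" if "0 \<le> s" "s \<le> t" for s t
  proof -
    have "(\<integral>\<omega>. (W s \<omega> - W 0 \<omega>) \<bullet> (W t \<omega> - W s \<omega>) \<partial>M) = 0"
      using adjacent_increments_orthogonal[of 0 s t] that by (cases "s = 0 \<or> s = t") auto
    moreover have "(\<integral>\<omega>. (W s \<omega> - W 0 \<omega>) \<bullet> (W s \<omega> - W 0 \<omega>) \<partial>M) = gauss_moment2 TYPE('v) * s"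
      using increment_norm_sq[of 0 s] that by (simp add: has_bochner_integral_iff power2_norm_eq_inner)
    moreover have "(W s \<omega> - W 0 \<omega>) \<bullet> (W t \<omega> - W 0 \<omega>)
        = (W s \<omega> - W 0 \<omega>) \<bullet> (W t \<omega> - W s \<omega>) + (W s \<omega> - W 0 \<omega>) \<bullet> (W s \<omega> - W 0 \<omega>)" for \<omega>
      by (simp flip: inner_add_right)
    ultimately show ?thesis
      using increment_inner_integrable[of 0 s s t] increment_inner_integrable[of 0 s 0 s] that by simp
  qed
  have cov: "(\<integral>\<omega>. (W s \<omega> - W 0 \<omega>) \<bullet> (W t \<omega> - W 0 \<omega>) \<partial>M) = gauss_moment2 TYPE('v) * min s t" if "0 \<le> s" "0 \<le> t" for s t
  proof (cases "s \<le> t")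
    case True then show ?thesis using sym[of s t] that by simp
  next
    case False
    then show ?thesis using sym[of t s] that by (subst inner_commute) simp
  qed
  have i: "integrable M (\<lambda>\<omega>. (W s \<omega> - W 0 \<omega>) \<bullet> (W t \<omega> - W 0 \<omega>))" if "0 \<le> s" "0 \<le> t" for s t
    using increment_inner_integrable[of 0 s 0 t] that by simp
  have "(W b \<omega> - W a \<omega>) \<bullet> (W d \<omega> - W c \<omega>)
      = (W b \<omega> - W 0 \<omega>) \<bullet> (W d \<omega> - W 0 \<omega>) - (W b \<omega> - W 0 \<omega>) \<bullet> (W c \<omega> - W 0 \<omega>)
      - (W a \<omega> - W 0 \<omega>) \<bullet> (W d \<omega> - W 0 \<omega>) + (W a \<omega> - W 0 \<omega>) \<bullet> (W c \<omega> - W 0 \<omega>)" for \<omega>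
    by (simp add: inner_diff)
  then have "(\<integral>\<omega>. (W b \<omega> - W a \<omega>) \<bullet> (W d \<omega> - W c \<omega>) \<partial>M)
      = gauss_moment2 TYPE('v) * min b d - gauss_moment2 TYPE('v) * min b c
      - gauss_moment2 TYPE('v) * min a d + gauss_moment2 TYPE('v) * min a c"
    using i assms by (simp add: cov)
  then show ?thesis by (simp add: algebra_simps)
qed

end

lemma integral_indicator_Ioc_Ioc:
  fixes a b c d :: real
  assumes "a \<le> b" "c \<le> d"
  shows "has_bochner_integral lborel (\<lambda>s. indicator {a<..b} s * indicator {c<..d} s :: real)
    (min b d - min b c - min a d + min a c)"
proof -
  have "{a<..b} \<inter> {c<..d} = {max a c<..min b d}" by auto
  then have eq: "(\<lambda>s. indicator {a<..b} s * indicator {c<..d} s :: real) = indicator {max a c<..min b d}"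
    by (simp add: indicator_inter_arith[symmetric] fun_eq_iff)
  have "emeasure lborel {u<..v} < \<infinity>" and m: "measure lborel {u<..v} = max 0 (v - u)" for u v :: real
    by (cases "u \<le> v"; simp)+
  then have "has_bochner_integral lborel (indicator {max a c<..min b d} :: real \<Rightarrow> real)
      (measure lborel {max a c<..min b d})"
    by (intro has_bochner_integral_real_indicator) simp_all
  moreover have "max 0 (min b d - max a c) = min b d - min b c - min a d + min a c"
    using assms by linarith
  ultimately show ?thesis unfolding eq m by simp
qed

context brownian
begin

text \<open>
  The isometry follows by bilinearity from the covariance of two increments, so that the intervals may overlap
  and two step functions on different partitions can be compared directly.
\<close>

lemma increments_isometry:
  fixes q a b :: "'i \<Rightarrow> real"
  assumes fin: "finite I" and ab: "\<And>i. i \<in> I \<Longrightarrow> 0 \<le> a i \<and> a i \<le> b i"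
  shows "has_bochner_integral M (\<lambda>\<omega>. (norm (\<Sum>i\<in>I. q i *\<^sub>R (W (b i) \<omega> - W (a i) \<omega>)))\<^sup>2)
      (gauss_moment2 TYPE('v) * (\<integral>s. (\<Sum>i\<in>I. q i * indicator {a i<..b i} s)\<^sup>2 \<partial>lborel))"
    and "integrable lborel (\<lambda>s. (\<Sum>i\<in>I. q i * indicator {a i<..b i} s)\<^sup>2)"
proof -
  define k where "k i j = min (b i) (b j) - min (b i) (a j) - min (a i) (b j) + min (a i) (a j)" for i j
  have "has_bochner_integral M (\<lambda>\<omega>. \<Sum>i\<in>I. \<Sum>j\<in>I. q i * (q j * ((W (b j) \<omega> - W (a j) \<omega>) \<bullet> (W (b i) \<omega> - W (a i) \<omega>))))
      (\<Sum>i\<in>I. \<Sum>j\<in>I. q i * (q j * (gauss_moment2 TYPE('v) * k i j)))"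
  proof (intro has_bochner_integral_sum has_bochner_integral_mult_right)
    fix i j assume "i \<in> I" "j \<in> I"
    then have "0 \<le> a i" "0 \<le> b i" "0 \<le> a j" "0 \<le> b j" using ab[of i] ab[of j] by auto
    then show "has_bochner_integral M (\<lambda>\<omega>. (W (b j) \<omega> - W (a j) \<omega>) \<bullet> (W (b i) \<omega> - W (a i) \<omega>)) (gauss_moment2 TYPE('v) * k i j)"
      unfolding has_bochner_integral_iff k_def
      by (subst (1 2) inner_commute) (simp add: increment_inner_integrable increment_covariance)
  qed
  then have 1: "has_bochner_integral M (\<lambda>\<omega>. (norm (\<Sum>i\<in>I. q i *\<^sub>R (W (b i) \<omega> - W (a i) \<omega>)))\<^sup>2)
      (gauss_moment2 TYPE('v) * (\<Sum>i\<in>I. \<Sum>j\<in>I. q i * (q j * k i j)))"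
    by (simp add: power2_norm_eq_inner inner_sum_left inner_sum_right sum_distrib_left mult.left_commute)
  have "has_bochner_integral lborel (\<lambda>s. \<Sum>i\<in>I. \<Sum>j\<in>I. q i * (q j * (indicator {a i<..b i} s * indicator {a j<..b j} s)))
      (\<Sum>i\<in>I. \<Sum>j\<in>I. q i * (q j * k i j))"
    unfolding k_def using ab by (intro has_bochner_integral_sum has_bochner_integral_mult_right integral_indicator_Ioc_Ioc) auto
  then have 2: "has_bochner_integral lborel (\<lambda>s. (\<Sum>i\<in>I. q i * indicator {a i<..b i} s)\<^sup>2) (\<Sum>i\<in>I. \<Sum>j\<in>I. q i * (q j * k i j))"
    by (simp add: power2_eq_square sum_product mult_ac)
  show "has_bochner_integral M (\<lambda>\<omega>. (norm (\<Sum>i\<in>I. q i *\<^sub>R (W (b i) \<omega> - W (a i) \<omega>)))\<^sup>2)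
      (gauss_moment2 TYPE('v) * (\<integral>s. (\<Sum>i\<in>I. q i * indicator {a i<..b i} s)\<^sup>2 \<partial>lborel))"
    using 1 2 by (simp add: has_bochner_integral_iff)
  show "integrable lborel (\<lambda>s. (\<Sum>i\<in>I. q i * indicator {a i<..b i} s)\<^sup>2)"
    using 2 by (simp add: has_bochner_integral_iff)
qed

lemma step_on_points:
  assumes "step_on T (n, p, c)" "i \<le> n"
  shows "0 \<le> p i" "p i \<le> T"
proof -
  have "p 0 \<le> p i" using assms(2,1) by (induction i) (auto simp: step_on_def intro: order_trans)
  moreover have "p i \<le> p n" using assms(2,1)
    by (induction rule: inc_induct) (auto simp: step_on_def intro: order_trans)
  ultimately show "0 \<le> p i" "p i \<le> T" using assms(1) by (auto simp: step_on_def)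
qed

lemma step_integral_measurable [measurable]:
  assumes "step_on T S" shows "step_integral W S \<in> borel_measurable M"
proof -
  obtain n p c where S: "S = (n, p, c)" by (cases S)
  show ?thesis
    using assms step_on_points[of T n p c] unfolding step_integral_def S by simp
qed

lemma step_fun_measurable [measurable]: "step_fun S \<in> borel_measurable borel"
proof -
  obtain n p c where S: "S = (n, p, c)" by (cases S)
  show ?thesis unfolding step_fun_def S prod.case by measurable
qed

lemma step_fun_outside:
  assumes "step_on T S" "s \<notin> {0..T}" shows "step_fun S s = 0"
proof -
  obtain n p c where S: "S = (n, p, c)" by (cases S)
  show ?thesis
    unfolding step_fun_def S prod.case
  proof (rule sum.neutral, intro ballI)
    fix i assume "i \<in> {..<n}"
    then show "c i * indicator {p i<..p (Suc i)} s = 0"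
      using assms step_on_points[of T n p c i] step_on_points[of T n p c "Suc i"] by (auto simp: S indicator_def)
  qed
qed

lemma step_integral_isometry:
  assumes S: "step_on T S" and S': "step_on T S'"
  shows "(\<integral>\<^sup>+\<omega>. ennreal ((norm (step_integral W S \<omega> - step_integral W S' \<omega>))\<^sup>2) \<partial>M)
    = ennreal (gauss_moment2 TYPE('v)) * (\<integral>\<^sup>+s. ennreal ((step_fun S s - step_fun S' s)\<^sup>2) \<partial>lborel)"
proof -
  obtain n p c where Seq: "S = (n, p, c)" by (cases S)
  obtain n' p' c' where Seq': "S' = (n', p', c')" by (cases S')
  define I where "I = {..<n} <+> {..<n'}"
  define a where "a = case_sum p p'"
  define b where "b = case_sum (\<lambda>i. p (Suc i)) (\<lambda>i. p' (Suc i))"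
  define q where "q = case_sum c (\<lambda>i. - c' i)"
  have fin: "finite I" by (simp add: I_def)
  have ab: "0 \<le> a i \<and> a i \<le> b i" if "i \<in> I" for i
  proof (cases i)
    case (Inl j)
    then have "j < n" using that by (auto simp: I_def)
    then show ?thesis
      using S step_on_points(1)[OF S[unfolded Seq], of j] by (simp add: a_def b_def Seq step_on_def Inl)
  next
    case (Inr j)
    then have "j < n'" using that by (auto simp: I_def)
    then show ?thesis
      using S' step_on_points(1)[OF S'[unfolded Seq'], of j] by (simp add: a_def b_def Seq' step_on_def Inr)
  qed
  have 1: "(\<Sum>i\<in>I. q i *\<^sub>R (W (b i) \<omega> - W (a i) \<omega>)) = step_integral W S \<omega> - step_integral W S' \<omega>" for \<omega>
    by (simp add: I_def sum.Plus q_def a_def b_def step_integral_def Seq Seq' sum_negf)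
  have 2: "(\<Sum>i\<in>I. q i * indicator {a i<..b i} s) = step_fun S s - step_fun S' s" for s
    unfolding I_def q_def a_def b_def step_fun_def Seq Seq' prod.case
    by (subst sum.Plus) (simp_all only: finite_lessThan sum.case mult_minus_left sum_negf o_def add_uminus_conv_diff)
  note iso = increments_isometry[of I a b q, OF fin ab, unfolded 1 2]
  have "(\<integral>\<^sup>+\<omega>. ennreal ((norm (step_integral W S \<omega> - step_integral W S' \<omega>))\<^sup>2) \<partial>M)
      = ennreal (gauss_moment2 TYPE('v) * (\<integral>s. (step_fun S s - step_fun S' s)\<^sup>2 \<partial>lborel))"
    using iso(1) by (subst nn_integral_eq_integral) (simp_all add: has_bochner_integral_iff)
  also have "\<dots> = ennreal (gauss_moment2 TYPE('v)) * ennreal (\<integral>s. (step_fun S s - step_fun S' s)\<^sup>2 \<partial>lborel)"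
    by (simp add: ennreal_mult gauss_moment2_nonneg)
  also have "ennreal (\<integral>s. (step_fun S s - step_fun S' s)\<^sup>2 \<partial>lborel) = (\<integral>\<^sup>+s. ennreal ((step_fun S s - step_fun S' s)\<^sup>2) \<partial>lborel)"
    using iso(2) by (subst nn_integral_eq_integral) simp_all
  finally show ?thesis .
qed

text \<open>
  The integral \<open>I\<close> is a limit of elementary integrals of step functions \<open>Z k\<close>. By the isometry, their distance from the
  elementary integral of \<open>S\<close> is proportional to the \<open>L\<^sup>2\<close> distance of \<open>Z k\<close> and \<open>S\<close>, and the functions \<open>Z k\<close> converge to \<open>g\<close>.
\<close>

lemma wiener_integral_step_error:
  assumes I: "has_wiener_integral M W g T I" and S: "step_on T S" and T: "0 \<le> T"
    and g [measurable]: "(\<lambda>s. g s * indicator {0..T} s) \<in> borel_measurable borel"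
    and close: "\<And>s. 0 < s \<Longrightarrow> s \<le> T \<Longrightarrow> \<bar>g s - step_fun S s\<bar> \<le> \<theta>"
  shows "(\<integral>\<^sup>+\<omega>. ennreal ((norm (I \<omega> - step_integral W S \<omega>))\<^sup>2) \<partial>M)
    \<le> ennreal (4 * gauss_moment2 TYPE('v) * \<theta>\<^sup>2 * T)"
proof -
  define \<kappa> where "\<kappa> = gauss_moment2 TYPE('v)"
  have \<kappa>: "\<kappa> \<ge> 0" unfolding \<kappa>_def by (rule gauss_moment2_nonneg)
  obtain Z where Z: "\<And>k. step_on T (Z k)"
    and Zg: "(\<lambda>k. \<integral>\<^sup>+ s. ennreal ((g s - step_fun (Z k) s)\<^sup>2) * indicator {0..T} s \<partial>lborel) \<longlonglongrightarrow> 0"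
    and ZI: "(\<lambda>k. \<integral>\<^sup>+ \<omega>. ennreal ((norm (I \<omega> - step_integral W (Z k) \<omega>))\<^sup>2) \<partial>M) \<longlonglongrightarrow> 0"
    and Im [measurable]: "I \<in> borel_measurable M"
    using I unfolding has_wiener_integral_def by blast
  note [measurable] = step_integral_measurable[OF Z] step_integral_measurable[OF S]
  have sq: "(norm (x - z))\<^sup>2 \<le> 2 * (norm (x - y))\<^sup>2 + 2 * (norm (y - z))\<^sup>2" for x y z :: "'b::real_normed_vector"
  proof -
    have "(norm (x - z))\<^sup>2 \<le> (norm (x - y) + norm (y - z))\<^sup>2"
      using norm_triangle_ineq[of "x - y" "y - z"] by (intro power_mono) simp_all
    also have "\<dots> \<le> 2 * (norm (x - y))\<^sup>2 + 2 * (norm (y - z))\<^sup>2"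
      using sum_squares_bound[of "norm (x - y)" "norm (y - z)"] by (simp add: power2_sum)
    finally show ?thesis .
  qed
  define A where "A k = (\<integral>\<^sup>+ \<omega>. ennreal ((norm (I \<omega> - step_integral W (Z k) \<omega>))\<^sup>2) \<partial>M)" for k
  define D where "D k = (\<integral>\<^sup>+ s. ennreal ((g s - step_fun (Z k) s)\<^sup>2) * indicator {0..T} s \<partial>lborel)" for k
  define G where "G = (\<integral>\<^sup>+ s. ennreal ((g s - step_fun S s)\<^sup>2) * indicator {0..T} s \<partial>lborel)"
  have gm: "(\<lambda>s. ennreal ((g s - step_fun S' s)\<^sup>2) * indicator {0..T} s) \<in> borel_measurable borel" for S'
  proof -
    have "(\<lambda>s. ennreal ((g s * indicator {0..T} s - step_fun S' s * indicator {0..T} s)\<^sup>2)) \<in> borel_measurable borel"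
      by measurable
    moreover have "ennreal ((g s * indicator {0..T} s - step_fun S' s * indicator {0..T} s)\<^sup>2)
        = ennreal ((g s - step_fun S' s)\<^sup>2) * indicator {0..T} s" for s
      by (simp add: indicator_def)
    ultimately show ?thesis by simp
  qed
  have "G \<le> (\<integral>\<^sup>+ s. ennreal (\<theta>\<^sup>2) * indicator {0..T} s \<partial>lborel)"
    unfolding G_def
  proof (rule nn_integral_mono_AE)
    have "AE s in lborel. s \<noteq> (0 :: real)" by (rule AE_lborel_singleton)
    then show "AE s in lborel. ennreal ((g s - step_fun S s)\<^sup>2) * indicator {0..T} s \<le> ennreal (\<theta>\<^sup>2) * indicator {0..T} s"
    proof eventually_elim
      case (elim s)
      have "(g s - step_fun S s)\<^sup>2 \<le> \<theta>\<^sup>2" if "s \<in> {0..T}"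
        using close[of s] elim that by (simp add: abs_le_square_iff[symmetric])
      then show ?case by (auto simp: indicator_def intro: ennreal_leI)
    qed
  qed
  also have "\<dots> = ennreal (\<theta>\<^sup>2 * T)" using T by (simp add: nn_integral_cmult_indicator ennreal_mult)
  finally have G: "G \<le> ennreal (\<theta>\<^sup>2 * T)" .
  then have G_fin: "G \<noteq> \<top>" using le_less_trans[OF G ennreal_less_top] by simp
  have "(\<integral>\<^sup>+\<omega>. ennreal ((norm (I \<omega> - step_integral W S \<omega>))\<^sup>2) \<partial>M) \<le> 2 * A k + 2 * (ennreal \<kappa> * (2 * D k + 2 * G))" for k
  proof -
    have "(\<integral>\<^sup>+\<omega>. ennreal ((norm (I \<omega> - step_integral W S \<omega>))\<^sup>2) \<partial>M)
        \<le> (\<integral>\<^sup>+\<omega>. 2 * ennreal ((norm (I \<omega> - step_integral W (Z k) \<omega>))\<^sup>2)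
            + 2 * ennreal ((norm (step_integral W (Z k) \<omega> - step_integral W S \<omega>))\<^sup>2) \<partial>M)"
    proof (rule nn_integral_mono)
      fix \<omega>
      show "ennreal ((norm (I \<omega> - step_integral W S \<omega>))\<^sup>2)
        \<le> 2 * ennreal ((norm (I \<omega> - step_integral W (Z k) \<omega>))\<^sup>2)
            + 2 * ennreal ((norm (step_integral W (Z k) \<omega> - step_integral W S \<omega>))\<^sup>2)"
        using ennreal_leI[OF sq[of "I \<omega>" "step_integral W S \<omega>" "step_integral W (Z k) \<omega>"]]
        by (simp add: ennreal_plus ennreal_mult)
    qed
    also have "\<dots> = 2 * A k + 2 * (ennreal \<kappa> * (\<integral>\<^sup>+s. ennreal ((step_fun (Z k) s - step_fun S s)\<^sup>2) \<partial>lborel))"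
      unfolding \<kappa>_def by (simp add: nn_integral_add nn_integral_cmult A_def step_integral_isometry[OF Z S])
    also have "(\<integral>\<^sup>+s. ennreal ((step_fun (Z k) s - step_fun S s)\<^sup>2) \<partial>lborel)
        \<le> (\<integral>\<^sup>+s. 2 * (ennreal ((g s - step_fun (Z k) s)\<^sup>2) * indicator {0..T} s)
            + 2 * (ennreal ((g s - step_fun S s)\<^sup>2) * indicator {0..T} s) \<partial>lborel)"
    proof (rule nn_integral_mono)
      fix s
      show "ennreal ((step_fun (Z k) s - step_fun S s)\<^sup>2)
        \<le> 2 * (ennreal ((g s - step_fun (Z k) s)\<^sup>2) * indicator {0..T} s)
            + 2 * (ennreal ((g s - step_fun S s)\<^sup>2) * indicator {0..T} s)"
      proof (cases "s \<in> {0..T}")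
        case True
        have "(step_fun (Z k) s - step_fun S s)\<^sup>2 \<le> 2 * (g s - step_fun (Z k) s)\<^sup>2 + 2 * (g s - step_fun S s)\<^sup>2"
          using sq[of "step_fun (Z k) s" "step_fun S s" "g s"] by (simp add: power2_commute)
        from ennreal_leI[OF this] show ?thesis using True by (simp add: ennreal_plus ennreal_mult)
      next
        case False
        then show ?thesis using step_fun_outside[OF Z False] step_fun_outside[OF S False] by simp
      qed
    qed
    also have "\<dots> = 2 * D k + 2 * G"
      using gm by (simp add: nn_integral_add nn_integral_cmult D_def G_def)
    finally show ?thesis by (simp add: mult_left_mono add_left_mono)
  qed
  moreover have "(\<lambda>k. 2 * A k + 2 * (ennreal \<kappa> * (2 * D k + 2 * G))) \<longlonglongrightarrow> 2 * 0 + 2 * (ennreal \<kappa> * (2 * 0 + 2 * G))"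
    using ZI Zg unfolding A_def[symmetric] D_def[symmetric]
    by (intro tendsto_intros) (simp_all add: G_fin ennreal_mult_eq_top_iff)
  ultimately have "(\<integral>\<^sup>+\<omega>. ennreal ((norm (I \<omega> - step_integral W S \<omega>))\<^sup>2) \<partial>M) \<le> 2 * 0 + 2 * (ennreal \<kappa> * (2 * 0 + 2 * G))"
    by (intro LIMSEQ_le_const) auto
  also note G
  also have "2 * 0 + 2 * (ennreal \<kappa> * (2 * 0 + 2 * ennreal (\<theta>\<^sup>2 * T))) = ennreal (4 * \<kappa> * \<theta>\<^sup>2 * T)"
  proof -
    have "ennreal (4 * \<kappa> * \<theta>\<^sup>2 * T) = ennreal (2 * (\<kappa> * (2 * (\<theta>\<^sup>2 * T))))" by (simp add: mult.assoc)
    also have "\<dots> = 2 * (ennreal \<kappa> * (2 * ennreal (\<theta>\<^sup>2 * T)))"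
      using \<kappa> T by (simp only: ennreal_mult' zero_le_mult_iff zero_le_power2 zero_le_numeral ennreal_numeral simp_thms)
    finally show ?thesis by simp
  qed
  finally show ?thesis by (simp add: \<kappa>_def mult_left_mono)
qed

lemma wiener_integral_step_error_L1:
  assumes I: "has_wiener_integral M W g T I" and S: "step_on T S" and T: "0 \<le> T"
    and g: "(\<lambda>s. g s * indicator {0..T} s) \<in> borel_measurable borel" and \<theta>: "\<theta> > 0"
    and close: "\<And>s. 0 < s \<Longrightarrow> s \<le> T \<Longrightarrow> \<bar>g s - step_fun S s\<bar> \<le> \<theta>"
  shows "integrable M (\<lambda>\<omega>. norm (I \<omega> - step_integral W S \<omega>))"
    and "(\<integral>\<omega>. norm (I \<omega> - step_integral W S \<omega>) \<partial>M) \<le> \<theta> * (1 + 4 * gauss_moment2 TYPE('v) * T)"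
proof -
  define \<kappa> where "\<kappa> = gauss_moment2 TYPE('v)"
  have \<kappa>: "\<kappa> \<ge> 0" unfolding \<kappa>_def by (rule gauss_moment2_nonneg)
  define R where "R \<omega> = norm (I \<omega> - step_integral W S \<omega>)" for \<omega>
  have [measurable]: "I \<in> borel_measurable M" using I by (simp add: has_wiener_integral_def)
  note [measurable] = step_integral_measurable[OF S]
  have Rm [measurable]: "R \<in> borel_measurable M" unfolding R_def[abs_def] by measurable
  have e: "(\<integral>\<^sup>+\<omega>. ennreal ((R \<omega>)\<^sup>2) \<partial>M) \<le> ennreal (4 * \<kappa> * \<theta>\<^sup>2 * T)"
    unfolding R_def \<kappa>_def by (rule wiener_integral_step_error[OF I S T g close])
  have i2: "integrable M (\<lambda>\<omega>. (R \<omega>)\<^sup>2)"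
    using le_less_trans[OF e ennreal_less_top] by (intro integrableI_nonneg) simp_all
  have e2: "(\<integral>\<omega>. (R \<omega>)\<^sup>2 \<partial>M) \<le> 4 * \<kappa> * \<theta>\<^sup>2 * T"
    using e \<kappa> T by (subst (asm) nn_integral_eq_integral[OF i2]) simp_all
  have b: "R \<omega> \<le> \<theta> + (R \<omega>)\<^sup>2 / \<theta>" for \<omega>
  proof -
    have "0 \<le> (\<theta> - R \<omega>)\<^sup>2 + \<theta> * R \<omega>" using \<theta> by (simp add: R_def)
    then have "R \<omega> * \<theta> \<le> \<theta> * \<theta> + (R \<omega>)\<^sup>2" by (simp add: power2_eq_square algebra_simps)
    then show ?thesis using \<theta> by (simp add: field_simps)
  qed
  have i1: "integrable M R"
  proof (rule Bochner_Integration.integrable_bound)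
    show "integrable M (\<lambda>\<omega>. \<theta> + (R \<omega>)\<^sup>2 / \<theta>)" using i2 by simp
    show "AE \<omega> in M. norm (R \<omega>) \<le> norm (\<theta> + (R \<omega>)\<^sup>2 / \<theta>)"
      using b \<theta> by (auto simp: R_def)
  qed simp
  then show "integrable M (\<lambda>\<omega>. norm (I \<omega> - step_integral W S \<omega>))" by (simp add: R_def[abs_def])
  have "(\<integral>\<omega>. R \<omega> \<partial>M) \<le> (\<integral>\<omega>. \<theta> + (R \<omega>)\<^sup>2 / \<theta> \<partial>M)" using i1 i2 b by (intro integral_mono) simp_all
  also have "\<dots> = \<theta> + (\<integral>\<omega>. (R \<omega>)\<^sup>2 \<partial>M) / \<theta>" using i2 prob_space by simp
  also have "\<dots> \<le> \<theta> + 4 * \<kappa> * \<theta>\<^sup>2 * T / \<theta>" using e2 \<theta> by (intro add_left_mono divide_right_mono) simp_all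
  also have "\<dots> = \<theta> * (1 + 4 * \<kappa> * T)" using \<theta> by (simp add: power2_eq_square field_simps)
  finally show "(\<integral>\<omega>. norm (I \<omega> - step_integral W S \<omega>) \<partial>M) \<le> \<theta> * (1 + 4 * gauss_moment2 TYPE('v) * T)"
    by (simp add: R_def \<kappa>_def)
qed

text \<open>
  The initial value is independent of the path, and the increments are independent of each other. The two
  combine because an event about the increments belongs to the \<open>\<sigma>\<close>-algebra of the path.
\<close>

lemma initial_increments_indep:
  fixes X0 :: "'a \<Rightarrow> 'v"
  assumes X0 [measurable]: "X0 \<in> borel_measurable M"
    and ind: "indep_set (sets (vimage_algebra (space M) X0 borel))
       (sets (vimage_algebra (space M) (\<lambda>\<omega>. \<lambda>s\<in>{0..}. W s \<omega>) (PiM {0..} (\<lambda>_. borel))))"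
    and p: "0 \<le> p 0" "strict_mono p"
  shows "indep_vars (\<lambda>_. borel) (\<lambda>i. case i of 0 \<Rightarrow> X0 | Suc j \<Rightarrow> (\<lambda>\<omega>. W (p (Suc j)) \<omega> - W (p j) \<omega>)) {..<Suc n}"
    (is "indep_vars _ ?V _")
proof -
  let ?D = "\<lambda>j \<omega>. W (p (Suc j)) \<omega> - W (p j) \<omega>"
  let ?F = "\<lambda>i. {?V i -` A \<inter> space M | A. A \<in> sets borel}"
  define N where "N = vimage_algebra (space M) (\<lambda>\<omega>. \<lambda>s\<in>{0..}. W s \<omega>) (PiM {0..} (\<lambda>_. borel :: 'v measure))"
  have p_nonneg: "0 \<le> p i" for i
    using p strict_mono_leD[OF p(2), of 0 i] by simp
  have WN [measurable]: "W s \<in> borel_measurable N" if "0 \<le> s" for s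
  proof -
    have "(\<lambda>\<omega>. \<lambda>s\<in>{0..}. W s \<omega>) \<in> N \<rightarrow>\<^sub>M PiM {0..} (\<lambda>_. borel)"
      unfolding N_def by (rule measurable_vimage_algebra1) (auto simp: space_PiM)
    from measurable_compose[OF this measurable_component_singleton[of s]] show ?thesis using that by simp
  qed
  have spN [simp]: "space N = space M" by (simp add: N_def)
  have DN: "?D j -` A \<inter> space M \<in> sets N" if "A \<in> sets borel" for j A
  proof -
    have "?D j \<in> borel_measurable N" using p_nonneg by measurable
    from measurable_sets[OF this that] show ?thesis by simp
  qed
  have rv: "random_variable borel (?V i)" for i
    using p_nonneg by (cases i) simp_all
  have "indep_sets ?F {..<Suc n}"
    unfolding indep_sets_def
  proof (intro conjI ballI allI impI)
    fix i show "?F i \<subseteq> events" using rv[of i] by (auto intro: measurable_sets)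
  next
    fix J A assume J: "J \<subseteq> {..<Suc n}" "J \<noteq> {}" "finite J" and A: "A \<in> Pi J ?F"
    define J' where "J' = {j. Suc j \<in> J}"
    have J': "finite J'" "J' \<subseteq> {..<n}"
    proof -
      have "J' = Suc -` J" by (auto simp: J'_def)
      then show "finite J'" using J(3) by (simp add: finite_vimageI)
      show "J' \<subseteq> {..<n}" using J(1) by (auto simp: J'_def)
    qed
    have "\<forall>j\<in>J'. \<exists>B. B \<in> sets borel \<and> A (Suc j) = ?D j -` B \<inter> space M"
      using A by (fastforce simp: J'_def Pi_iff)
    then obtain B where B: "\<And>j. j \<in> J' \<Longrightarrow> B j \<in> sets borel \<and> A (Suc j) = ?D j -` B j \<inter> space M" by metis
    have inc: "prob (\<Inter>j\<in>J'. A (Suc j)) = (\<Prod>j\<in>J'. prob (A (Suc j)))" if "J' \<noteq> {}"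
      using indep_varsD[OF increments_indep[OF p, of n] that J', of B] B by simp
    have AN: "A (Suc j) \<in> sets N" if "j \<in> J'" for j using DN B[OF that] by simp
    show "prob (\<Inter>j\<in>J. A j) = (\<Prod>j\<in>J. prob (A j))"
    proof (cases "0 \<in> J")
      case False
      then have eq: "J = Suc ` J'" unfolding J'_def by (auto simp: image_iff) (metis not0_implies_Suc)
      then have "J' \<noteq> {}" using J(2) by auto
      then show ?thesis using inc unfolding eq by (simp add: prod.reindex)
    next
      case True
      then have eq: "J = insert 0 (Suc ` J')" unfolding J'_def by (auto simp: image_iff) (metis not0_implies_Suc)
      obtain B0 where B0: "B0 \<in> sets borel" "A 0 = X0 -` B0 \<inter> space M" using A True by (force simp: Pi_iff)
      show ?thesis
      proof (cases "J' = {}")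
        case True then show ?thesis by (simp add: eq)
      next
        case False
        have "prob (A 0 \<inter> (\<Inter>j\<in>J'. A (Suc j))) = prob (A 0) * prob (\<Inter>j\<in>J'. A (Suc j))"
        proof (rule indep_setD[OF ind[folded N_def]])
          show "A 0 \<in> sets (vimage_algebra (space M) X0 borel)" using B0 by (simp add: in_vimage_algebra)
          show "(\<Inter>j\<in>J'. A (Suc j)) \<in> sets N" using J' False AN by (intro sets.finite_INT) auto
        qed
        then show ?thesis using J' inc[OF False] unfolding eq by (simp add: prod.reindex)
      qed
    qed
  qed
  then show ?thesis unfolding indep_vars_def2 using rv by simp
qed

end

section \<open>Comparison of a solution with its Euler scheme\<close>

text \<open>
  The indicator of a closed set is a decreasing limit of bounded Lipschitz functions of the distance to it.
\<close>

lemma measure_eqI_lipschitz: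
  fixes \<mu> \<nu> :: "'v::euclidean_space measure"
  assumes "prob_space \<mu>" "prob_space \<nu>" and [simp]: "sets \<mu> = sets borel" "sets \<nu> = sets borel"
    and eq: "\<And>L B f. L-lipschitz_on UNIV f \<Longrightarrow> (\<And>x. \<bar>f x\<bar> \<le> B) \<Longrightarrow> (\<integral>x. f x \<partial>\<mu>) = (\<integral>x. (f x :: real) \<partial>\<nu>)"
  shows "\<mu> = \<nu>"
proof -
  interpret m: prob_space \<mu> by fact
  interpret n: prob_space \<nu> by fact
  have sp [simp]: "space \<mu> = UNIV" "space \<nu> = UNIV"
    using sets_eq_imp_space_eq[of \<mu> borel] sets_eq_imp_space_eq[of \<nu> borel] by simp_all
  have closed: "measure \<mu> C = measure \<nu> C" if C: "closed C" for C :: "'v set"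
  proof (cases "C = {}")
    case False
    define f where "f k x = max 0 (1 - real k * infdist x C)" for k :: nat and x
    have lip: "(real k)-lipschitz_on UNIV (f k)" for k
    proof (rule lipschitz_onI)
      fix x y :: 'v
      have "\<bar>infdist x C - infdist y C\<bar> \<le> dist x y"
        using infdist_triangle[of x C y] infdist_triangle[of y C x] by (simp add: dist_commute)
      then have "real k * \<bar>infdist x C - infdist y C\<bar> \<le> real k * dist x y" by (intro mult_left_mono) simp_all
      moreover have "\<bar>f k x - f k y\<bar> \<le> \<bar>real k * infdist x C - real k * infdist y C\<bar>"
        unfolding f_def by linarith
      moreover have "\<bar>real k * infdist x C - real k * infdist y C\<bar> = real k * \<bar>infdist x C - infdist y C\<bar>"
        by (simp add: abs_mult flip: right_diff_distrib)
      ultimately show "dist (f k x) (f k y) \<le> real k * dist x y" by (simp add: dist_real_def)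
    qed simp
    have bdd: "\<bar>f k x\<bar> \<le> 1" for k x by (simp add: f_def infdist_nonneg)
    have [measurable]: "f k \<in> borel_measurable borel" for k
      by (intro borel_measurable_continuous_onI lipschitz_on_continuous_on[OF lip])
    have Cm [measurable]: "C \<in> sets borel" using C by simp
    have lim: "(\<lambda>k. f k x) \<longlonglongrightarrow> indicator C x" for x
    proof (cases "x \<in> C")
      case True
      then show ?thesis by (simp add: f_def)
    next
      case x: False
      then have pos: "infdist x C > 0" using in_closed_iff_infdist_zero[OF C False] infdist_nonneg[of x C] by (simp add: less_le)
      obtain k0 :: nat where k0: "1 / infdist x C < real k0" using reals_Archimedean2 by blast
      have "f k x = 0" if "k \<ge> k0" for k
      proof -
        have "1 < real k0 * infdist x C" using k0 pos by (simp add: field_simps)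
        also have "\<dots> \<le> real k * infdist x C" using that pos by (intro mult_right_mono) simp_all
        finally show ?thesis by (simp add: f_def)
      qed
      then show ?thesis using x by (intro tendsto_eventually) (auto simp: eventually_sequentially)
    qed
    have conv: "(\<lambda>k. \<integral>x. f k x \<partial>\<rho>) \<longlonglongrightarrow> measure \<rho> C" if \<rho>: "prob_space \<rho>" "sets \<rho> = sets borel" for \<rho>
    proof -
      interpret r: prob_space \<rho> by fact
      have sp: "space \<rho> = UNIV" using sets_eq_imp_space_eq[OF \<rho>(2)] by simp
      have "(\<lambda>k. \<integral>x. f k x \<partial>\<rho>) \<longlonglongrightarrow> (\<integral>x. indicator C x \<partial>\<rho>)"
      proof (rule integral_dominated_convergence[where w = "\<lambda>_. 1"])
        show "AE x in \<rho>. norm (f k x) \<le> 1" for k using bdd by simp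
      qed (use lim \<rho>(2) in \<open>simp_all add: measurable_cong_sets[OF \<rho>(2) refl]\<close>)
      then show ?thesis using \<rho>(2) by (simp add: sp)
    qed
    have "(\<lambda>k. \<integral>x. f k x \<partial>\<mu>) = (\<lambda>k. \<integral>x. f k x \<partial>\<nu>)" using eq[OF lip bdd] by simp
    then show ?thesis using conv[OF assms(1)] conv[OF assms(2)] by (auto intro: LIMSEQ_unique)
  qed simp
  show ?thesis
  proof (rule measure_eqI_generator_eq[where \<Omega> = UNIV and E = "Collect closed" and A = "\<lambda>_. UNIV"])
    show "Int_stable (Collect closed :: 'v set set)" by (auto simp: Int_stable_def)
    show "sets \<mu> = sigma_sets UNIV (Collect closed)" "sets \<nu> = sigma_sets UNIV (Collect closed)"
      by (simp_all add: borel_eq_closed)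
    show "emeasure \<mu> C = emeasure \<nu> C" if "C \<in> Collect closed" for C
      using closed[of C] that by (simp add: m.emeasure_eq_measure n.emeasure_eq_measure)
    show "range (\<lambda>_ :: nat. UNIV) \<subseteq> (Collect closed :: 'v set set)" by auto
  qed (simp_all add: m.emeasure_eq_measure)
qed

fun euler_path :: "(nat \<Rightarrow> 'v::real_vector \<Rightarrow> 'v) \<Rightarrow> 'v \<Rightarrow> (nat \<Rightarrow> 'v) \<Rightarrow> nat \<Rightarrow> 'v" where
  "euler_path \<phi> x \<xi> 0 = x"
| "euler_path \<phi> x \<xi> (Suc i) = \<phi> i (euler_path \<phi> x \<xi> i) + \<xi> i"

lemma euler_path_cong: "(\<And>j. j < i \<Longrightarrow> \<xi> j = \<xi>' j) \<Longrightarrow> euler_path \<phi> x \<xi> i = euler_path \<phi> x \<xi>' i"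
  by (induction i) simp_all

lemma euler_path_measurable:
  fixes \<phi> :: "nat \<Rightarrow> 'v::euclidean_space \<Rightarrow> 'v"
  assumes [measurable]: "\<And>j. j < i \<Longrightarrow> \<phi> j \<in> borel_measurable borel"
    and [measurable]: "x \<in> borel_measurable N" "\<And>j. j < i \<Longrightarrow> (\<lambda>\<omega>. \<xi> \<omega> j) \<in> borel_measurable N"
  shows "(\<lambda>\<omega>. euler_path \<phi> (x \<omega>) (\<xi> \<omega>) i) \<in> borel_measurable N"
  using assms
proof (induction i)
  case (Suc i)
  have [measurable]: "(\<lambda>\<omega>. euler_path \<phi> (x \<omega>) (\<xi> \<omega>) i) \<in> borel_measurable N"
    using Suc.prems by (intro Suc.IH) simp_all
  have [measurable]: "\<phi> i \<in> borel_measurable borel" "(\<lambda>\<omega>. \<xi> \<omega> i) \<in> borel_measurable N" using Suc.prems by simp_all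
  show ?case by simp
qed simp

text \<open>
  Apart from \<open>a n\<close>, the error terms enter through a weighted sum, so that it suffices to control the expectation
  of each of them; no maximum over \<open>i\<close> is taken.
\<close>

lemma discrete_gronwall:
  fixes d a h :: "nat \<Rightarrow> real"
  assumes d: "\<And>i. i \<le> n \<Longrightarrow> d i \<le> a i + \<Lambda> * (\<Sum>j<i. h j * d j)"
    and nonneg: "\<Lambda> \<ge> 0" "\<And>i. i < n \<Longrightarrow> h i \<ge> 0" "\<And>i. i \<le> n \<Longrightarrow> a i \<ge> 0"
  shows "d n \<le> a n + \<Lambda> * exp (\<Lambda> * (\<Sum>j<n. h j)) * (\<Sum>j<n. h j * a j)"
proof -
  have "i \<le> n \<Longrightarrow> (\<Sum>j<i. h j * d j) \<le> exp (\<Lambda> * (\<Sum>j<i. h j)) * (\<Sum>j<i. h j * a j)" for i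
  proof (induction i)
    case (Suc i)
    let ?S = "\<Sum>j<i. h j * a j" and ?H = "\<Sum>j<i. h j"
    have i: "i < n" using Suc.prems by simp
    have hi: "h i \<ge> 0" using nonneg(2)[OF i] .
    have S: "?S \<ge> 0" and H: "?H \<ge> 0" using nonneg i by (auto intro!: sum_nonneg)
    have "(\<Sum>j<Suc i. h j * d j) \<le> (\<Sum>j<i. h j * d j) + h i * (a i + \<Lambda> * (\<Sum>j<i. h j * d j))"
      using d[of i] hi i by (simp add: mult_left_mono)
    also have "\<dots> = (1 + \<Lambda> * h i) * (\<Sum>j<i. h j * d j) + h i * a i" by (simp add: algebra_simps)
    also have "\<dots> \<le> exp (\<Lambda> * h i) * (exp (\<Lambda> * ?H) * ?S) + h i * a i"
    proof (intro add_right_mono)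
      have "(1 + \<Lambda> * h i) * (\<Sum>j<i. h j * d j) \<le> (1 + \<Lambda> * h i) * (exp (\<Lambda> * ?H) * ?S)"
        using Suc nonneg(1) hi by (intro mult_left_mono) simp_all
      also have "\<dots> \<le> exp (\<Lambda> * h i) * (exp (\<Lambda> * ?H) * ?S)"
        using S by (intro mult_right_mono exp_ge_add_one_self) simp
      finally show "(1 + \<Lambda> * h i) * (\<Sum>j<i. h j * d j) \<le> exp (\<Lambda> * h i) * (exp (\<Lambda> * ?H) * ?S)" .
    qed
    also have "\<dots> = exp (\<Lambda> * (\<Sum>j<Suc i. h j)) * ?S + 1 * (h i * a i)"
      by (simp add: distrib_left exp_add)
    also have "\<dots> \<le> exp (\<Lambda> * (\<Sum>j<Suc i. h j)) * ?S + exp (\<Lambda> * (\<Sum>j<Suc i. h j)) * (h i * a i)"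
      using nonneg(1) nonneg(3)[of i] hi H i by (intro add_left_mono mult_right_mono) simp_all
    also have "\<dots> = exp (\<Lambda> * (\<Sum>j<Suc i. h j)) * (\<Sum>j<Suc i. h j * a j)" by (simp add: distrib_left)
    finally show ?case .
  qed simp
  then have "\<Lambda> * (\<Sum>j<n. h j * d j) \<le> \<Lambda> * (exp (\<Lambda> * (\<Sum>j<n. h j)) * (\<Sum>j<n. h j * a j))"
    using nonneg(1) by (intro mult_left_mono) simp_all
  then show ?thesis using d[of n] by (simp add: mult.assoc)
qed

text \<open>
  A pathwise estimate for an equation with drift \<open>- \<beta>' r G r\<close>, where \<open>I\<close> is the noise of the path \<open>x\<close> and \<open>\<xi>\<close>
  the noise of the scheme. On each interval, the drift integral is replaced by its value with \<open>G\<close> frozen at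
  the left end, at the cost of the oscillation \<open>\<theta>\<close>; the Lipschitz bound for \<open>G\<close> and Gronwall's inequality do the rest.
\<close>

lemma euler_path_error:
  fixes x :: "real \<Rightarrow> 'v::euclidean_space" and G :: "real \<Rightarrow> 'v \<Rightarrow> 'v" and s :: "nat \<Rightarrow> real"
  assumes s: "s 0 = 0" "\<And>i. i < n \<Longrightarrow> s i \<le> s (Suc i)"
    and \<beta>: "\<And>a b. 0 \<le> a \<Longrightarrow> a \<le> b \<Longrightarrow> b \<le> s n \<Longrightarrow> (\<beta>' has_integral \<beta> b - \<beta> a) {a..b}"
    and \<beta>'_nonneg: "\<And>r. 0 \<le> r \<Longrightarrow> r \<le> s n \<Longrightarrow> \<beta>' r \<ge> 0"
    and int: "(\<lambda>r. - \<beta>' r *\<^sub>R G r (x r)) integrable_on {0..s n}"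
    and eq: "\<And>i. i \<le> n \<Longrightarrow> x (s i) = x 0 + integral {0..s i} (\<lambda>r. - \<beta>' r *\<^sub>R G r (x r)) + I i"
    and osc: "\<And>i r. i < n \<Longrightarrow> s i \<le> r \<Longrightarrow> r \<le> s (Suc i) \<Longrightarrow> norm (G r (x r) - G (s i) (x (s i))) \<le> \<theta>"
    and lip: "\<And>i. i < n \<Longrightarrow> \<Lambda>-lipschitz_on UNIV (G (s i))"
    and \<phi>: "\<And>i y. i < n \<Longrightarrow> \<phi> i y = y - (\<beta> (s (Suc i)) - \<beta> (s i)) *\<^sub>R G (s i) y"
    and nonneg: "\<theta> \<ge> 0" "\<Lambda> \<ge> 0" and \<beta>1: "\<beta> 0 = 0" "\<beta> (s n) \<le> 1"
  shows "norm (x (s n) - euler_path \<phi> (x 0) \<xi> n)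
    \<le> (1 + \<Lambda> * exp \<Lambda>) * \<theta>
      + (norm (I n - (\<Sum>j<n. \<xi> j)) + \<Lambda> * exp \<Lambda> * (\<Sum>i<n. (\<beta> (s (Suc i)) - \<beta> (s i)) * norm (I i - (\<Sum>j<i. \<xi> j))))"
proof -
  define E where "E = euler_path \<phi> (x 0) \<xi>"
  define h where "h i = \<beta> (s (Suc i)) - \<beta> (s i)" for i
  define F where "F r = - \<beta>' r *\<^sub>R G r (x r)" for r
  define R where "R i = (\<Sum>j<i. \<xi> j)" for i
  define e where "e i = integral {s i..s (Suc i)} F + h i *\<^sub>R G (s i) (x (s i))" for i
  have mono: "s i \<le> s j" if "i \<le> j" "j \<le> n" for i j
    using that
  proof (induction j rule: dec_induct)
    case (step j)
    then show ?case using s(2)[of j] by simp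
  qed simp
  have s_pos: "0 \<le> s i" if "i \<le> n" for i using mono[of 0 i] s(1) that by simp
  have h: "h i \<ge> 0" if "i < n" for i
  proof -
    have "(\<beta>' has_integral h i) {s i..s (Suc i)}"
      unfolding h_def using that s(2)[of i] s_pos[of i] mono[of "Suc i" n] by (intro \<beta>) auto
    then show ?thesis
      by (rule has_integral_nonneg) (use \<beta>'_nonneg s_pos[of i] mono[of "Suc i" n] that in auto)
  qed
  have sub: "F integrable_on {a..b}" if "0 \<le> a" "b \<le> s n" for a b
    unfolding F_def by (rule integrable_on_subinterval[OF int]) (use that in auto)
  have e: "norm (e i) \<le> h i * \<theta>" if i: "i < n" for i
  proof -
    let ?A = "{s i..s (Suc i)}"
    have si: "0 \<le> s i" "s i \<le> s (Suc i)" "s (Suc i) \<le> s n" using i s_pos[of i] s(2)[of i] mono[of "Suc i" n] by auto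
    have b: "(\<beta>' has_integral h i) ?A" unfolding h_def using si by (intro \<beta>) auto
    have "((\<lambda>r. \<beta>' r *\<^sub>R G (s i) (x (s i))) has_integral h i *\<^sub>R G (s i) (x (s i))) ?A"
      using b by (rule has_integral_scaleR_left)
    moreover have "(F has_integral integral ?A F) ?A" using sub[of "s i" "s (Suc i)"] si by (simp add: integrable_integral)
    ultimately have hF: "((\<lambda>r. F r + \<beta>' r *\<^sub>R G (s i) (x (s i))) has_integral e i) ?A"
      unfolding e_def by (intro has_integral_add)
    have hb: "((\<lambda>r. \<beta>' r * \<theta>) has_integral h i * \<theta>) ?A" using b by (rule has_integral_mult_left)
    from hF hb have "norm (integral ?A (\<lambda>r. F r + \<beta>' r *\<^sub>R G (s i) (x (s i)))) \<le> integral ?A (\<lambda>r. \<beta>' r * \<theta>)"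
    proof (intro integral_norm_bound_integral)
      fix r assume r: "r \<in> ?A"
      have "F r + \<beta>' r *\<^sub>R G (s i) (x (s i)) = - \<beta>' r *\<^sub>R (G r (x r) - G (s i) (x (s i)))"
        by (simp add: F_def scaleR_diff_right)
      also have "norm \<dots> \<le> \<beta>' r * \<theta>"
        using osc[OF i, of r] \<beta>'_nonneg[of r] r si by (simp add: mult_left_mono)
      finally show "norm (F r + \<beta>' r *\<^sub>R G (s i) (x (s i))) \<le> \<beta>' r * \<theta>" .
    qed (auto intro: has_integral_integrable)
    then show ?thesis unfolding integral_unique[OF hF] integral_unique[OF hb] .
  qed
  have int_sum: "i \<le> n \<Longrightarrow> integral {0..s i} F = (\<Sum>j<i. e j - h j *\<^sub>R G (s j) (x (s j)))" for i
  proof (induction i)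
    case 0 then show ?case by (simp add: s(1))
  next
    case (Suc i)
    have "integral {0..s i} F + integral {s i..s (Suc i)} F = integral {0..s (Suc i)} F"
      using Suc.prems s_pos[of i] s(2)[of i] mono[of "Suc i" n]
      by (intro Henstock_Kurzweil_Integration.integral_combine sub) auto
    then show ?case using Suc by (simp add: e_def)
  qed
  have E_sum: "i \<le> n \<Longrightarrow> E i = x 0 - (\<Sum>j<i. h j *\<^sub>R G (s j) (E j)) + R i" for i
    by (induction i) (simp_all add: E_def R_def \<phi> h_def)
  define d where "d i = norm (x (s i) - E i)" for i
  have d: "d i \<le> (\<theta> + norm (I i - R i)) + \<Lambda> * (\<Sum>j<i. h j * d j)" if i: "i \<le> n" for i
  proof -
    have "x (s i) - E i = (\<Sum>j<i. e j + h j *\<^sub>R (G (s j) (E j) - G (s j) (x (s j)))) + (I i - R i)"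
      using eq[OF i] int_sum[OF i] E_sum[OF i] unfolding F_def[symmetric]
      by (simp add: sum.distrib sum_subtractf scaleR_diff_right)
    then have "d i \<le> norm (\<Sum>j<i. e j + h j *\<^sub>R (G (s j) (E j) - G (s j) (x (s j)))) + norm (I i - R i)"
      unfolding d_def by (metis norm_triangle_ineq)
    also have "norm (\<Sum>j<i. e j + h j *\<^sub>R (G (s j) (E j) - G (s j) (x (s j)))) \<le> (\<Sum>j<i. h j * \<theta> + \<Lambda> * (h j * d j))"
    proof (rule sum_norm_le)
      fix j assume "j \<in> {..<i}"
      then have j: "j < n" using i by simp
      have "norm (G (s j) (E j) - G (s j) (x (s j))) \<le> \<Lambda> * d j"
        using lipschitz_onD[OF lip[OF j], of "E j" "x (s j)"] by (simp add: dist_norm d_def norm_minus_commute)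
      then have "norm (h j *\<^sub>R (G (s j) (E j) - G (s j) (x (s j)))) \<le> \<Lambda> * (h j * d j)"
        using mult_left_mono[OF _ h[OF j], of "norm (G (s j) (E j) - G (s j) (x (s j)))" "\<Lambda> * d j"] h[OF j]
        by (simp add: mult.left_commute)
      then show "norm (e j + h j *\<^sub>R (G (s j) (E j) - G (s j) (x (s j)))) \<le> h j * \<theta> + \<Lambda> * (h j * d j)"
        using e[OF j] norm_triangle_ineq[of "e j"] by (meson add_mono order_trans)
    qed
    also have "\<dots> = (\<Sum>j<i. h j) * \<theta> + \<Lambda> * (\<Sum>j<i. h j * d j)"
      by (simp add: sum.distrib sum_distrib_left sum_distrib_right)
    also have "(\<Sum>j<i. h j) * \<theta> \<le> 1 * \<theta>"
    proof (rule mult_right_mono)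
      have "(\<Sum>j<i. h j) \<le> (\<Sum>j<n. h j)" using i h by (intro sum_mono2) auto
      also have "\<dots> = \<beta> (s n) - \<beta> (s 0)" unfolding h_def by (rule sum_lessThan_telescope)
      finally show "(\<Sum>j<i. h j) \<le> 1" using \<beta>1 s(1) by simp
    qed (rule nonneg)
    finally show ?thesis by simp
  qed
  have H: "(\<Sum>j<n. h j) \<le> 1"
    using \<beta>1 s(1) sum_lessThan_telescope[of "\<lambda>i. \<beta> (s i)" n] by (simp add: h_def)
  have "d n \<le> (\<theta> + norm (I n - R n)) + \<Lambda> * exp (\<Lambda> * (\<Sum>j<n. h j)) * (\<Sum>j<n. h j * (\<theta> + norm (I j - R j)))"
    using d nonneg h by (intro discrete_gronwall) simp_all
  also have "\<Lambda> * exp (\<Lambda> * (\<Sum>j<n. h j)) * (\<Sum>j<n. h j * (\<theta> + norm (I j - R j)))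
      \<le> \<Lambda> * exp \<Lambda> * (\<theta> + (\<Sum>j<n. h j * norm (I j - R j)))"
  proof (intro mult_mono)
    have "\<Lambda> * (\<Sum>j<n. h j) \<le> \<Lambda> * 1" using H nonneg by (intro mult_left_mono) simp_all
    then show "exp (\<Lambda> * (\<Sum>j<n. h j)) \<le> exp \<Lambda>" by simp
    have "(\<Sum>j<n. h j * (\<theta> + norm (I j - R j))) = (\<Sum>j<n. h j) * \<theta> + (\<Sum>j<n. h j * norm (I j - R j))"
      by (simp add: distrib_left sum.distrib sum_distrib_right)
    also have "(\<Sum>j<n. h j) * \<theta> \<le> 1 * \<theta>" using H nonneg by (intro mult_right_mono) simp_all
    finally show "(\<Sum>j<n. h j * (\<theta> + norm (I j - R j))) \<le> \<theta> + (\<Sum>j<n. h j * norm (I j - R j))" by simp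
    show "0 \<le> (\<Sum>j<n. h j * (\<theta> + norm (I j - R j)))" using h nonneg by (intro sum_nonneg) simp
  qed (use nonneg in simp_all)
  finally show ?thesis by (simp add: d_def E_def R_def h_def algebra_simps)
qed

section \<open>The marginal laws of the diffusion\<close>

text \<open>
  The position after \<open>i\<close> steps is a function of the initial value and the earlier increments, hence independent
  of the next increment, and the expectation over the latter is Gaussian smoothing.
\<close>

lemma (in brownian) euler_scheme_step:
  fixes X0 :: "'a \<Rightarrow> 'v" and \<phi> :: "nat \<Rightarrow> 'v \<Rightarrow> 'v" and u :: "'v \<Rightarrow> real" and p c :: "nat \<Rightarrow> real"
  defines "E \<equiv> \<lambda>\<omega>. euler_path \<phi> (X0 \<omega>) (\<lambda>j. c j *\<^sub>R (W (p (Suc j)) \<omega> - W (p j) \<omega>))"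
  assumes X0: "X0 \<in> borel_measurable M"
    and ind: "indep_set (sets (vimage_algebra (space M) X0 borel))
       (sets (vimage_algebra (space M) (\<lambda>\<omega>. \<lambda>s\<in>{0..}. W s \<omega>) (PiM {0..} (\<lambda>_. borel))))"
    and p: "0 \<le> p 0" "strict_mono p"
    and \<phi>: "\<And>j. j \<le> i \<Longrightarrow> \<phi> j \<in> borel_measurable borel"
    and u [measurable]: "u \<in> borel_measurable borel" and bdd: "bounded (range u)"
  shows "(\<integral>\<omega>. u (E \<omega> (Suc i)) \<partial>M) = (\<integral>\<omega>. gauss_smooth (c i * sqrt (p (Suc i) - p i)) u (\<phi> i (E \<omega> i)) \<partial>M)"
proof -
  obtain B where B: "\<bar>u x\<bar> \<le> B" for x using bdd by (auto simp: bounded_iff)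
  define V where "V i = (case i of 0 \<Rightarrow> X0 | Suc j \<Rightarrow> (\<lambda>\<omega>. W (p (Suc j)) \<omega> - W (p j) \<omega>))" for i
  have V: "indep_vars (\<lambda>_. borel) V {..<Suc (Suc i)}"
    using initial_increments_indep[OF X0 ind p, of "Suc i"] unfolding V_def[abs_def] .
  define F where "F f = euler_path \<phi> (f 0) (\<lambda>j. c j *\<^sub>R f (Suc j)) i" for f
  have F: "F \<in> borel_measurable (PiM {..i} (\<lambda>_. borel))"
    unfolding F_def[abs_def]
  proof (rule euler_path_measurable)
    fix j assume j: "j < i"
    have "(\<lambda>f. f (Suc j)) \<in> borel_measurable (PiM {..i} (\<lambda>_. borel :: 'v measure))"
      using j by (intro measurable_component_singleton) simp
    then show "(\<lambda>f. c j *\<^sub>R f (Suc j)) \<in> borel_measurable (PiM {..i} (\<lambda>_. borel :: 'v measure))" by simp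
  qed (use \<phi> in \<open>auto intro: measurable_component_singleton\<close>)
  have "indep_var borel (F \<circ> (\<lambda>\<omega>. \<lambda>j\<in>{..i}. V j \<omega>)) borel ((\<lambda>f. f (Suc i)) \<circ> (\<lambda>\<omega>. \<lambda>j\<in>{Suc i}. V j \<omega>))"
    by (rule indep_var_compose[OF indep_var_restrict[OF V, of "{..i}" "{Suc i}"] F]) auto
  moreover have "F \<circ> (\<lambda>\<omega>. \<lambda>j\<in>{..i}. V j \<omega>) = (\<lambda>\<omega>. E \<omega> i)"
  proof
    fix \<omega>
    show "(F \<circ> (\<lambda>\<omega>. \<lambda>j\<in>{..i}. V j \<omega>)) \<omega> = E \<omega> i"
      unfolding o_def F_def E_def by (simp add: V_def) (rule euler_path_cong, simp)
  qed
  moreover have "(\<lambda>f. f (Suc i)) \<circ> (\<lambda>\<omega>. \<lambda>j\<in>{Suc i}. V j \<omega>) = (\<lambda>\<omega>. W (p (Suc i)) \<omega> - W (p i) \<omega>)"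
    by (simp add: fun_eq_iff V_def)
  ultimately have iv: "indep_var borel (\<lambda>\<omega>. E \<omega> i) borel (\<lambda>\<omega>. W (p (Suc i)) \<omega> - W (p i) \<omega>)" by simp
  let ?D = "\<lambda>\<omega>. W (p (Suc i)) \<omega> - W (p i) \<omega>"
  have Em [measurable]: "(\<lambda>\<omega>. E \<omega> i) \<in> borel_measurable M" and Dm [measurable]: "?D \<in> borel_measurable M"
    and joint: "distr M borel (\<lambda>\<omega>. E \<omega> i) \<Otimes>\<^sub>M distr M borel ?D = distr M (borel \<Otimes>\<^sub>M borel) (\<lambda>\<omega>. (E \<omega> i, ?D \<omega>))"
    using iv unfolding indep_var_distribution_eq by auto
  have [measurable]: "\<phi> i \<in> borel_measurable borel" using \<phi> by simp
  define \<Delta> where "\<Delta> = p (Suc i) - p i"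
  have \<Delta>: "\<Delta> > 0" using p(2) by (simp add: \<Delta>_def strict_mono_Suc_iff)
  have "0 \<le> p i" using p strict_mono_leD[OF p(2), of 0 i] by simp
  then have "distr M borel ?D = gaussian_measure \<Delta>"
    using increment_law[of "p i" "p (Suc i)"] \<Delta> by (simp add: \<Delta>_def)
  also have "\<dots> = distr std_gauss borel (\<lambda>w :: 'v. sqrt \<Delta> *\<^sub>R w)"
    using distr_gaussian_scale[of "sqrt \<Delta>" 1, where 'v = 'v] \<Delta> by simp
  finally have law: "distr M borel ?D = distr std_gauss borel (\<lambda>w :: 'v. sqrt \<Delta> *\<^sub>R w)" .
  let ?A = "distr M borel (\<lambda>\<omega>. E \<omega> i)" and ?B = "distr M borel ?D"
  interpret A: prob_space ?A by (rule prob_space_distr) simp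
  interpret B: prob_space ?B by (rule prob_space_distr) simp
  interpret AB: pair_prob_space ?A ?B ..
  have "(\<integral>\<omega>. u (E \<omega> (Suc i)) \<partial>M) = (\<integral>\<omega>. u (\<phi> i (E \<omega> i) + c i *\<^sub>R ?D \<omega>) \<partial>M)"
    by (simp add: E_def)
  also have "\<dots> = (\<integral>z. u (\<phi> i (fst z) + c i *\<^sub>R snd z) \<partial>(?A \<Otimes>\<^sub>M ?B))"
    unfolding joint by (subst integral_distr) simp_all
  also have "\<dots> = (\<integral>e. \<integral>d. u (\<phi> i e + c i *\<^sub>R d) \<partial>?B \<partial>?A)"
  proof -
    have "integrable (?A \<Otimes>\<^sub>M ?B) (\<lambda>z. u (\<phi> i (fst z) + c i *\<^sub>R snd z))"
      by (rule AB.integrable_const_bound[of _ B]) (simp_all add: B)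
    from AB.integral_fst'[OF this] show ?thesis by simp
  qed
  also have "\<dots> = (\<integral>e. gauss_smooth (c i * sqrt \<Delta>) u (\<phi> i e) \<partial>?A)"
    unfolding law by (simp add: integral_distr gauss_smooth_def)
  also have "\<dots> = (\<integral>\<omega>. gauss_smooth (c i * sqrt \<Delta>) u (\<phi> i (E \<omega> i)) \<partial>M)"
  proof (rule integral_distr)
    have "(\<lambda>x. gauss_smooth (c i * sqrt \<Delta>) u x) \<in> borel_measurable borel"
      unfolding gauss_smooth_def by (rule std_gauss.borel_measurable_lebesgue_integral) measurable
    then show "(\<lambda>e. gauss_smooth (c i * sqrt \<Delta>) u (\<phi> i e)) \<in> borel_measurable borel" by measurable
  qed simp
  finally show ?thesis by (simp add: \<Delta>_def)
qed

lemma step_fun_grid: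
  assumes p: "\<And>j. j < n \<Longrightarrow> p j \<le> p (Suc j)" and r: "p 0 < r" "r \<le> p n"
  obtains j where "j < n" "p j < r" "r \<le> p (Suc j)" "step_fun (n, p, c) r = c j"
proof -
  have mono: "p i \<le> p j" if "i \<le> j" "j \<le> n" for i j
    using that
  proof (induction j rule: dec_induct)
    case (step j)
    then show ?case using p[of j] by simp
  qed simp
  define j where "j = (LEAST k. r \<le> p (Suc k))"
  have n: "n \<noteq> 0" using r by (cases n) auto
  have ex: "r \<le> p (Suc (n - 1))" using r n by simp
  have j: "r \<le> p (Suc j)" unfolding j_def using ex by (rule LeastI)
  have jn: "j < n" using Least_le[of "\<lambda>k. r \<le> p (Suc k)", OF ex] n unfolding j_def by linarith
  have jr: "p j < r"
  proof (cases j)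
    case (Suc k)
    have "\<not> r \<le> p (Suc k)" using not_less_Least[of k "\<lambda>k. r \<le> p (Suc k)"] Suc unfolding j_def by simp
    then show ?thesis using Suc by simp
  qed (use r in simp)
  have "c i * indicator {p i<..p (Suc i)} r = (if i = j then c j else 0)" if "i < n" for i
    using j jr mono[of "Suc i" j] mono[of "Suc j" i] that jn by (auto simp: indicator_def not_less) linarith+
  then have "step_fun (n, p, c) r = (\<Sum>i<n. if i = j then c j else 0)"
    unfolding step_fun_def prod.case by (intro sum.cong) simp_all
  also have "\<dots> = c j" using jn by simp
  finally have "step_fun (n, p, c) r = c j" .
  then show thesis using that jn jr j by blast
qed

text \<open>
  The equation of the theorem for a general prior law \<open>\<nu>\<close> with bounded support, with \<open>\<sigma> = 1 - \<beta>\<close> inserted.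
\<close>

locale interpolating_sde = law: bounded_law \<nu> K + noise: brownian M W
  for \<nu> :: "'v::euclidean_space measure" and K :: real and M :: "'a measure" and W :: "real \<Rightarrow> 'a \<Rightarrow> 'v" +
  fixes \<epsilon> \<gamma> :: real and \<beta> \<beta>' :: "real \<Rightarrow> real" and b :: "real \<Rightarrow> 'v \<Rightarrow> 'v" and X :: "real \<Rightarrow> 'a \<Rightarrow> 'v"
  assumes eps: "\<epsilon> > 0" and gam: "\<gamma> > 0"
    and beta_deriv: "\<And>s. s \<in> {0..1} \<Longrightarrow> (\<beta> has_real_derivative \<beta>' s) (at s within {0..1})"
    and beta_C1: "continuous_on {0..1} \<beta>'"
    and beta_incr: "\<And>s. s \<in> {0<..<1} \<Longrightarrow> \<beta>' s > 0"
    and beta_0: "\<beta> 0 = 0" and beta_1: "\<beta> 1 = 1"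
    and drift_eq: "\<And>s x. s \<in> {0..<1} \<Longrightarrow>
      b s x = - (\<beta>' s / (1 - \<beta> s)) *\<^sub>R (x - post_mean \<nu> (\<beta> s) (mix_var \<epsilon> \<gamma> (\<beta> s)) x)"
    and sde: "sde_solution M W b (\<lambda>s. sqrt (\<epsilon> * \<beta>' s)) 1 X"
    and init: "distr M borel (X 0) = gaussian_measure \<gamma>"
begin

lemma beta_cont: "continuous_on {0..1} \<beta>"
  using beta_deriv by (meson DERIV_continuous_on)

lemma beta_mvt:
  assumes "0 \<le> s" "s < s'" "s' \<le> 1"
  obtains z where "s < z" "z < s'" "\<beta> s' - \<beta> s = \<beta>' z * (s' - s)"
proof -
  have "(\<beta> has_derivative (\<lambda>h. \<beta>' x * h)) (at x within {s..s'})" if "s \<le> x" "x \<le> s'" for x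
  proof -
    have "(\<beta> has_derivative (\<lambda>h. \<beta>' x * h)) (at x within {0..1})"
      using beta_deriv[of x] that assms by (simp add: has_field_derivative_def)
    then show ?thesis by (rule has_derivative_subset) (use assms in auto)
  qed
  from mvt_simple[OF assms(2) this] show thesis using that by auto
qed

lemma beta_less:
  assumes "0 \<le> s" "s < s'" "s' \<le> 1" shows "\<beta> s < \<beta> s'"
proof -
  obtain z where z: "s < z" "z < s'" "\<beta> s' - \<beta> s = \<beta>' z * (s' - s)" using beta_mvt[OF assms] .
  then have "0 < \<beta>' z * (s' - s)" using beta_incr[of z] assms by simp
  then show ?thesis using z(3) by simp
qed

lemma beta_le: "0 \<le> s \<Longrightarrow> s \<le> s' \<Longrightarrow> s' \<le> 1 \<Longrightarrow> \<beta> s \<le> \<beta> s'"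
  using beta_less[of s s'] by (cases "s = s'") simp_all

lemma beta_range: "0 \<le> s \<Longrightarrow> s < 1 \<Longrightarrow> 0 \<le> \<beta> s \<and> \<beta> s < 1"
  using beta_le[of 0 s] beta_less[of s 1] by (simp add: beta_0 beta_1)

lemma beta'_nonneg:
  assumes "0 \<le> s" "s \<le> 1" shows "\<beta>' s \<ge> 0"
proof (rule continuous_ge_on_closure[of "{0<..<1}" \<beta>'])
  show "continuous_on (closure {0<..<1}) \<beta>'" using beta_C1 by (simp add: closure_greaterThanLessThan)
  show "s \<in> closure {0<..<1}" using assms by (simp add: closure_greaterThanLessThan)
qed (use beta_incr in \<open>auto intro: less_imp_le\<close>)

lemma beta_has_integral:
  assumes "0 \<le> s" "s \<le> s'" "s' \<le> 1"
  shows "(\<beta>' has_integral \<beta> s' - \<beta> s) {s..s'}"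
proof (rule fundamental_theorem_of_calculus[OF assms(2)])
  fix x assume "x \<in> {s..s'}"
  then have "(\<beta> has_real_derivative \<beta>' x) (at x within {s..s'})"
    using beta_deriv[of x] assms by (auto intro: DERIV_subset)
  then show "(\<beta> has_vector_derivative \<beta>' x) (at x within {s..s'})"
    by (rule has_real_derivative_iff_has_vector_derivative[THEN iffD1])
qed

text \<open>
  The drift without its factor \<open>- \<beta>'\<close>. That factor is kept apart because it integrates exactly to the increments
  of \<open>\<beta>\<close>, which are the step sizes of the Euler scheme.
\<close>

definition pull :: "real \<Rightarrow> 'v \<Rightarrow> 'v" where
  "pull s y = (1 / (1 - \<beta> s)) *\<^sub>R (y - post_mean \<nu> (\<beta> s) (mix_var \<epsilon> \<gamma> (\<beta> s)) y)"

lemma drift_pull: "s \<in> {0..<1} \<Longrightarrow> b s x = - \<beta>' s *\<^sub>R pull s x"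
  by (simp add: drift_eq pull_def)

lemma pull_lipschitz:
  assumes "0 \<le> s" "s \<le> t" "t < 1"
  shows "(1 / (1 - \<beta> t) * (1 + 2 * (exp 1)\<^sup>2 * K\<^sup>2 * (1 / ((1 - \<beta> t) * min \<epsilon> \<gamma>))))-lipschitz_on UNIV (pull s)"
proof -
  have bs: "0 \<le> \<beta> s" "\<beta> s \<le> \<beta> t" "\<beta> t < 1" "\<beta> s < 1"
    using beta_range[of s] beta_range[of t] beta_le[of s t] assms by auto
  let ?v = "mix_var \<epsilon> \<gamma> (\<beta> s)"
  have v: "?v > 0" using mix_var_pos eps gam bs by simp
  have "(\<bar>1 / (1 - \<beta> s)\<bar> * (1 + 2 * (exp 1)\<^sup>2 * K\<^sup>2 * (\<beta> s / ?v)))-lipschitz_on UNIV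
      (\<lambda>y. (1 / (1 - \<beta> s)) *\<^sub>R (y - post_mean \<nu> (\<beta> s) ?v y))"
    by (intro lipschitz_on_cmult lipschitz_on_diff lipschitz_on_id law.post_mean_lipschitz v bs)
  then show ?thesis
    unfolding pull_def[abs_def]
  proof (rule lipschitz_on_mono)
    have "\<beta> s / ?v \<le> 1 / ((1 - \<beta> t) * min \<epsilon> \<gamma>)"
      using mix_var_ge[of \<epsilon> \<gamma> "\<beta> s" "\<beta> t"] eps gam bs v by (intro frac_le) simp_all
    moreover have "\<bar>1 / (1 - \<beta> s)\<bar> \<le> 1 / (1 - \<beta> t)" using bs by (simp add: frac_le)
    ultimately show "\<bar>1 / (1 - \<beta> s)\<bar> * (1 + 2 * (exp 1)\<^sup>2 * K\<^sup>2 * (\<beta> s / ?v))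
        \<le> 1 / (1 - \<beta> t) * (1 + 2 * (exp 1)\<^sup>2 * K\<^sup>2 * (1 / ((1 - \<beta> t) * min \<epsilon> \<gamma>)))"
      using bs v by (intro mult_mono add_left_mono mult_left_mono) simp_all
  qed simp
qed

lemma pull_continuous:
  assumes t: "t < 1" and x: "continuous_on {0..t} x"
  shows "continuous_on {0..t} (\<lambda>s. pull s (x s))"
proof -
  have b: "continuous_on {0..t} \<beta>" using t by (intro continuous_on_subset[OF beta_cont]) auto
  have bs: "0 \<le> \<beta> s" "\<beta> s < 1" if "s \<in> {0..t}" for s using beta_range[of s] that t by auto
  define k where "k s y = gkern (\<beta> s) (mix_var \<epsilon> \<gamma> (\<beta> s)) (x s) y" for s y
  have v: "mix_var \<epsilon> \<gamma> (\<beta> s) > 0" if "s \<in> {0..t}" for s using mix_var_pos eps gam bs that by simp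
  have k_cont: "continuous_on {0..t} (\<lambda>s. k s y)" for y
  proof -
    have "continuous_on {0..t} (\<lambda>s. mix_var \<epsilon> \<gamma> (\<beta> s))"
      unfolding mix_var_def by (intro continuous_intros b)
    then show ?thesis
      unfolding k_def gkern_def using v by (intro continuous_intros b x) fastforce+
  qed
  have km: "k s \<in> borel_measurable \<nu>" for s unfolding k_def[abs_def] by simp
  have int_cont: "continuous_on {0..t} (\<lambda>s. \<integral>y. k s y *\<^sub>R f y \<partial>\<nu>)"
    if f [measurable]: "f \<in> borel_measurable borel" and fB: "AE y in \<nu>. norm (f y) \<le> B"
    for f :: "'v \<Rightarrow> 'b::{banach, second_countable_topology}" and B
    unfolding continuous_on_sequentially comp_def
  proof (intro allI ballI impI)
    fix z :: "nat \<Rightarrow> real" and a assume a: "a \<in> {0..t}" and z: "(\<forall>n. z n \<in> {0..t}) \<and> z \<longlonglongrightarrow> a"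
    show "(\<lambda>n. \<integral>y. k (z n) y *\<^sub>R f y \<partial>\<nu>) \<longlonglongrightarrow> (\<integral>y. k a y *\<^sub>R f y \<partial>\<nu>)"
    proof (rule integral_dominated_convergence[where w = "\<lambda>_. B"])
      show "(\<lambda>y. k a y *\<^sub>R f y) \<in> borel_measurable \<nu>" "(\<lambda>y. k (z n) y *\<^sub>R f y) \<in> borel_measurable \<nu>" for n
        using km by simp_all
      show "AE y in \<nu>. (\<lambda>n. k (z n) y *\<^sub>R f y) \<longlonglongrightarrow> k a y *\<^sub>R f y"
      proof (rule AE_I2)
        fix y
        have "(\<lambda>n. k (z n) y) \<longlonglongrightarrow> k a y"
          using k_cont[of y] a z unfolding continuous_on_sequentially comp_def by blast
        then show "(\<lambda>n. k (z n) y *\<^sub>R f y) \<longlonglongrightarrow> k a y *\<^sub>R f y" by (intro tendsto_intros)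
      qed
      show "AE y in \<nu>. norm (k (z n) y *\<^sub>R f y) \<le> B" for n
        using fB
      proof eventually_elim
        case (elim y)
        have "k (z n) y * norm (f y) \<le> 1 * norm (f y)"
          using gkern_le_1[OF v[of "z n"]] z unfolding k_def by (intro mult_right_mono) simp_all
        then show ?case using elim by (simp add: k_def abs_of_pos[OF gkern_pos])
      qed
    qed simp
  qed
  have "continuous_on {0..t} (\<lambda>s. \<integral>y. k s y *\<^sub>R (1 :: real) \<partial>\<nu>)"
    by (rule int_cont[of _ 1]) simp_all
  then have i0: "continuous_on {0..t} (\<lambda>s. \<integral>y. k s y \<partial>\<nu>)" by simp
  have i1: "continuous_on {0..t} (\<lambda>s. \<integral>y. k s y *\<^sub>R y \<partial>\<nu>)"
    by (rule int_cont[OF _ law.bounded]) simp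
  have pos: "(\<integral>y. k s y \<partial>\<nu>) \<noteq> 0" if "s \<in> {0..t}" for s
    using law.integral_gkern_pos[OF v[OF that], of "\<beta> s" "x s"] by (simp add: k_def)
  have "continuous_on {0..t} (\<lambda>s. (1 / (1 - \<beta> s)) *\<^sub>R (x s - (1 / (\<integral>y. k s y \<partial>\<nu>)) *\<^sub>R (\<integral>y. k s y *\<^sub>R y \<partial>\<nu>)))"
    using bs pos by (intro continuous_intros b x i0 i1) fastforce+
  then show ?thesis by (simp add: pull_def post_mean_def k_def)
qed

text \<open>
  The coefficient \<open>\<surd>(\<epsilon> (\<beta> s' - \<beta> s) / (s' - s))\<close> gives a noise increment over \<open>[s, s']\<close> the exact variance \<open>\<epsilon> (\<beta> s' - \<beta> s)\<close>.
  By the mean value theorem it is a value of \<open>\<surd>(\<epsilon> \<beta>')\<close> inside the interval.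
\<close>

lemma noise_coeff_close:
  assumes t: "0 < t" "t < 1" and \<theta>: "\<theta> > 0"
  obtains d where "d > 0" "\<And>s s' r. 0 \<le> s \<Longrightarrow> s < s' \<Longrightarrow> s' \<le> t \<Longrightarrow> s' - s < d \<Longrightarrow> s \<le> r \<Longrightarrow> r \<le> s' \<Longrightarrow>
    \<bar>sqrt (\<epsilon> * \<beta>' r) - sqrt (\<epsilon> * (\<beta> s' - \<beta> s) / (s' - s))\<bar> \<le> \<theta>"
proof -
  have "continuous_on {0..t} (\<lambda>s. sqrt (\<epsilon> * \<beta>' s))"
    using t by (intro continuous_intros continuous_on_subset[OF beta_C1]) auto
  then have "uniformly_continuous_on {0..t} (\<lambda>s. sqrt (\<epsilon> * \<beta>' s))"
    by (rule compact_uniformly_continuous) simp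
  then obtain d where d: "d > 0" "\<And>s s'. s \<in> {0..t} \<Longrightarrow> s' \<in> {0..t} \<Longrightarrow> dist s' s < d \<Longrightarrow>
      dist (sqrt (\<epsilon> * \<beta>' s')) (sqrt (\<epsilon> * \<beta>' s)) < \<theta>"
    using \<theta> unfolding uniformly_continuous_on_def by metis
  show thesis
  proof (rule that[OF d(1)])
    fix s s' r assume s: "0 \<le> s" "s < s'" "s' \<le> t" "s' - s < d" "s \<le> r" "r \<le> s'"
    obtain z where z: "s < z" "z < s'" "\<beta> s' - \<beta> s = \<beta>' z * (s' - s)"
      using beta_mvt[of s s'] s t by auto
    have "sqrt (\<epsilon> * (\<beta> s' - \<beta> s) / (s' - s)) = sqrt (\<epsilon> * \<beta>' z)" using z s by simp
    moreover have "dist (sqrt (\<epsilon> * \<beta>' r)) (sqrt (\<epsilon> * \<beta>' z)) < \<theta>"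
      using s z by (intro d(2)) (auto simp: dist_real_def)
    ultimately show "\<bar>sqrt (\<epsilon> * \<beta>' r) - sqrt (\<epsilon> * (\<beta> s' - \<beta> s) / (s' - s))\<bar> \<le> \<theta>"
      by (simp add: dist_real_def)
  qed
qed

text \<open>
  The Euler scheme on the uniform grid of \<open>[0, t]\<close> is compared with both sides. Its law at \<open>t\<close> tends to the mixture,
  since the sum of the one-step errors \<open>h\<^bsup>3/2\<^esup>\<close> tends to \<open>0\<close>. On the other hand its noise tends to the Wiener integral in the mean,
  so that along a subsequence it converges almost surely to the solution. Independence enters through the scheme,
  whose positions are functions of the initial value and the increments.
\<close>

theorem marginal_law:
  assumes t: "0 < t" "t < 1"
  shows "distr M borel (X t) = gauss_mixture \<nu> (\<beta> t) (mix_var \<epsilon> \<gamma> (\<beta> t))"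
proof -
  define c where "c = \<beta> t"
  have c: "0 < c" "c < 1" using beta_less[of 0 t] beta_range[of t] t by (simp_all add: c_def beta_0)
  define \<kappa> where "\<kappa> = gauss_moment2 TYPE('v)"
  have \<kappa>: "\<kappa> \<ge> 0" unfolding \<kappa>_def by (rule gauss_moment2_nonneg)
  define \<Lambda> where "\<Lambda> = 1 / (1 - c) * (1 + 2 * (exp 1)\<^sup>2 * K\<^sup>2 * (1 / ((1 - c) * min \<epsilon> \<gamma>)))"
  have \<Lambda>: "\<Lambda> \<ge> 0" using c eps gam by (simp add: \<Lambda>_def)
  define p where "p n i = t * real i / real n" for n i :: nat
  define h where "h n i = \<beta> (p n (Suc i)) - \<beta> (p n i)" for n i
  \<comment> \<open>this coefficient makes the variance of each noise increment exactly \<open>\<epsilon> h\<close>\<close>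
  define q where "q n i = sqrt (\<epsilon> * h n i / (p n (Suc i) - p n i))" for n i
  define \<xi> where "\<xi> n \<omega> j = q n j *\<^sub>R (W (p n (Suc j)) \<omega> - W (p n j) \<omega>)" for n \<omega> j
  define \<phi> where "\<phi> n j = euler_mean \<nu> (\<beta> (p n j)) (mix_var \<epsilon> \<gamma> (\<beta> (p n j))) (h n j / (1 - \<beta> (p n j)))" for n j
  define E where "E n \<omega> = euler_path (\<phi> n) (X 0 \<omega>) (\<xi> n \<omega>)" for n \<omega>
  define mix where "mix = gauss_mixture \<nu> (\<beta> t) (mix_var \<epsilon> \<gamma> (\<beta> t))"

  have p0: "p n 0 = 0" for n by (simp add: p_def)
  have pn: "p n n = t" if "n > 0" for n using that by (simp add: p_def)
  have p_mono: "strict_mono (p n)" if "n > 0" for n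
    using t that by (auto simp: strict_mono_def p_def divide_strict_right_mono)
  have p_diff: "p n (Suc i) - p n i = t / real n" for n i
    by (simp add: p_def diff_divide_distrib[symmetric] right_diff_distrib[symmetric])
  have p_le: "0 \<le> p n i" "p n i \<le> t" if "n > 0" "i \<le> n" for n i
    using strict_mono_leD[OF p_mono, of n 0 i] strict_mono_leD[OF p_mono, of n i n] that by (simp_all add: p0 pn)
  have p_less: "p n i < p n (Suc i)" if "n > 0" for n i using p_mono[OF that] by (simp add: strict_mono_Suc_iff)
  have beta_p: "0 \<le> \<beta> (p n i)" "\<beta> (p n i) \<le> c" if "n > 0" "i \<le> n" for n i
    using beta_range[of "p n i"] beta_le[of "p n i" t] p_le[OF that] t by (simp_all add: c_def)
  have h_pos: "h n i > 0" if "n > 0" "i < n" for n i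
    using beta_less[of "p n i" "p n (Suc i)"] p_less[of n i] p_le[of n i] p_le[of n "Suc i"] that t by (simp add: h_def)
  obtain Bm where Bm: "\<And>s. 0 \<le> s \<Longrightarrow> s \<le> 1 \<Longrightarrow> \<beta>' s \<le> Bm"
  proof -
    have "bounded (\<beta>' ` {0..1})" by (intro compact_imp_bounded compact_continuous_image beta_C1) simp
    then obtain Bm where "\<forall>y\<in>\<beta>' ` {0..1}. norm y \<le> Bm" unfolding bounded_iff by blast
    then have "\<beta>' s \<le> Bm" if "0 \<le> s" "s \<le> 1" for s
      using that by (auto simp: abs_le_iff)
    then show thesis by (rule that)
  qed
  have Bm0: "Bm \<ge> 0" using Bm[of 0] beta'_nonneg[of 0] by simp
  have h_le: "h n i \<le> Bm * t / real n" if n: "n > 0" and i: "i < n" for n i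
  proof -
    have 1: "0 \<le> p n i" "p n (Suc i) \<le> 1" using p_le[of n i] p_le[of n "Suc i"] n i t by auto
    obtain z where z: "p n i < z" "z < p n (Suc i)" "h n i = \<beta>' z * (p n (Suc i) - p n i)"
      using beta_mvt[OF 1(1) p_less[OF n] 1(2)] unfolding h_def by blast
    have "\<beta>' z * (t / real n) \<le> Bm * (t / real n)"
      using Bm[of z] z 1 t by (intro mult_right_mono) simp_all
    then show ?thesis using z(3) by (simp add: p_diff)
  qed
  have h_sum: "(\<Sum>i<n. h n i) = c" if "n > 0" for n
    using sum_lessThan_telescope[of "\<lambda>i. \<beta> (p n i)" n] that by (simp add: h_def p0 pn beta_0 c_def)
  have h_lim: "(\<lambda>n. Bm * t / real n) \<longlonglongrightarrow> 0"
    by (rule lim_const_over_n)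
  have q_pos: "q n i > 0" if "n > 0" "i < n" for n i
    using h_pos[OF that] p_less[OF that(1)] eps by (simp add: q_def)
  have q_scale: "q n i * sqrt (p n (Suc i) - p n i) = sqrt (\<epsilon> * h n i)" if "n > 0" for n i
    unfolding q_def real_sqrt_mult[symmetric] using p_less[OF that, of i] by simp
  have \<phi>_meas: "\<phi> n j \<in> borel_measurable borel" if "n > 0" "j \<le> n" for n j
  proof -
    have "post_mean \<nu> (\<beta> (p n j)) (mix_var \<epsilon> \<gamma> (\<beta> (p n j))) \<in> borel_measurable borel"
      using beta_p[OF that] c eps gam by (intro law.post_mean_measurable mix_var_pos) simp_all
    then show ?thesis unfolding \<phi>_def euler_mean_def[abs_def] by measurable
  qed
  have X_meas: "X s \<in> borel_measurable M" if "s \<in> {0..<1}" for s using sde that by (simp add: sde_solution_def)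
  have E_meas: "(\<lambda>\<omega>. E n \<omega> i) \<in> borel_measurable M" if "n > 0" "i \<le> n" for n i
    unfolding E_def
  proof (rule euler_path_measurable)
    fix j assume "j < i"
    then have "0 \<le> p n j" "0 \<le> p n (Suc j)" using p_le that by auto
    then show "(\<lambda>\<omega>. \<xi> n \<omega> j) \<in> borel_measurable M" unfolding \<xi>_def by measurable
  qed (use \<phi>_meas that X_meas in auto)

  \<comment> \<open>The laws of the Euler schemes converge to the mixture.\<close>
  have weak: "(\<lambda>n. \<integral>\<omega>. f (E n \<omega> n) \<partial>M) \<longlonglongrightarrow> (\<integral>z. f z \<partial>mix)"
    if lip: "L-lipschitz_on UNIV f" and bdd: "\<And>x. \<bar>f x\<bar> \<le> B" for f :: "'v \<Rightarrow> real" and L B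
  proof -
    define C where "C = L * exp (law.step_lip \<epsilon> \<gamma> c * c) * law.step_const \<epsilon> \<gamma> c"
    have C: "C \<ge> 0"
      using lipschitz_on_nonneg[OF lip] law.step_const_nonneg[of \<epsilon> \<gamma> c] eps gam c by (simp add: C_def)
    have "(\<lambda>n. (2 * K)\<^sup>2 * (Bm * t / real n)) \<longlonglongrightarrow> (2 * K)\<^sup>2 * 0"
      by (intro tendsto_intros h_lim)
    moreover have "\<epsilon> * (1 - c)\<^sup>2 > (2 * K)\<^sup>2 * 0" using eps c by simp
    ultimately have small: "\<forall>\<^sub>F n in sequentially. (2 * K)\<^sup>2 * (Bm * t / real n) < \<epsilon> * (1 - c)\<^sup>2"
      by (rule order_tendstoD)
    have "\<forall>\<^sub>F n in sequentially. norm ((\<integral>\<omega>. f (E n \<omega> n) \<partial>M) - (\<integral>z. f z \<partial>mix)) \<le> C * sqrt (Bm * t / real n)"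
      using small eventually_gt_at_top[of 0]
    proof eventually_elim
      case (elim n)
      then have n: "n > 0" by simp
      have "\<bar>(\<integral>\<omega>. f (E n \<omega> n) \<partial>M) - (\<integral>z. f z \<partial>gauss_mixture \<nu> (\<beta> (p n n)) (mix_var \<epsilon> \<gamma> (\<beta> (p n n))))\<bar>
        \<le> L * exp (law.step_lip \<epsilon> \<gamma> c * \<beta> (p n n)) * law.step_const \<epsilon> \<gamma> c * (\<Sum>i<n. (\<beta> (p n (Suc i)) - \<beta> (p n i)) * sqrt (\<beta> (p n (Suc i)) - \<beta> (p n i)))"
      proof (rule law.euler_scheme_weak_error[OF noise.prob_space_axioms eps gam c(2), where g = "\<lambda>i. \<beta> (p n i)" and E = "\<lambda>i \<omega>. E n \<omega> i"])
        show "\<beta> (p n 0) = 0" by (simp add: p0 beta_0)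
        show "\<beta> (p n i) < \<beta> (p n (Suc i))" if "i < n" for i using h_pos[OF n that] by (simp add: h_def)
        show "\<beta> (p n n) \<le> c" using beta_p[OF n] by simp
        show "(2 * K)\<^sup>2 * (\<beta> (p n (Suc i)) - \<beta> (p n i)) \<le> \<epsilon> * (1 - c)\<^sup>2" if "i < n" for i
        proof -
          have "(2 * K)\<^sup>2 * h n i \<le> (2 * K)\<^sup>2 * (Bm * t / real n)"
            using h_le[OF n that] by (intro mult_left_mono) simp_all
          then show ?thesis using elim(1) unfolding h_def by linarith
        qed
        show "distr M borel (\<lambda>\<omega>. E n \<omega> 0) = gaussian_measure \<gamma>" using init by (simp add: E_def)
        show "(\<lambda>\<omega>. E n \<omega> i) \<in> borel_measurable M" if "i \<le> n" for i by (rule E_meas[OF n that])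
        show "(\<integral>\<omega>. u (E n \<omega> (Suc i)) \<partial>M) = (\<integral>\<omega>. gauss_smooth (sqrt (\<epsilon> * (\<beta> (p n (Suc i)) - \<beta> (p n i)))) u
          (euler_mean \<nu> (\<beta> (p n i)) (mix_var \<epsilon> \<gamma> (\<beta> (p n i))) ((\<beta> (p n (Suc i)) - \<beta> (p n i)) / (1 - \<beta> (p n i))) (E n \<omega> i)) \<partial>M)"
          if i: "i < n" and u: "u \<in> borel_measurable borel" "bounded (range u)" for i and u :: "'v \<Rightarrow> real"
        proof -
          have ind: "prob_space.indep_set M (sets (vimage_algebra (space M) (X 0) borel))
             (sets (vimage_algebra (space M) (\<lambda>\<omega>. \<lambda>s\<in>{0..}. W s \<omega>) (PiM {0..} (\<lambda>_. borel))))"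
            using sde by (simp add: sde_solution_def)
          have "(\<integral>\<omega>. u (E n \<omega> (Suc i)) \<partial>M) = (\<integral>\<omega>. gauss_smooth (q n i * sqrt (p n (Suc i) - p n i)) u (\<phi> n i (E n \<omega> i)) \<partial>M)"
            unfolding E_def \<xi>_def
            by (rule noise.euler_scheme_step[OF X_meas ind _ p_mono[OF n] \<phi>_meas u]) (use n i p0 in auto)
          then show ?thesis unfolding q_scale[OF n] by (simp add: \<phi>_def h_def)
        qed
      qed (use lip bdd in auto)
      also have "\<dots> = C * (\<Sum>i<n. h n i * sqrt (h n i))" by (simp add: C_def h_def pn[OF n] c_def)
      also have "\<dots> \<le> C * (\<Sum>i<n. h n i * sqrt (Bm * t / real n))"
        using h_le[OF n] h_pos[OF n] C by (intro mult_left_mono sum_mono) (simp_all add: less_imp_le)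
      also have "(\<Sum>i<n. h n i * sqrt (Bm * t / real n)) = c * sqrt (Bm * t / real n)"
        by (simp add: h_sum[OF n] flip: sum_distrib_right)
      also have "C * (c * sqrt (Bm * t / real n)) \<le> C * (1 * sqrt (Bm * t / real n))"
        using C c Bm0 t by (intro mult_left_mono mult_right_mono) simp_all
      finally show ?case by (simp add: mix_def pn[OF n])
    qed
    moreover have "(\<lambda>n. C * sqrt (Bm * t / real n)) \<longlonglongrightarrow> 0"
    proof -
      have "(\<lambda>n. C * sqrt (Bm * t / real n)) \<longlonglongrightarrow> C * sqrt 0" by (intro tendsto_intros h_lim)
      then show ?thesis by simp
    qed
    ultimately have "(\<lambda>n. (\<integral>\<omega>. f (E n \<omega> n) \<partial>M) - (\<integral>z. f z \<partial>mix)) \<longlonglongrightarrow> 0"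
      by (rule Lim_null_comparison)
    then show ?thesis by (simp add: LIM_zero_iff)
  qed

  \<comment> \<open>Along a subsequence, the Euler schemes converge to the solution almost surely.\<close>
  define g where "g s = sqrt (\<epsilon> * \<beta>' s)" for s
  define is_noise where "is_noise s I \<longleftrightarrow> has_wiener_integral M W g s I \<and>
      (AE \<omega> in M. X s \<omega> = X 0 \<omega> + (LINT r:{0..s}|lborel. b r (X r \<omega>)) + I \<omega>)" for s I
  define J where "J s = (SOME I. is_noise s I)" for s
  have noise_J: "is_noise s (J s)" if "s \<in> {0..<1}" for s
  proof -
    have "\<exists>I. is_noise s I" using sde that by (simp add: sde_solution_def is_noise_def g_def[abs_def])
    then show ?thesis unfolding J_def by (rule someI_ex)
  qed
  have J: "has_wiener_integral M W g s (J s)"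
    and J_eq: "AE \<omega> in M. X s \<omega> = X 0 \<omega> + (LINT r:{0..s}|lborel. b r (X r \<omega>)) + J s \<omega>" if "s \<in> {0..<1}" for s
    using noise_J[OF that] by (simp_all add: is_noise_def)
  define \<rho> where "\<rho> n i \<omega> = norm (J (p n i) \<omega> - (\<Sum>j<i. \<xi> n \<omega> j))" for n i \<omega>
  \<comment> \<open>the part of the pathwise error that is due to the noise\<close>
  define Q where "Q n \<omega> = \<rho> n n \<omega> + \<Lambda> * exp \<Lambda> * (\<Sum>i<n. h n i * \<rho> n i \<omega>)" for n \<omega>
  have \<rho>: "\<exists>n0>0. \<forall>n\<ge>n0. \<forall>i\<le>n. integrable M (\<rho> n i) \<and> (\<integral>\<omega>. \<rho> n i \<omega> \<partial>M) \<le> \<theta> * (1 + 4 * \<kappa>)" if \<theta>: "\<theta> > 0" for \<theta>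
  proof -
    obtain d where d: "d > 0" "\<And>s s' r. 0 \<le> s \<Longrightarrow> s < s' \<Longrightarrow> s' \<le> t \<Longrightarrow> s' - s < d \<Longrightarrow> s \<le> r \<Longrightarrow> r \<le> s' \<Longrightarrow>
      \<bar>sqrt (\<epsilon> * \<beta>' r) - sqrt (\<epsilon> * (\<beta> s' - \<beta> s) / (s' - s))\<bar> \<le> \<theta>"
      using noise_coeff_close[OF t \<theta>] by blast
    obtain n0 :: nat where n0: "t / d < real n0" using reals_Archimedean2 by blast
    have "0 < t / d" using t d(1) by simp
    then have "0 < real n0" using n0 by linarith
    then have n0_pos: "n0 > 0" by simp
    show ?thesis
    proof (intro exI[of _ n0] conjI allI impI n0_pos)
      fix n i assume n: "n0 \<le> n" and i: "i \<le> n"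
      have n_pos: "n > 0" using n n0_pos by simp
      have "t / d < real n" using n0 of_nat_mono[OF n, where 'a = real] by linarith
      then have tn: "t / real n < d" using d(1) n_pos by (simp add: field_simps)
      let ?S = "(i, p n, q n) :: step" and ?T = "p n i"
      have T: "0 \<le> ?T" "?T \<le> t" "?T < 1" using p_le[OF n_pos i] t by auto
      have S: "step_on ?T ?S" using p0 p_less[OF n_pos] by (auto simp: step_on_def intro: less_imp_le)
      have W: "has_wiener_integral M W g ?T (J ?T)" using T by (intro J) simp
      have gm: "(\<lambda>s. g s * indicator {0..?T} s) \<in> borel_measurable borel"
      proof -
        have "continuous_on {0..?T} g"
          unfolding g_def using T by (intro continuous_intros continuous_on_subset[OF beta_C1]) auto
        then have "(\<lambda>s. indicator {0..?T} s *\<^sub>R g s) \<in> borel_measurable borel"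
          by (intro borel_measurable_continuous_on_indicator) simp_all
        then show ?thesis by (simp add: mult.commute)
      qed
      have close: "\<bar>g r - step_fun ?S r\<bar> \<le> \<theta>" if r: "0 < r" "r \<le> ?T" for r
      proof -
        obtain j where j: "j < i" "p n j < r" "r \<le> p n (Suc j)" "step_fun ?S r = q n j"
          using step_fun_grid[of i "p n" r "q n"] p_less[OF n_pos] r p0 by (metis less_imp_le)
        show ?thesis
          unfolding j(4) g_def q_def h_def
          using j i p_le[OF n_pos, of j] p_le[OF n_pos, of "Suc j"] p_less[OF n_pos, of j] tn
          by (intro d(2)) (simp_all add: p_diff)
      qed
      have eq: "\<rho> n i = (\<lambda>\<omega>. norm (J ?T \<omega> - step_integral W ?S \<omega>))"
        by (simp add: \<rho>_def \<xi>_def step_integral_def fun_eq_iff)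
      show "integrable M (\<rho> n i)"
        unfolding eq by (rule noise.wiener_integral_step_error_L1(1)[OF W S T(1) gm \<theta> close])
      have "(\<integral>\<omega>. \<rho> n i \<omega> \<partial>M) \<le> \<theta> * (1 + 4 * \<kappa> * ?T)"
        unfolding eq \<kappa>_def by (rule noise.wiener_integral_step_error_L1(2)[OF W S T(1) gm \<theta> close])
      also have "\<dots> \<le> \<theta> * (1 + 4 * \<kappa>)"
        using \<theta> \<kappa> T by (intro mult_left_mono add_left_mono) (simp_all add: mult_left_le)
      finally show "(\<integral>\<omega>. \<rho> n i \<omega> \<partial>M) \<le> \<theta> * (1 + 4 * \<kappa>)" .
    qed
  qed
  define D where "D = (1 + \<Lambda> * exp \<Lambda>) * (1 + 4 * \<kappa>)"
  have D: "D > 0" using \<Lambda> \<kappa> by (simp add: D_def add_pos_nonneg)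
  have Q: "\<exists>n0>0. \<forall>n\<ge>n0. integrable M (Q n) \<and> (\<integral>\<omega>. norm (Q n \<omega>) \<partial>M) \<le> D * \<theta>" if \<theta>: "\<theta> > 0" for \<theta>
  proof -
    obtain n0 where n0: "n0 > 0"
      "\<And>n i. n \<ge> n0 \<Longrightarrow> i \<le> n \<Longrightarrow> integrable M (\<rho> n i) \<and> (\<integral>\<omega>. \<rho> n i \<omega> \<partial>M) \<le> \<theta> * (1 + 4 * \<kappa>)"
      using \<rho>[OF \<theta>] by blast
    show ?thesis
    proof (intro exI[of _ n0] conjI allI impI n0(1))
      fix n assume n: "n0 \<le> n"
      then have n_pos: "n > 0" using n0(1) by simp
      have i: "integrable M (\<rho> n i)" if "i \<le> n" for i using n0(2)[OF n that] by simp
      have i_sum: "integrable M (\<lambda>\<omega>. \<Sum>i<n. h n i * \<rho> n i \<omega>)"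
        by (intro Bochner_Integration.integrable_sum integrable_mult_right i) simp
      have i_n: "integrable M (\<lambda>\<omega>. \<rho> n n \<omega>)" by (rule i) simp
      show "integrable M (Q n)" unfolding Q_def[abs_def]
        by (intro Bochner_Integration.integrable_add integrable_mult_right i_sum i_n)
      have "Q n \<omega> \<ge> 0" for \<omega>
        unfolding Q_def \<rho>_def using \<Lambda> less_imp_le[OF h_pos[OF n_pos]]
        by (intro add_nonneg_nonneg mult_nonneg_nonneg sum_nonneg) simp_all
      then have "(\<integral>\<omega>. norm (Q n \<omega>) \<partial>M) = (\<integral>\<omega>. Q n \<omega> \<partial>M)" by simp
      also have "\<dots> = (\<integral>\<omega>. \<rho> n n \<omega> \<partial>M) + \<Lambda> * exp \<Lambda> * (\<Sum>i<n. h n i * (\<integral>\<omega>. \<rho> n i \<omega> \<partial>M))"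
      proof -
        have "(\<integral>\<omega>. (\<Sum>i<n. h n i * \<rho> n i \<omega>) \<partial>M) = (\<Sum>i<n. h n i * (\<integral>\<omega>. \<rho> n i \<omega> \<partial>M))"
          by (subst Bochner_Integration.integral_sum) (auto intro!: i)
        then show ?thesis
          unfolding Q_def using i_sum i_n by (subst Bochner_Integration.integral_add) auto
      qed
      also have "\<dots> \<le> \<theta> * (1 + 4 * \<kappa>) + \<Lambda> * exp \<Lambda> * (\<Sum>i<n. h n i * (\<theta> * (1 + 4 * \<kappa>)))"
        using n0(2)[OF n] \<Lambda> h_pos[OF n_pos] by (intro add_mono mult_left_mono sum_mono) (simp_all add: less_imp_le)
      also have "(\<Sum>i<n. h n i * (\<theta> * (1 + 4 * \<kappa>))) = c * (\<theta> * (1 + 4 * \<kappa>))"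
        by (simp add: h_sum[OF n_pos] flip: sum_distrib_right)
      also have "\<theta> * (1 + 4 * \<kappa>) + \<Lambda> * exp \<Lambda> * (c * (\<theta> * (1 + 4 * \<kappa>)))
          \<le> \<theta> * (1 + 4 * \<kappa>) + \<Lambda> * exp \<Lambda> * (1 * (\<theta> * (1 + 4 * \<kappa>)))"
        using \<Lambda> \<kappa> \<theta> c by (intro add_left_mono mult_left_mono mult_right_mono) simp_all
      also have "\<dots> = D * \<theta>" by (simp add: D_def algebra_simps)
      finally show "(\<integral>\<omega>. norm (Q n \<omega>) \<partial>M) \<le> D * \<theta>" .
    qed
  qed
  \<comment> \<open>\<open>Q n\<close> is known to be integrable for large \<open>n\<close> only, hence the shift by \<open>n1\<close>\<close>
  obtain n1 where n1: "n1 > 0" "\<And>n. n \<ge> n1 \<Longrightarrow> integrable M (Q n)" using Q[of 1] by auto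
  have "(\<lambda>k. \<integral>\<omega>. norm (Q (k + n1) \<omega>) \<partial>M) \<longlonglongrightarrow> 0"
  proof (rule LIMSEQ_I)
    fix \<eta> :: real assume \<eta>: "\<eta> > 0"
    then have "\<eta> / (2 * D) > 0" using D by simp
    from Q[OF this] obtain n0 where n0: "\<And>n. n \<ge> n0 \<Longrightarrow> (\<integral>\<omega>. norm (Q n \<omega>) \<partial>M) \<le> D * (\<eta> / (2 * D))" by blast
    have "norm ((\<integral>\<omega>. norm (Q (k + n1) \<omega>) \<partial>M) - 0) < \<eta>" if "k \<ge> n0" for k
      using n0[of "k + n1"] that \<eta> D by simp
    then show "\<exists>no. \<forall>n\<ge>no. norm ((\<integral>\<omega>. norm (Q (n + n1) \<omega>) \<partial>M) - 0) < \<eta>" by blast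
  qed
  from tendsto_L1_AE_subseq[OF n1(2) this] obtain r where r: "strict_mono r" "AE \<omega> in M. (\<lambda>k. Q (r k + n1) \<omega>) \<longlonglongrightarrow> 0"
    by auto
  define N where "N k = r k + n1" for k
  have N_ge: "k \<le> N k" "N k > 0" for k using strict_mono_imp_increasing[OF r(1), of k] n1(1) by (auto simp: N_def)
  have AE_eq: "AE \<omega> in M. \<forall>n i. p n i \<in> {0..<1} \<longrightarrow>
      X (p n i) \<omega> = X 0 \<omega> + (LINT r:{0..p n i}|lborel. b r (X r \<omega>)) + J (p n i) \<omega>"
    unfolding AE_all_countable using J_eq by auto
  have AE_int: "AE \<omega> in M. set_integrable lborel {0..t} (\<lambda>s. b s (X s \<omega>))"
    using sde t by (simp add: sde_solution_def)
  have AE_cont: "AE \<omega> in M. continuous_on {0..<1} (\<lambda>s. X s \<omega>)"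
    using sde by (simp add: sde_solution_def)
  have strong: "AE \<omega> in M. (\<lambda>k. E (N k) \<omega> (N k)) \<longlonglongrightarrow> X t \<omega>"
    using AE_eq AE_int AE_cont r(2)
  proof eventually_elim
    case (elim \<omega>)
    define x where "x s = X s \<omega>" for s
    have x_cont: "continuous_on {0..t} x"
      unfolding x_def using t by (intro continuous_on_subset[OF elim(3)]) auto
    have b_eq: "b s (x s) = - \<beta>' s *\<^sub>R pull s (x s)" if "s \<in> {0..t}" for s using that t by (intro drift_pull) simp
    have int_t: "set_integrable lborel {0..t} (\<lambda>s. b s (x s))" using elim(2) by (simp add: x_def)
    have int_s: "set_integrable lborel {0..s} (\<lambda>s. b s (x s))" if "s \<le> t" for s
      using that by (intro set_integrable_subset[OF int_t]) auto
    have lint: "(LINT r:{0..s}|lborel. b r (x r)) = integral {0..s} (\<lambda>r. - \<beta>' r *\<^sub>R pull r (x r))" if "s \<le> t" for s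
    proof -
      have "(LINT r:{0..s}|lborel. b r (x r)) = integral {0..s} (\<lambda>r. b r (x r))"
        by (rule set_borel_integral_eq_integral(2)[OF int_s[OF that]])
      also have "\<dots> = integral {0..s} (\<lambda>r. - \<beta>' r *\<^sub>R pull r (x r))"
        using b_eq that by (intro Henstock_Kurzweil_Integration.integral_cong) simp
      finally show ?thesis .
    qed
    have hk: "(\<lambda>r. - \<beta>' r *\<^sub>R pull r (x r)) integrable_on {0..t}"
      using set_borel_integral_eq_integral(1)[OF int_t] b_eq by (rule integrable_eq)
    have bound: "\<exists>n0. \<forall>n\<ge>n0. norm (x t - E n \<omega> n) \<le> (1 + \<Lambda> * exp \<Lambda>) * \<theta> + Q n \<omega>" if \<theta>: "\<theta> > 0" for \<theta>
    proof -
      have "uniformly_continuous_on {0..t} (\<lambda>s. pull s (x s))"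
        by (intro compact_uniformly_continuous pull_continuous x_cont t) simp
      then obtain d where d: "d > 0" "\<And>s s'. s \<in> {0..t} \<Longrightarrow> s' \<in> {0..t} \<Longrightarrow> dist s' s < d \<Longrightarrow> dist (pull s' (x s')) (pull s (x s)) < \<theta>"
        using \<theta> unfolding uniformly_continuous_on_def by metis
      obtain n0 :: nat where n0: "t / d < real n0" using reals_Archimedean2 by blast
      show ?thesis
      proof (intro exI[of _ n0] allI impI)
        fix n assume n: "n0 \<le> n"
        have "t / d < real n" using n0 of_nat_mono[OF n, where 'a = real] by linarith
        moreover have "0 < t / d" using t d(1) by simp
        ultimately have "0 < real n" by linarith
        then have n_pos: "n > 0" by simp
        have tn: "t / real n < d" using \<open>t / d < real n\<close> d(1) n_pos by (simp add: field_simps)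
        have "norm (x (p n n) - euler_path (\<phi> n) (x 0) (\<xi> n \<omega>) n)
          \<le> (1 + \<Lambda> * exp \<Lambda>) * \<theta>
            + (norm (J (p n n) \<omega> - (\<Sum>j<n. \<xi> n \<omega> j)) + \<Lambda> * exp \<Lambda> * (\<Sum>i<n. (\<beta> (p n (Suc i)) - \<beta> (p n i)) * norm (J (p n i) \<omega> - (\<Sum>j<i. \<xi> n \<omega> j))))"
        proof (rule euler_path_error[where G = pull and \<beta>' = \<beta>'])
          show "p n 0 = 0" by (rule p0)
          show "p n i \<le> p n (Suc i)" if "i < n" for i using p_less[OF n_pos] by (rule less_imp_le)
          show "(\<beta>' has_integral \<beta> a' - \<beta> a) {a..a'}" if "0 \<le> a" "a \<le> a'" "a' \<le> p n n" for a a'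
            using that t by (intro beta_has_integral) (simp_all add: pn[OF n_pos])
          show "0 \<le> \<beta>' r" if "0 \<le> r" "r \<le> p n n" for r
            using that t by (intro beta'_nonneg) (simp_all add: pn[OF n_pos])
          show "(\<lambda>r. - \<beta>' r *\<^sub>R pull r (x r)) integrable_on {0..p n n}" using hk by (simp add: pn[OF n_pos])
          show "x (p n i) = x 0 + integral {0..p n i} (\<lambda>r. - \<beta>' r *\<^sub>R pull r (x r)) + J (p n i) \<omega>" if "i \<le> n" for i
          proof -
            have pi: "p n i \<in> {0..<1}" "p n i \<le> t" using p_le[OF n_pos that] t by auto
            then have "x (p n i) = x 0 + (LINT r:{0..p n i}|lborel. b r (x r)) + J (p n i) \<omega>"
              using elim(1) unfolding x_def by blast
            then show ?thesis by (simp only: lint[OF pi(2)])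
          qed
          show "norm (pull r (x r) - pull (p n i) (x (p n i))) \<le> \<theta>" if "i < n" "p n i \<le> r" "r \<le> p n (Suc i)" for i r
          proof -
            have "dist r (p n i) < d" using that p_diff[of n i] tn by (simp add: dist_real_def)
            moreover have "r \<in> {0..t}" "p n i \<in> {0..t}"
              using that p_le[OF n_pos, of i] p_le[OF n_pos, of "Suc i"] by auto
            ultimately have "dist (pull r (x r)) (pull (p n i) (x (p n i))) < \<theta>" by (intro d(2))
            then show ?thesis by (simp add: dist_norm)
          qed
          show "\<Lambda>-lipschitz_on UNIV (pull (p n i))" if "i < n" for i
            unfolding \<Lambda>_def c_def using that p_le[OF n_pos, of i] t by (intro pull_lipschitz) simp_all
          show "\<phi> n i y = y - (\<beta> (p n (Suc i)) - \<beta> (p n i)) *\<^sub>R pull (p n i) y" if "i < n" for i y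
            by (simp add: \<phi>_def euler_mean_def pull_def h_def scaleR_diff_left scaleR_diff_right)
          show "\<beta> (p n n) \<le> 1" using beta_p[OF n_pos, of n] c by simp
        qed (use \<theta> \<Lambda> beta_0 in simp_all)
        then show "norm (x t - E n \<omega> n) \<le> (1 + \<Lambda> * exp \<Lambda>) * \<theta> + Q n \<omega>"
          by (simp add: E_def Q_def \<rho>_def h_def pn[OF n_pos] x_def)
      qed
    qed
    show "(\<lambda>k. E (N k) \<omega> (N k)) \<longlonglongrightarrow> X t \<omega>"
    proof (rule LIMSEQ_I)
      fix \<eta> :: real assume \<eta>: "\<eta> > 0"
      define A where "A = 1 + \<Lambda> * exp \<Lambda>"
      define \<theta> where "\<theta> = \<eta> / (2 * A)"
      have "A > 0" using \<Lambda> by (simp add: A_def add_pos_nonneg)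
      then have \<theta>: "\<theta> > 0" "A * \<theta> = \<eta> / 2" using \<eta> by (simp_all add: \<theta>_def)
      obtain n0 where n0: "\<And>n. n \<ge> n0 \<Longrightarrow> norm (x t - E n \<omega> n) \<le> A * \<theta> + Q n \<omega>"
        using bound[OF \<theta>(1)] unfolding A_def by blast
      obtain k0 where k0: "\<And>k. k \<ge> k0 \<Longrightarrow> norm (Q (r k + n1) \<omega> - 0) < \<eta> / 2"
        using LIMSEQ_D[OF elim(4), of "\<eta> / 2"] \<eta> by auto
      have "norm (E (N k) \<omega> (N k) - X t \<omega>) < \<eta>" if "k \<ge> max n0 k0" for k
      proof -
        have "norm (x t - E (N k) \<omega> (N k)) \<le> \<eta> / 2 + Q (N k) \<omega>"
          using n0[of "N k"] N_ge(1)[of k] that \<theta>(2) by simp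
        moreover have "Q (N k) \<omega> < \<eta> / 2" using k0[of k] that by (simp add: N_def)
        ultimately show ?thesis by (simp add: x_def norm_minus_commute)
      qed
      then show "\<exists>no. \<forall>n\<ge>no. norm (E (N n) \<omega> (N n) - X t \<omega>) < \<eta>" by blast
    qed
  qed

  have Xt [measurable]: "X t \<in> borel_measurable M" using X_meas t by simp
  show ?thesis
  proof (rule measure_eqI_lipschitz)
    show "prob_space (distr M borel (X t))" by (rule noise.prob_space_distr) simp
    show "prob_space (gauss_mixture \<nu> (\<beta> t) (mix_var \<epsilon> \<gamma> (\<beta> t)))" by (rule law.prob_space_gauss_mixture)
    fix L B and f :: "'v \<Rightarrow> real" assume lip: "L-lipschitz_on UNIV f" and bdd: "\<And>x. \<bar>f x\<bar> \<le> B"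
    have f_cont: "continuous_on UNIV f" by (rule lipschitz_on_continuous_on[OF lip])
    have [measurable]: "f \<in> borel_measurable borel" using f_cont by (rule borel_measurable_continuous_onI)
    have "filterlim N at_top sequentially"
      by (rule filterlim_at_top_mono[OF filterlim_ident]) (use N_ge in simp)
    from filterlim_compose[OF weak[OF lip bdd] this]
    have "(\<lambda>k. \<integral>\<omega>. f (E (N k) \<omega> (N k)) \<partial>M) \<longlonglongrightarrow> (\<integral>z. f z \<partial>mix)" .
    moreover have "(\<lambda>k. \<integral>\<omega>. f (E (N k) \<omega> (N k)) \<partial>M) \<longlonglongrightarrow> (\<integral>\<omega>. f (X t \<omega>) \<partial>M)"
    proof (rule integral_dominated_convergence[where w = "\<lambda>_. B"])
      show "(\<lambda>\<omega>. f (E (N k) \<omega> (N k))) \<in> borel_measurable M" for k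
        using E_meas[OF N_ge(2)[of k] order_refl] by simp
      show "AE \<omega> in M. (\<lambda>k. f (E (N k) \<omega> (N k))) \<longlonglongrightarrow> f (X t \<omega>)"
        using strong
      proof eventually_elim
        case (elim \<omega>)
        have "isCont f (X t \<omega>)" using f_cont by (simp add: continuous_on_eq_continuous_at)
        then show ?case using elim by (rule isCont_tendsto_compose)
      qed
    qed (use bdd in simp_all)
    ultimately have "(\<integral>z. f z \<partial>mix) = (\<integral>\<omega>. f (X t \<omega>) \<partial>M)" by (rule LIMSEQ_unique)
    then show "(\<integral>z. f z \<partial>distr M borel (X t)) = (\<integral>z. f z \<partial>gauss_mixture \<nu> (\<beta> t) (mix_var \<epsilon> \<gamma> (\<beta> t)))"
      by (simp add: mix_def integral_distr)
  qed simp_all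
qed

end

section \<open>The variation distance between Gaussian mixtures\<close>

text \<open>
  The supremum is attained at the sign of \<open>p - q\<close>.
\<close>

lemma var_dist_density:
  fixes p q :: "'v::euclidean_space \<Rightarrow> real"
  assumes p: "integrable lborel p" "\<And>x. p x \<ge> 0" and q: "integrable lborel q" "\<And>x. q x \<ge> 0"
  shows "var_dist (density lborel (\<lambda>x. ennreal (p x))) (density lborel (\<lambda>x. ennreal (q x))) = (\<integral>x. \<bar>p x - q x\<bar> \<partial>lborel)"
proof -
  have [measurable]: "p \<in> borel_measurable borel" "q \<in> borel_measurable borel"
    using borel_measurable_integrable[OF p(1)] borel_measurable_integrable[OF q(1)] by simp_all
  have int_diff: "integrable lborel (\<lambda>x. \<bar>p x - q x\<bar>)" using p q by simp
  let ?F = "{f \<in> borel_measurable borel. \<forall>x. \<bar>f x\<bar> \<le> 1} :: ('v \<Rightarrow> real) set"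
  have bdd: "integrable lborel (\<lambda>x. r x * f x)" if "f \<in> ?F" "integrable lborel r" for f r :: "'v \<Rightarrow> real"
  proof (rule Bochner_Integration.integrable_bound[OF that(2)])
    have [measurable]: "f \<in> borel_measurable borel" using that by simp
    have [measurable]: "r \<in> borel_measurable borel" using borel_measurable_integrable[OF that(2)] by simp
    show "(\<lambda>x. r x * f x) \<in> borel_measurable lborel" by simp
    show "AE x in lborel. norm (r x * f x) \<le> norm (r x)"
    proof (rule AE_I2)
      fix x
      have "\<bar>r x\<bar> * \<bar>f x\<bar> \<le> \<bar>r x\<bar> * 1" using that(1) by (intro mult_left_mono) simp_all
      then show "norm (r x * f x) \<le> norm (r x)" by (simp add: abs_mult)
    qed
  qed
  have eq: "(\<integral>x. f x \<partial>density lborel (\<lambda>x. ennreal (p x))) - (\<integral>x. f x \<partial>density lborel (\<lambda>x. ennreal (q x)))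
      = (\<integral>x. (p x - q x) * f x \<partial>lborel)" if f: "f \<in> ?F" for f
  proof -
    have [measurable]: "f \<in> borel_measurable borel" using f by simp
    show ?thesis
      using bdd[OF f p(1)] bdd[OF f q(1)] p q by (simp add: integral_density left_diff_distrib)
  qed
  have le: "\<bar>\<integral>x. (p x - q x) * f x \<partial>lborel\<bar> \<le> (\<integral>x. \<bar>p x - q x\<bar> \<partial>lborel)" if f: "f \<in> ?F" for f
  proof (rule order_trans[OF integral_abs_bound], rule integral_mono[OF _ int_diff])
    show "integrable lborel (\<lambda>x. \<bar>(p x - q x) * f x\<bar>)"
      using p q by (intro integrable_abs bdd[OF f]) simp
    fix x
    have "\<bar>p x - q x\<bar> * \<bar>f x\<bar> \<le> \<bar>p x - q x\<bar> * 1" using f by (intro mult_left_mono) simp_all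
    then show "\<bar>(p x - q x) * f x\<bar> \<le> \<bar>p x - q x\<bar>" by (simp add: abs_mult)
  qed
  define s where "s x = sgn (p x - q x)" for x
  have s: "s \<in> ?F" by (auto simp: s_def[abs_def] sgn_if)
  have s_eq: "(p x - q x) * s x = \<bar>p x - q x\<bar>" for x by (simp add: s_def abs_sgn)
  show ?thesis
    unfolding var_dist_def
  proof (rule cSup_eq_maximum)
    show "(\<integral>x. \<bar>p x - q x\<bar> \<partial>lborel) \<in> (\<lambda>f. \<bar>(\<integral>x. f x \<partial>density lborel (\<lambda>x. ennreal (p x)))
        - (\<integral>x. f x \<partial>density lborel (\<lambda>x. ennreal (q x)))\<bar>) ` ?F"
      by (rule image_eqI[OF _ s]) (simp only: eq[OF s] s_eq, simp)
  qed (use eq le in auto)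
qed

text \<open>
  The Cauchy-Schwarz inequality for \<open>H / \<surd>g\<close> and \<open>\<surd>g\<close>.
\<close>

lemma sq_integral_abs_le:
  fixes H g :: "'v::euclidean_space \<Rightarrow> real"
  assumes H: "integrable lborel H" and [measurable]: "g \<in> borel_measurable borel"
    and g: "\<And>x. g x > 0" "(\<integral>\<^sup>+x. ennreal (g x) \<partial>lborel) = 1"
  shows "ennreal ((\<integral>x. \<bar>H x\<bar> \<partial>lborel)\<^sup>2) \<le> (\<integral>\<^sup>+x. ennreal ((H x)\<^sup>2 / g x) \<partial>lborel)"
proof (cases "(\<integral>\<^sup>+x. ennreal ((H x)\<^sup>2 / g x) \<partial>lborel) = \<infinity>")
  case False
  have [measurable]: "H \<in> borel_measurable borel" using borel_measurable_integrable[OF H] by simp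
  define D where "D = (\<integral>x. \<bar>H x\<bar> \<partial>lborel)"
  define S where "S = (\<integral>x. (H x)\<^sup>2 / g x \<partial>lborel)"
  have nn: "(H x)\<^sup>2 / g x \<ge> 0" for x using g(1)[of x] by simp
  have iS: "integrable lborel (\<lambda>x. (H x)\<^sup>2 / g x)"
    using False nn by (intro integrableI_nonneg) (simp_all add: top.not_eq_extremum)
  have ig: "integrable lborel g" using g by (intro integrableI_nonneg) (simp_all add: less_imp_le)
  have eg: "(\<integral>x. g x \<partial>lborel) = 1"
    using g by (subst integral_eq_nn_integral) (simp_all add: less_imp_le)
  have D: "D \<ge> 0" unfolding D_def by simp
  have "D\<^sup>2 \<le> S"
  proof (cases "D = 0")
    case True then show ?thesis using nn by (simp add: S_def)
  next
    case False
    then have D: "D > 0" using D by simp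
    \<comment> \<open>the weight \<open>D\<close> is the optimal one in the arithmetic-geometric mean inequality\<close>
    have "D \<le> (\<integral>x. D * g x / 2 + (H x)\<^sup>2 / g x / (2 * D) \<partial>lborel)"
      (is "_ \<le> ?R")
    proof -
      have "(\<integral>x. \<bar>H x\<bar> \<partial>lborel) \<le> ?R"
      proof (rule integral_mono)
        show "integrable lborel (\<lambda>x. \<bar>H x\<bar>)" using H by simp
        show "integrable lborel (\<lambda>x. D * g x / 2 + (H x)\<^sup>2 / g x / (2 * D))"
          by (intro Bochner_Integration.integrable_add integrable_divide integrable_mult_right ig iS)
        fix x
        have "0 \<le> (D * g x - \<bar>H x\<bar>)\<^sup>2 / (2 * D * g x)" using D g(1)[of x] by simp
        also have "\<dots> = D * g x / 2 + (H x)\<^sup>2 / g x / (2 * D) - \<bar>H x\<bar>"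
          using D g(1)[of x] by (simp add: power2_diff power_mult_distrib add_divide_distrib diff_divide_distrib) (simp add: power2_eq_square field_simps)
        finally show "\<bar>H x\<bar> \<le> D * g x / 2 + (H x)\<^sup>2 / g x / (2 * D)" by simp
      qed
      then show ?thesis by (simp add: D_def)
    qed
    also have "\<dots> = D / 2 + S / (2 * D)"
      using ig iS by (subst Bochner_Integration.integral_add) (simp_all add: eg S_def del: divide_divide_eq_left)
    finally have "D * D \<le> S" using D by (simp add: field_simps)
    then show ?thesis by (simp add: power2_eq_square)
  qed
  then have "ennreal (D\<^sup>2) \<le> ennreal S" by (rule ennreal_leI)
  also have "ennreal S = (\<integral>\<^sup>+x. ennreal ((H x)\<^sup>2 / g x) \<partial>lborel)"
    unfolding S_def using iS nn by (intro nn_integral_eq_integral[symmetric]) simp_all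
  finally show ?thesis by (simp add: D_def)
qed simp

lemma (in prob_space) expectation_sq_sum_indep:
  fixes Y :: "'i \<Rightarrow> 'a \<Rightarrow> real"
  assumes fin: "finite I" and ind: "indep_vars (\<lambda>_. borel) Y I"
    and bdd: "\<And>i \<omega>. i \<in> I \<Longrightarrow> \<bar>Y i \<omega>\<bar> \<le> B" and mean: "\<And>i. i \<in> I \<Longrightarrow> expectation (Y i) = 0"
  shows "expectation (\<lambda>\<omega>. (\<Sum>i\<in>I. Y i \<omega>)\<^sup>2) = (\<Sum>i\<in>I. expectation (\<lambda>\<omega>. (Y i \<omega>)\<^sup>2))"
proof -
  have [measurable]: "Y i \<in> borel_measurable M" if "i \<in> I" for i using ind that by (auto simp: indep_vars_def)
  have int: "integrable M (Y i)" if "i \<in> I" for i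
    using that by (intro integrable_const_bound[of _ B]) (simp_all add: bdd)
  have int2: "integrable M (\<lambda>\<omega>. Y i \<omega> * Y j \<omega>)" if "i \<in> I" "j \<in> I" for i j
  proof (rule integrable_const_bound[of _ "B * B"])
    have "\<bar>Y i \<omega>\<bar> * \<bar>Y j \<omega>\<bar> \<le> B * B" for \<omega>
      using bdd[OF that(1), of \<omega>] bdd[OF that(2), of \<omega>] by (intro mult_mono) auto
    then show "AE \<omega> in M. norm (Y i \<omega> * Y j \<omega>) \<le> B * B" by (simp add: abs_mult)
  qed (use that in simp)
  have cross: "expectation (\<lambda>\<omega>. Y i \<omega> * Y j \<omega>) = 0" if "i \<in> I" "j \<in> I" "i \<noteq> j" for i j
  proof -
    have "indep_vars (\<lambda>_. borel) Y {i, j}" by (rule indep_vars_subset[OF ind]) (use that in auto)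
    then have "expectation (\<lambda>\<omega>. \<Prod>k\<in>{i, j}. Y k \<omega>) = (\<Prod>k\<in>{i, j}. expectation (Y k))"
      by (intro indep_vars_lebesgue_integral) (use that int in auto)
    then show ?thesis using that mean by simp
  qed
  have "expectation (\<lambda>\<omega>. (\<Sum>i\<in>I. Y i \<omega>)\<^sup>2) = expectation (\<lambda>\<omega>. \<Sum>i\<in>I. \<Sum>j\<in>I. Y i \<omega> * Y j \<omega>)"
    by (simp add: power2_eq_square sum_product)
  also have "\<dots> = (\<Sum>i\<in>I. \<Sum>j\<in>I. expectation (\<lambda>\<omega>. Y i \<omega> * Y j \<omega>))"
    using int2 by (subst Bochner_Integration.integral_sum; (intro Bochner_Integration.integrable_sum sum.cong refl Bochner_Integration.integral_sum)?) auto
  also have "\<dots> = (\<Sum>i\<in>I. \<Sum>j\<in>I. if j = i then expectation (\<lambda>\<omega>. (Y i \<omega>)\<^sup>2) else 0)"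
    using cross by (intro sum.cong refl) (auto simp: power2_eq_square)
  also have "\<dots> = (\<Sum>i\<in>I. expectation (\<lambda>\<omega>. (Y i \<omega>)\<^sup>2))" using fin by simp
  finally show ?thesis .
qed

text \<open>
  The quotient is again a Gaussian density, centred at \<open>2 u\<close>, times a constant.
\<close>

lemma nn_integral_gauss_density_ratio:
  assumes v: "v > 0"
  shows "(\<integral>\<^sup>+x. ennreal ((gauss_density v (x - u))\<^sup>2 / gauss_density v x) \<partial>lborel) = ennreal (exp ((norm (u :: 'v::euclidean_space))\<^sup>2 / v))"
proof -
  have eq: "(gauss_density v (x - u))\<^sup>2 / gauss_density v x = exp ((norm u)\<^sup>2 / v) * gauss_density v (x - 2 *\<^sub>R u)" for x
  proof -
    define C where "C = (2 * pi * v) powr (- real DIM('v) / 2)"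
    have C: "C > 0" using v by (simp add: C_def)
    have e: "- (norm (x - u))\<^sup>2 / (2 * v) + - (norm (x - u))\<^sup>2 / (2 * v) - - (norm x)\<^sup>2 / (2 * v)
        = (norm u)\<^sup>2 / v + - (norm (x - 2 *\<^sub>R u))\<^sup>2 / (2 * v)"
    proof -
      have 1: "(norm (x - u))\<^sup>2 = (norm x)\<^sup>2 - 2 * (x \<bullet> u) + (norm u)\<^sup>2"
        and 2: "(norm (x - 2 *\<^sub>R u))\<^sup>2 = (norm x)\<^sup>2 - 4 * (x \<bullet> u) + 4 * (norm u)\<^sup>2"
        by (simp_all add: power2_norm_eq_inner inner_diff inner_commute)
      show ?thesis unfolding 1 2 using v by (simp add: field_simps)
    qed
    have "(gauss_density v (x - u))\<^sup>2 / gauss_density v x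
        = C * (exp (- (norm (x - u))\<^sup>2 / (2 * v)) * exp (- (norm (x - u))\<^sup>2 / (2 * v)) / exp (- (norm x)\<^sup>2 / (2 * v)))"
      unfolding gauss_density_def C_def[symmetric] using C by (simp add: power2_eq_square)
    also have "\<dots> = C * exp ((norm u)\<^sup>2 / v + - (norm (x - 2 *\<^sub>R u))\<^sup>2 / (2 * v))"
      by (simp only: exp_add[symmetric] exp_diff[symmetric] e)
    also have "\<dots> = exp ((norm u)\<^sup>2 / v) * gauss_density v (x - 2 *\<^sub>R u)"
      unfolding exp_add gauss_density_def C_def by simp
    finally show ?thesis .
  qed
  have "(\<integral>\<^sup>+x. ennreal (gauss_density v (x - 2 *\<^sub>R u)) \<partial>lborel) = (\<integral>\<^sup>+x. ennreal (gauss_density v (x :: 'v)) \<partial>lborel)"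
    by (subst nn_integral_lborel_affine[where r = 1 and c = "2 *\<^sub>R u"]) simp_all
  then show ?thesis
    unfolding eq by (simp add: ennreal_mult nn_integral_cmult nn_integral_gauss_density[OF v])
qed

context bounded_law
begin

definition mix_density :: "real \<Rightarrow> real \<Rightarrow> 'v \<Rightarrow> real" where
  "mix_density b v x = (\<integral>y. gauss_density v (x - b *\<^sub>R y) \<partial>\<nu>)"

lemma mix_density_measurable [measurable]: "mix_density b v \<in> borel_measurable borel"
  unfolding mix_density_def[abs_def] by (rule borel_measurable_lebesgue_integral) measurable

lemma mix_density_nonneg: "mix_density b v x \<ge> 0"
  by (simp add: mix_density_def)

lemma integrable_mix_density: "v > 0 \<Longrightarrow> integrable lborel (mix_density b v)"
proof -
  assume v: "v > 0"
  interpret pair_sigma_finite \<nu> "lborel :: 'v measure" ..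
  have 1: "case_prod (\<lambda>z y. 1 :: real) \<in> borel_measurable ((borel :: 'v measure) \<Otimes>\<^sub>M (borel :: 'v measure))" by simp
  show ?thesis
    using integrable_snd[OF integrable_pair_gauss_density[OF v 1, of 1], of b] by (simp add: mix_density_def[abs_def])
qed

lemma gauss_mixture_mix_density: "v > 0 \<Longrightarrow> gauss_mixture \<nu> b v = density lborel (\<lambda>x. ennreal (mix_density b v x))"
  by (simp add: gauss_mixture_density mix_density_def)

lemma gauss_density_le: "v > 0 \<Longrightarrow> gauss_density v (x :: 'v) \<le> gauss_density v (0 :: 'v)"
  unfolding gauss_density_def by (simp add: mult_left_le)

lemma mix_density_le:
  assumes "v > 0" shows "mix_density b v x \<le> gauss_density v (0 :: 'v)"
proof -
  have "mix_density b v x \<le> (\<integral>y. gauss_density v (0 :: 'v) \<partial>\<nu>)"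
    unfolding mix_density_def
  proof (rule integral_mono)
    show "integrable \<nu> (\<lambda>y. gauss_density v (x - b *\<^sub>R y))"
      unfolding gauss_density_gkern using integrable_gkern[OF assms] by simp
  qed (simp_all add: gauss_density_le[OF assms])
  then show ?thesis using prob_space by simp
qed

text \<open>
  With the centred Gaussian as weight, the squared variation distance is bounded by a chi-square type integral. At each
  point its mean is the variance of a sample average, that is \<open>1 / N\<close> times the variance of one term.
\<close>

lemma empirical_mixture_error:
  fixes Y :: "nat \<Rightarrow> 'a \<Rightarrow> 'v"
  assumes M: "prob_space M" and ind: "prob_space.indep_vars M (\<lambda>_. borel) Y {1..N}"
    and law: "\<And>i. i \<in> {1..N} \<Longrightarrow> distr M borel (Y i) = \<nu>" and N: "N \<ge> 1" and v: "v > 0"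
  shows "(\<lambda>\<omega>. \<integral>x. \<bar>(\<Sum>i=1..N. gauss_density v (x - b *\<^sub>R Y i \<omega>)) / real N - mix_density b v x\<bar> \<partial>lborel) \<in> borel_measurable M"
      (is "?D \<in> _")
    and "(\<integral>\<^sup>+\<omega>. ennreal ((\<integral>x. \<bar>(\<Sum>i=1..N. gauss_density v (x - b *\<^sub>R Y i \<omega>)) / real N - mix_density b v x\<bar> \<partial>lborel)\<^sup>2) \<partial>M)
      \<le> ennreal (1 / real N) * (\<integral>\<^sup>+x. ennreal ((\<integral>y. (gauss_density v (x - b *\<^sub>R y) - mix_density b v x)\<^sup>2 \<partial>\<nu>) / gauss_density v x) \<partial>lborel)"
proof -
  interpret M: prob_space M by fact
  interpret prod: pair_sigma_finite M "lborel :: 'v measure" ..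
  have Ym [measurable]: "Y i \<in> borel_measurable M" if "i \<in> {1..N}" for i
    using ind that unfolding M.indep_vars_def by auto
  define p where "p = mix_density b v"
  have [measurable]: "p \<in> borel_measurable borel" unfolding p_def by measurable
  define C where "C = gauss_density v (0 :: 'v)"
  define G where "G x y = gauss_density v (x - b *\<^sub>R y) - p x" for x y
  have G_bdd: "\<bar>G x y\<bar> \<le> C" for x y
    using gauss_density_le[OF v, of "x - b *\<^sub>R y"] gauss_density_nonneg[of v "x - b *\<^sub>R y"]
      mix_density_le[OF v, of b x] mix_density_nonneg[of b v x]
    unfolding G_def p_def C_def by linarith
  define H where "H \<omega> x = (\<Sum>i=1..N. gauss_density v (x - b *\<^sub>R Y i \<omega>)) / real N - p x" for \<omega> x
  have H_sum: "H \<omega> x = (\<Sum>i=1..N. G x (Y i \<omega>)) / real N" for \<omega> x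
    using N by (simp add: H_def G_def sum_subtractf diff_divide_distrib)
  have Hm [measurable]: "(\<lambda>z. H (fst z) (snd z)) \<in> borel_measurable (M \<Otimes>\<^sub>M lborel)"
    unfolding H_def by measurable
  have Dm: "(\<lambda>\<omega>. \<integral>x. \<bar>H \<omega> x\<bar> \<partial>lborel) \<in> borel_measurable M"
    by (rule lborel.borel_measurable_lebesgue_integral) (use Hm in \<open>simp add: case_prod_unfold\<close>)
  then show "?D \<in> borel_measurable M" unfolding H_def p_def .
  have Hi: "integrable lborel (H \<omega>)" for \<omega>
  proof -
    have "integrable lborel (\<lambda>x. gauss_density v (x - u))" for u :: 'v
    proof (rule integrableI_nonneg)
      have "(\<integral>\<^sup>+x. ennreal (gauss_density v (x - u)) \<partial>lborel) = (\<integral>\<^sup>+x. ennreal (gauss_density v (x :: 'v)) \<partial>lborel)"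
        by (subst nn_integral_lborel_affine[where r = 1 and c = u]) simp_all
      then show "(\<integral>\<^sup>+x. ennreal (gauss_density v (x - u)) \<partial>lborel) < \<infinity>"
        by (simp add: nn_integral_gauss_density[OF v])
    qed simp_all
    then show ?thesis unfolding H_def[abs_def] p_def using integrable_mix_density[OF v] by simp
  qed
  have g0: "gauss_density v x > 0" for x :: 'v using v by (rule gauss_density_pos)
  have "(\<integral>\<^sup>+\<omega>. ennreal ((\<integral>x. \<bar>H \<omega> x\<bar> \<partial>lborel)\<^sup>2) \<partial>M) \<le> (\<integral>\<^sup>+\<omega>. \<integral>\<^sup>+x. ennreal ((H \<omega> x)\<^sup>2 / gauss_density v x) \<partial>lborel \<partial>M)"
    by (intro nn_integral_mono sq_integral_abs_le Hi g0 nn_integral_gauss_density v) simp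
  also have "\<dots> = (\<integral>\<^sup>+x. \<integral>\<^sup>+\<omega>. ennreal ((H \<omega> x)\<^sup>2 / gauss_density v x) \<partial>M \<partial>lborel)"
    by (rule prod.Fubini'[symmetric]) (use Hm in \<open>simp add: case_prod_unfold\<close>)
  also have "\<dots> = (\<integral>\<^sup>+x. ennreal (1 / real N) * ennreal ((\<integral>y. (G x y)\<^sup>2 \<partial>\<nu>) / gauss_density v x) \<partial>lborel)"
  proof (rule nn_integral_cong)
    fix x :: 'v
    have Gm [measurable]: "G x \<in> borel_measurable borel" unfolding G_def[abs_def] by measurable
    have Gi: "integrable M (\<lambda>\<omega>. G x (Y i \<omega>))" if "i \<in> {1..N}" for i
      using that by (intro M.integrable_const_bound[of _ C]) (simp_all add: G_bdd)
    have E: "(\<integral>\<omega>. (\<Sum>i=1..N. G x (Y i \<omega>))\<^sup>2 \<partial>M) = (\<Sum>i=1..N. (\<integral>\<omega>. (G x (Y i \<omega>))\<^sup>2 \<partial>M))"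
    proof (rule M.expectation_sq_sum_indep[of "{1..N}" "\<lambda>i \<omega>. G x (Y i \<omega>)" C])
      show "M.indep_vars (\<lambda>_. borel) (\<lambda>i \<omega>. G x (Y i \<omega>)) {1..N}"
        by (rule M.indep_vars_compose2[OF ind]) simp
      fix i assume i: "i \<in> {1..N}"
      have "(\<integral>\<omega>. G x (Y i \<omega>) \<partial>M) = (\<integral>y. G x y \<partial>\<nu>)"
        unfolding law[OF i, symmetric] using i by (intro integral_distr[symmetric]) simp_all
      also have "\<dots> = 0"
      proof -
        have "integrable \<nu> (\<lambda>y. gauss_density v (x - b *\<^sub>R y))"
          unfolding gauss_density_gkern using integrable_gkern[OF v] by simp
        then show ?thesis using prob_space by (simp add: G_def p_def mix_density_def)
      qed
      finally show "(\<integral>\<omega>. G x (Y i \<omega>) \<partial>M) = 0" .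
    qed (simp_all add: G_bdd)
    also have "\<dots> = (\<Sum>i=1..N. (\<integral>y. (G x y)\<^sup>2 \<partial>\<nu>))"
    proof (rule sum.cong[OF refl])
      fix i assume i: "i \<in> {1..N}"
      show "(\<integral>\<omega>. (G x (Y i \<omega>))\<^sup>2 \<partial>M) = (\<integral>y. (G x y)\<^sup>2 \<partial>\<nu>)"
        unfolding law[OF i, symmetric] using i by (intro integral_distr[symmetric]) simp_all
    qed
    finally have E: "(\<integral>\<omega>. (\<Sum>i=1..N. G x (Y i \<omega>))\<^sup>2 \<partial>M) = real N * (\<integral>y. (G x y)\<^sup>2 \<partial>\<nu>)" by simp
    have Hx [measurable]: "(\<lambda>\<omega>. H \<omega> x) \<in> borel_measurable M" unfolding H_def by measurable
    have H_bdd: "\<bar>H \<omega> x\<bar> \<le> C" for \<omega>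
    proof -
      have "\<bar>\<Sum>i=1..N. G x (Y i \<omega>)\<bar> \<le> (\<Sum>i=1..N. C)" by (rule order_trans[OF sum_abs sum_mono]) (rule G_bdd)
      then show ?thesis using N by (simp add: H_sum field_simps)
    qed
    have iH: "integrable M (\<lambda>\<omega>. (H \<omega> x)\<^sup>2 / gauss_density v x)"
    proof (rule M.integrable_const_bound[of _ "C\<^sup>2 / gauss_density v x"])
      have "(H \<omega> x)\<^sup>2 \<le> C\<^sup>2" for \<omega> using H_bdd[of \<omega>] abs_le_square_iff[of "H \<omega> x" C] by simp
      then show "AE \<omega> in M. norm ((H \<omega> x)\<^sup>2 / gauss_density v x) \<le> C\<^sup>2 / gauss_density v x"
        using g0[of x] by (simp add: divide_right_mono)
    qed simp
    have "(\<integral>\<^sup>+\<omega>. ennreal ((H \<omega> x)\<^sup>2 / gauss_density v x) \<partial>M) = ennreal (\<integral>\<omega>. (H \<omega> x)\<^sup>2 / gauss_density v x \<partial>M)"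
      using iH by (rule nn_integral_eq_integral) simp
    also have "(\<integral>\<omega>. (H \<omega> x)\<^sup>2 / gauss_density v x \<partial>M) = (\<integral>\<omega>. (\<Sum>i=1..N. G x (Y i \<omega>))\<^sup>2 \<partial>M) / (real N)\<^sup>2 / gauss_density v x"
      by (simp add: H_sum power_divide)
    also have "\<dots> = (1 / real N) * ((\<integral>y. (G x y)\<^sup>2 \<partial>\<nu>) / gauss_density v x)"
      unfolding E using N by (simp add: power2_eq_square)
    finally show "(\<integral>\<^sup>+\<omega>. ennreal ((H \<omega> x)\<^sup>2 / gauss_density v x) \<partial>M)
        = ennreal (1 / real N) * ennreal ((\<integral>y. (G x y)\<^sup>2 \<partial>\<nu>) / gauss_density v x)"
      by (simp only: ennreal_mult' zero_le_divide_1_iff of_nat_0_le_iff)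
  qed
  also have "\<dots> = ennreal (1 / real N) * (\<integral>\<^sup>+x. ennreal ((\<integral>y. (G x y)\<^sup>2 \<partial>\<nu>) / gauss_density v x) \<partial>lborel)"
  proof (rule nn_integral_cmult)
    have "(\<lambda>x. \<integral>y. (G x y)\<^sup>2 \<partial>\<nu>) \<in> borel_measurable borel"
      unfolding G_def by (rule borel_measurable_lebesgue_integral) measurable
    then show "(\<lambda>x. ennreal ((\<integral>y. (G x y)\<^sup>2 \<partial>\<nu>) / gauss_density v x)) \<in> borel_measurable lborel" by measurable
  qed
  finally show "(\<integral>\<^sup>+\<omega>. ennreal ((\<integral>x. \<bar>(\<Sum>i=1..N. gauss_density v (x - b *\<^sub>R Y i \<omega>)) / real N - mix_density b v x\<bar> \<partial>lborel)\<^sup>2) \<partial>M)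
      \<le> ennreal (1 / real N) * (\<integral>\<^sup>+x. ennreal ((\<integral>y. (gauss_density v (x - b *\<^sub>R y) - mix_density b v x)\<^sup>2 \<partial>\<nu>) / gauss_density v x) \<partial>lborel)"
    unfolding H_def G_def p_def .
qed

text \<open>
  The variance is at most the second moment.
\<close>

lemma chi_square_le:
  assumes v: "v > 0"
  shows "(\<integral>\<^sup>+x. ennreal ((\<integral>y. (gauss_density v (x - b *\<^sub>R y) - mix_density b v x)\<^sup>2 \<partial>\<nu>) / gauss_density v x) \<partial>lborel)
    \<le> ennreal (\<integral>y. exp (b\<^sup>2 * (norm y)\<^sup>2 / v) \<partial>\<nu>)"
proof -
  interpret pair_sigma_finite \<nu> "lborel :: 'v measure" ..
  define p where "p = mix_density b v"
  have ig: "integrable \<nu> (\<lambda>y. gauss_density v (x - b *\<^sub>R y))" for x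
    unfolding gauss_density_gkern using integrable_gkern[OF v] by simp
  have ig2: "integrable \<nu> (\<lambda>y. (gauss_density v (x - b *\<^sub>R y))\<^sup>2)" for x
  proof (rule integrable_const_bound[of _ "(gauss_density v (0 :: 'v))\<^sup>2"])
    show "AE y in \<nu>. norm ((gauss_density v (x - b *\<^sub>R y))\<^sup>2) \<le> (gauss_density v (0 :: 'v))\<^sup>2"
      by (auto intro!: power_mono gauss_density_le[OF v])
  qed simp
  have le: "(\<integral>y. (gauss_density v (x - b *\<^sub>R y) - p x)\<^sup>2 \<partial>\<nu>) \<le> (\<integral>y. (gauss_density v (x - b *\<^sub>R y))\<^sup>2 \<partial>\<nu>)" for x
  proof -
    have "(\<integral>y. (gauss_density v (x - b *\<^sub>R y) - p x)\<^sup>2 \<partial>\<nu>)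
        = (\<integral>y. (gauss_density v (x - b *\<^sub>R y))\<^sup>2 - 2 * p x * gauss_density v (x - b *\<^sub>R y) + (p x)\<^sup>2 \<partial>\<nu>)"
      by (intro Bochner_Integration.integral_cong refl) (simp add: power2_diff)
    also have "\<dots> = (\<integral>y. (gauss_density v (x - b *\<^sub>R y))\<^sup>2 \<partial>\<nu>) - 2 * p x * p x + (p x)\<^sup>2"
      using ig ig2 prob_space by (simp add: p_def mix_density_def)
    finally show ?thesis by (simp add: power2_eq_square)
  qed
  have g0: "gauss_density v x > 0" for x :: 'v using v by (rule gauss_density_pos)
  have "(\<integral>\<^sup>+x. ennreal ((\<integral>y. (gauss_density v (x - b *\<^sub>R y) - p x)\<^sup>2 \<partial>\<nu>) / gauss_density v x) \<partial>lborel)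
      \<le> (\<integral>\<^sup>+x. \<integral>\<^sup>+y. ennreal ((gauss_density v (x - b *\<^sub>R y))\<^sup>2 / gauss_density v x) \<partial>\<nu> \<partial>lborel)"
  proof (rule nn_integral_mono)
    fix x :: 'v
    have "(\<integral>\<^sup>+y. ennreal ((gauss_density v (x - b *\<^sub>R y))\<^sup>2 / gauss_density v x) \<partial>\<nu>)
        = ennreal ((\<integral>y. (gauss_density v (x - b *\<^sub>R y))\<^sup>2 \<partial>\<nu>) / gauss_density v x)"
      using ig2[of x] by (subst nn_integral_eq_integral) simp_all
    then show "ennreal ((\<integral>y. (gauss_density v (x - b *\<^sub>R y) - p x)\<^sup>2 \<partial>\<nu>) / gauss_density v x)
        \<le> (\<integral>\<^sup>+y. ennreal ((gauss_density v (x - b *\<^sub>R y))\<^sup>2 / gauss_density v x) \<partial>\<nu>)"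
      using le[of x] g0[of x] by (simp add: ennreal_leI divide_right_mono)
  qed
  also have "\<dots> = (\<integral>\<^sup>+y. \<integral>\<^sup>+x. ennreal ((gauss_density v (x - b *\<^sub>R y))\<^sup>2 / gauss_density v x) \<partial>lborel \<partial>\<nu>)"
    by (rule Fubini') measurable
  also have "\<dots> = (\<integral>\<^sup>+y. ennreal (exp (b\<^sup>2 * (norm y)\<^sup>2 / v)) \<partial>\<nu>)"
    by (simp add: nn_integral_gauss_density_ratio[OF v] power_mult_distrib)
  also have "\<dots> = ennreal (\<integral>y. exp (b\<^sup>2 * (norm y)\<^sup>2 / v) \<partial>\<nu>)"
  proof (rule nn_integral_eq_integral)
    show "integrable \<nu> (\<lambda>y. exp (b\<^sup>2 * (norm y)\<^sup>2 / v))"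
    proof (rule integrable_const_bound[of _ "exp (b\<^sup>2 * K\<^sup>2 / v)"])
      show "AE y in \<nu>. norm (exp (b\<^sup>2 * (norm y)\<^sup>2 / v)) \<le> exp (b\<^sup>2 * K\<^sup>2 / v)"
        using bounded
      proof eventually_elim
        case (elim y)
        then have "b\<^sup>2 * (norm y)\<^sup>2 / v \<le> b\<^sup>2 * K\<^sup>2 / v"
          using v by (intro divide_right_mono mult_left_mono power_mono) simp_all
        then show ?case by simp
      qed
    qed simp
  qed simp
  finally show ?thesis by (simp add: p_def)
qed

text \<open>
  This settles the case \<open>E |\<eta>|\<^sup>2 = 0\<close>, where \<open>\<eta> = 0\<close> almost surely and the right-hand side of the final
  estimate is \<open>0\<close> by the convention \<open>x / 0 = 0\<close>.
\<close>

lemma chi_square_degenerate: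
  assumes "AE y in \<nu>. y = 0"
  shows "(\<integral>y. (gauss_density v (x - b *\<^sub>R y) - mix_density b v x)\<^sup>2 \<partial>\<nu>) = 0"
proof -
  have "mix_density b v x = (\<integral>y. gauss_density v x \<partial>\<nu>)"
    unfolding mix_density_def by (intro integral_cong_AE) (use assms in auto)
  then have "mix_density b v x = gauss_density v x" using prob_space by simp
  then have "(\<integral>y. (gauss_density v (x - b *\<^sub>R y) - mix_density b v x)\<^sup>2 \<partial>\<nu>) = (\<integral>y. 0 \<partial>\<nu>)"
    by (intro integral_cong_AE) (use assms in auto)
  then show ?thesis by simp
qed

end

section \<open>The error bound\<close>

text \<open>
  The drift averages \<open>x - y\<close> over the posterior law of \<open>y\<close>.
\<close>

lemma (in bounded_law) drift_post_mean:
  assumes v: "v > 0"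
  shows "(r / (s * (\<integral>y. gkern b v x y \<partial>\<nu>))) *\<^sub>R (\<integral>y. gkern b v x y *\<^sub>R (x - y) \<partial>\<nu>)
    = (r / s) *\<^sub>R (x - post_mean \<nu> b v x)"
proof -
  have "(\<integral>y. gkern b v x y *\<^sub>R (x - y) \<partial>\<nu>) = (\<integral>y. gkern b v x y \<partial>\<nu>) *\<^sub>R x - (\<integral>y. gkern b v x y *\<^sub>R y \<partial>\<nu>)"
    using integrable_gkern_mult[OF v _ bounded] integrable_gkern[OF v] by (simp add: scaleR_diff_right)
  then show ?thesis
    using integral_gkern_pos[OF v, of b x] by (simp add: post_mean_def scaleR_diff_right)
qed

lemma kern_gkern:
  assumes "\<sigma> s = 1 - \<beta> s"
  shows "kern \<epsilon> \<gamma> \<sigma> \<beta> s x y = gkern (\<beta> s) (mix_var \<epsilon> \<gamma> (\<beta> s)) x y"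
  using assms by (simp add: kern_def gkern_def mix_var_def mult_ac)

definition empirical_law :: "nat \<Rightarrow> (nat \<Rightarrow> 'v::euclidean_space) \<Rightarrow> 'v measure" where
  "empirical_law N y = distr (measure_pmf (pmf_of_set {1..N})) borel y"

lemma integral_empirical_law:
  fixes f :: "'v::euclidean_space \<Rightarrow> 'b::{banach, second_countable_topology}"
  assumes N: "N \<ge> 1" and f: "f \<in> borel_measurable borel"
  shows "(\<integral>z. f z \<partial>empirical_law N y) = (1 / real N) *\<^sub>R (\<Sum>i=1..N. f (y i))"
proof -
  have "(\<integral>z. f z \<partial>empirical_law N y) = (\<integral>i. f (y i) \<partial>measure_pmf (pmf_of_set {1..N}))"
    unfolding empirical_law_def using f by (intro integral_distr) simp_all
  also have "\<dots> = (\<Sum>i\<in>{1..N}. pmf (pmf_of_set {1..N}) i *\<^sub>R f (y i))"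
    using N by (intro integral_measure_pmf) simp_all
  also have "\<dots> = (1 / real N) *\<^sub>R (\<Sum>i=1..N. f (y i))"
    using N by (simp add: scaleR_sum_right)
  finally show ?thesis .
qed

lemma bounded_law_empirical:
  assumes N: "N \<ge> 1"
  shows "bounded_law (empirical_law N y) (\<Sum>i=1..N. norm (y i))"
proof -
  interpret prob_space "empirical_law N y"
    unfolding empirical_law_def by (rule measure_pmf.prob_space_distr) simp
  show ?thesis
  proof
    show "sets (empirical_law N y) = sets borel" by (simp add: empirical_law_def)
    have "norm (y i) \<le> (\<Sum>i=1..N. norm (y i))" if "i \<in> {1..N}" for i
      using that by (intro member_le_sum) simp_all
    then show "AE z in empirical_law N y. norm z \<le> (\<Sum>i=1..N. norm (y i))"
      unfolding empirical_law_def using N by (subst AE_distr_iff) (simp_all add: AE_measure_pmf_iff)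
  qed
qed

text \<open>
  Both marginal laws are Gaussian mixtures with variance \<open>v = \<sigma> (\<epsilon> \<beta> + \<gamma> \<sigma>)\<close>, where \<open>\<sigma>\<close> and \<open>\<beta>\<close> are taken at \<open>t\<close>. The sampling error is at most
  \<open>E exp (\<beta>\<^sup>2 |\<eta>|\<^sup>2 / v) / N\<close>, and \<open>\<beta>\<^sup>2 / v \<le> \<beta> / (\<epsilon> \<sigma>)\<close>. As \<open>2 |\<eta>|\<^sup>2 + E |\<eta>|\<^sup>2 \<le> 3 K\<^sup>2\<close>, this is below the claimed bound if
  \<open>E |\<eta>|\<^sup>2 > 0\<close>; otherwise both sides vanish.
\<close>

theorem theorem4p4:
  fixes M :: "'a measure"
    and \<epsilon> \<gamma> K t :: real
    and \<sigma> \<sigma>' \<beta> \<beta>' :: "real \<Rightarrow> real"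
    and N :: nat
    and \<eta> :: "'a \<Rightarrow> real ^ 'd"
    and \<eta>s :: "nat \<Rightarrow> 'a \<Rightarrow> real ^ 'd"
    and W X :: "real \<Rightarrow> 'a \<Rightarrow> real ^ 'd"
    and Xy :: "(nat \<Rightarrow> real ^ 'd) \<Rightarrow> real \<Rightarrow> 'a \<Rightarrow> real ^ 'd"
  assumes prob: "prob_space M"
    and eps_pos: "\<epsilon> > 0" and gamma_pos: "\<gamma> > 0"
    and sigma_range: "\<sigma> \<in> {0..1} \<rightarrow> {0..1}"
    and beta_range: "\<beta> \<in> {0..1} \<rightarrow> {0..1}"
    and sigma_deriv: "\<And>s. s \<in> {0..1} \<Longrightarrow> (\<sigma> has_real_derivative \<sigma>' s) (at s within {0..1})"
    and beta_deriv: "\<And>s. s \<in> {0..1} \<Longrightarrow> (\<beta> has_real_derivative \<beta>' s) (at s within {0..1})"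
    and sigma_C1: "continuous_on {0..1} \<sigma>'"
    and beta_C1: "continuous_on {0..1} \<beta>'"
    and beta_incr: "\<And>s. s \<in> {0<..<1} \<Longrightarrow> \<beta>' s > 0"
    and beta_0: "\<beta> 0 = 0" and beta_1: "\<beta> 1 = 1"
    and sigma_beta: "\<And>s. s \<in> {0..1} \<Longrightarrow> \<sigma> s + \<beta> s = 1"
    and eta_meas: "\<eta> \<in> borel_measurable M"
    and eta_bound: "AE \<omega> in M. norm (\<eta> \<omega>) \<le> K"
    and eta_mean: "(\<integral>\<omega>. \<eta> \<omega> \<partial>M) = 0"
    and N_pos: "N \<ge> 1"
    and copies_indep: "prob_space.indep_vars M (\<lambda>_. borel) \<eta>s {1..N}"
    and copies_law: "\<And>i. i \<in> {1..N} \<Longrightarrow> distr M borel (\<eta>s i) = distr M borel \<eta>"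
    and X_sde: "sde_solution M W (drift \<epsilon> \<gamma> \<sigma> \<sigma>' \<beta> M \<eta>) (\<lambda>s. sqrt (\<epsilon> * \<beta>' s)) 1 X"
    and X_init: "distr M borel (X 0) = gaussian_measure \<gamma>"
    and Xy_sde: "\<And>y. y \<in> {1..N} \<rightarrow>\<^sub>E UNIV \<Longrightarrow>
      sde_solution M W (empirical_drift \<epsilon> \<gamma> \<sigma> \<sigma>' \<beta> N y) (\<lambda>s. sqrt (\<epsilon> * \<beta>' s)) 1 (Xy y)"
    and Xy_init: "\<And>y. y \<in> {1..N} \<rightarrow>\<^sub>E UNIV \<Longrightarrow> distr M borel (Xy y 0) = gaussian_measure \<gamma>"
    and t: "t \<in> {0<..<1}"
  shows "integrable M (\<lambda>\<omega>. (var_dist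
        (distr M borel (Xy (\<lambda>i\<in>{1..N}. \<eta>s i \<omega>) t)) (distr M borel (X t)))\<^sup>2) \<and>
    (\<integral>\<omega>. (var_dist
        (distr M borel (Xy (\<lambda>i\<in>{1..N}. \<eta>s i \<omega>) t)) (distr M borel (X t)))\<^sup>2 \<partial>M) \<le>
      8 * K\<^sup>2 / real N *
      (\<integral>\<omega>. exp (\<beta> t * (2 * (norm (\<eta> \<omega>))\<^sup>2 + (\<integral>\<omega>'. (norm (\<eta> \<omega>'))\<^sup>2 \<partial>M)) / (2 * \<epsilon> * \<sigma> t)) /
            (2 * (norm (\<eta> \<omega>))\<^sup>2 + (\<integral>\<omega>'. (norm (\<eta> \<omega>'))\<^sup>2 \<partial>M)) \<partial>M)"
proof -
  interpret M: prob_space M by (rule prob)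
  note [measurable] = eta_meas
  have bm: "brownian_motion M W" using X_sde by (simp add: sde_solution_def)
  have sig: "\<sigma> s = 1 - \<beta> s" if "s \<in> {0..1}" for s using sigma_beta[OF that] by simp
  have sig': "\<sigma>' s = - \<beta>' s" if s: "s \<in> {0..1}" for s
  proof -
    have "((\<lambda>s. 1 - \<beta> s) has_real_derivative - \<beta>' s) (at s within {0..1})"
      using beta_deriv[OF s] by (auto intro!: derivative_eq_intros)
    then have "(\<sigma> has_real_derivative - \<beta>' s) (at s within {0..1})"
      using s sig by (auto intro: has_field_derivative_transform_within[where d = 1])
    then show ?thesis
      using sigma_deriv[OF s] s vector_derivative_unique_within_closed_interval[of 0 1 s \<sigma> "\<sigma>' s" "- \<beta>' s"]
      by (simp add: has_real_derivative_iff_has_vector_derivative)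
  qed
  have beta_lt: "0 \<le> \<beta> s" "\<beta> s < 1" if s: "s \<in> {0..<1}" for s
  proof -
    have "s \<in> {0..1}" using s by auto
    then show "0 \<le> \<beta> s" using beta_range by (auto simp: Pi_iff)
    have "continuous_on {0..1} \<beta>" using beta_deriv by (meson DERIV_continuous_on)
    then have "continuous_on {s..1} \<beta>" by (rule continuous_on_subset) (use s in auto)
    moreover have "\<exists>y. DERIV \<beta> x :> y \<and> 0 < y" if "s < x" "x < 1" for x
    proof -
      have x: "0 < x" "x < 1" using that s by auto
      then have "DERIV \<beta> x :> \<beta>' x" using beta_deriv[of x] at_within_Icc_at[OF x] by simp
      then show ?thesis using beta_incr[of x] x by auto
    qed
    moreover have "s < 1" using s by simp
    ultimately have "\<beta> s < \<beta> 1" by (metis DERIV_pos_imp_increasing_open)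
    then show "\<beta> s < 1" by (simp add: beta_1)
  qed
  define v where "v s = mix_var \<epsilon> \<gamma> (\<beta> s)" for s
  have v: "v s > 0" if "s \<in> {0..<1}" for s
    unfolding v_def using mix_var_pos eps_pos gamma_pos beta_lt[OF that] by simp
  have t01: "t \<in> {0..<1}" "t \<in> {0..1}" using t by auto
  define \<nu> where "\<nu> = distr M borel \<eta>"
  interpret law: bounded_law \<nu> K
  proof -
    interpret prob_space \<nu> unfolding \<nu>_def by (rule M.prob_space_distr) simp
    show "bounded_law \<nu> K"
    proof
      show "sets \<nu> = sets borel" by (simp add: \<nu>_def)
      show "AE y in \<nu>. norm y \<le> K" unfolding \<nu>_def using eta_bound by (subst AE_distr_iff) simp_all
    qed
  qed
  have brown: "brownian M W" by (rule brownian.intro[OF prob]) (rule brownian_axioms.intro[OF bm])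

  have law_X: "distr M borel (X t) = density lborel (\<lambda>x. ennreal (law.mix_density (\<beta> t) (v t) x))"
  proof -
    interpret interpolating_sde \<nu> K M W \<epsilon> \<gamma> \<beta> \<beta>' "drift \<epsilon> \<gamma> \<sigma> \<sigma>' \<beta> M \<eta>" X
    proof (intro interpolating_sde.intro interpolating_sde_axioms.intro)
      show "bounded_law \<nu> K" by (rule law.bounded_law_axioms)
      show "drift \<epsilon> \<gamma> \<sigma> \<sigma>' \<beta> M \<eta> s x = - (\<beta>' s / (1 - \<beta> s)) *\<^sub>R (x - post_mean \<nu> (\<beta> s) (mix_var \<epsilon> \<gamma> (\<beta> s)) x)"
        if s: "s \<in> {0..<1}" for s x
      proof -
        have s': "s \<in> {0..1}" using s by auto
        have "drift \<epsilon> \<gamma> \<sigma> \<sigma>' \<beta> M \<eta> s x = (\<sigma>' s / (\<sigma> s * (\<integral>y. gkern (\<beta> s) (v s) x y \<partial>\<nu>))) *\<^sub>R (\<integral>y. gkern (\<beta> s) (v s) x y *\<^sub>R (x - y) \<partial>\<nu>)"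
          unfolding drift_def kern_gkern[of \<sigma> s \<beta>, OF sig[OF s']] \<nu>_def v_def
          by (simp add: integral_distr)
        then show ?thesis
          using law.drift_post_mean[OF v[OF s], of "\<sigma>' s" "\<sigma> s" "\<beta> s" x] by (simp add: sig[OF s'] sig'[OF s'] v_def)
      qed
    qed (use brown eps_pos gamma_pos beta_deriv beta_C1 beta_incr beta_0 beta_1 X_sde X_init in auto)
    show ?thesis
      using marginal_law[of t] t law.gauss_mixture_mix_density[OF v[OF t01(1)], of "\<beta> t"] by (simp add: v_def)
  qed

  have law_Xy: "distr M borel (Xy y t)
      = density lborel (\<lambda>x. ennreal ((\<Sum>i=1..N. gauss_density (v t) (x - \<beta> t *\<^sub>R y i)) / real N))"
    if y: "y \<in> {1..N} \<rightarrow>\<^sub>E UNIV" for y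
  proof -
    interpret emp: bounded_law "empirical_law N y" "\<Sum>i=1..N. norm (y i)" by (rule bounded_law_empirical[OF N_pos])
    interpret interpolating_sde "empirical_law N y" "\<Sum>i=1..N. norm (y i)" M W \<epsilon> \<gamma> \<beta> \<beta>' "empirical_drift \<epsilon> \<gamma> \<sigma> \<sigma>' \<beta> N y" "Xy y"
    proof (intro interpolating_sde.intro interpolating_sde_axioms.intro)
      show "bounded_law (empirical_law N y) (\<Sum>i=1..N. norm (y i))" by (rule emp.bounded_law_axioms)
      show "empirical_drift \<epsilon> \<gamma> \<sigma> \<sigma>' \<beta> N y s x
          = - (\<beta>' s / (1 - \<beta> s)) *\<^sub>R (x - post_mean (empirical_law N y) (\<beta> s) (mix_var \<epsilon> \<gamma> (\<beta> s)) x)"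
        if s: "s \<in> {0..<1}" for s x
      proof -
        have s': "s \<in> {0..1}" using s by auto
        have "empirical_drift \<epsilon> \<gamma> \<sigma> \<sigma>' \<beta> N y s x
            = (\<sigma>' s / (\<sigma> s * (\<integral>z. gkern (\<beta> s) (v s) x z \<partial>empirical_law N y))) *\<^sub>R (\<integral>z. gkern (\<beta> s) (v s) x z *\<^sub>R (x - z) \<partial>empirical_law N y)"
          unfolding empirical_drift_def kern_gkern[of \<sigma> s \<beta>, OF sig[OF s']] v_def
          using N_pos by (simp add: integral_empirical_law)
        then show ?thesis
          using emp.drift_post_mean[OF v[OF s], of "\<sigma>' s" "\<sigma> s" "\<beta> s" x] by (simp add: sig[OF s'] sig'[OF s'] v_def)
      qed
    qed (use brown eps_pos gamma_pos beta_deriv beta_C1 beta_incr beta_0 beta_1 Xy_sde[OF y] Xy_init[OF y] in auto)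
    have "emp.mix_density (\<beta> t) (v t) x = (\<Sum>i=1..N. gauss_density (v t) (x - \<beta> t *\<^sub>R y i)) / real N" for x
      unfolding emp.mix_density_def using N_pos by (subst integral_empirical_law) simp_all
    then show ?thesis
      using marginal_law[of t] t emp.gauss_mixture_mix_density[OF v[OF t01(1)], of "\<beta> t"] by (simp add: v_def)
  qed

  define p where "p = law.mix_density (\<beta> t) (v t)"
  define D where "D \<omega> = (\<integral>x. \<bar>(\<Sum>i=1..N. gauss_density (v t) (x - \<beta> t *\<^sub>R \<eta>s i \<omega>)) / real N - p x\<bar> \<partial>lborel)" for \<omega>
  have vt: "v t > 0" by (rule v[OF t01(1)])
  have p1: "(\<integral>x. gauss_density (v t) (x - u) \<partial>lborel) = 1" "integrable lborel (\<lambda>x. gauss_density (v t) (x - u))" for u :: "real ^ 'd"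
  proof -
    have "(\<integral>\<^sup>+x. ennreal (gauss_density (v t) (x - u)) \<partial>lborel) = (\<integral>\<^sup>+x. ennreal (gauss_density (v t) (x :: real ^ 'd)) \<partial>lborel)"
      by (subst nn_integral_lborel_affine[where r = 1 and c = u]) simp_all
    then have 1: "(\<integral>\<^sup>+x. ennreal (gauss_density (v t) (x - u)) \<partial>lborel) = 1"
      by (simp add: nn_integral_gauss_density[OF vt])
    then show "integrable lborel (\<lambda>x. gauss_density (v t) (x - u))" by (intro integrableI_nonneg) simp_all
    show "(\<integral>x. gauss_density (v t) (x - u) \<partial>lborel) = 1" using 1 by (subst integral_eq_nn_integral) simp_all
  qed
  have var_D: "var_dist (distr M borel (Xy (\<lambda>i\<in>{1..N}. \<eta>s i \<omega>) t)) (distr M borel (X t)) = D \<omega>" for \<omega>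
  proof -
    have "(\<lambda>i\<in>{1..N}. \<eta>s i \<omega>) \<in> {1..N} \<rightarrow>\<^sub>E UNIV" by simp
    note eq = law_Xy[OF this]
    show ?thesis
      unfolding eq law_X p_def[symmetric] D_def
      by (subst var_dist_density)
         (simp_all add: p_def law.integrable_mix_density[OF vt] law.mix_density_nonneg p1 sum_nonneg)
  qed
  note err = law.empirical_mixture_error[OF prob copies_indep copies_law[folded \<nu>_def] N_pos vt, of "\<beta> t", folded p_def, folded D_def]
  have Dm [measurable]: "D \<in> borel_measurable M" using err(1) by (simp add: D_def[abs_def])
  have D_nonneg: "D \<omega> \<ge> 0" for \<omega> by (simp add: D_def)

  define m where "m = (\<integral>\<omega>. (norm (\<eta> \<omega>))\<^sup>2 \<partial>M)"
  define F where "F \<omega> = exp (\<beta> t * (2 * (norm (\<eta> \<omega>))\<^sup>2 + m) / (2 * \<epsilon> * \<sigma> t)) / (2 * (norm (\<eta> \<omega>))\<^sup>2 + m)" for \<omega>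
  have eta_sq: "AE \<omega> in M. (norm (\<eta> \<omega>))\<^sup>2 \<le> K\<^sup>2"
    using eta_bound by eventually_elim (simp add: power_mono)
  then have int_sq: "integrable M (\<lambda>\<omega>. (norm (\<eta> \<omega>))\<^sup>2)"
    by (intro M.integrable_const_bound[of _ "K\<^sup>2"]) simp_all
  have m_nonneg: "m \<ge> 0" unfolding m_def by simp
  have m_le: "m \<le> K\<^sup>2"
  proof -
    have "m \<le> (\<integral>\<omega>. K\<^sup>2 \<partial>M)"
      unfolding m_def using eta_sq by (intro integral_mono_AE int_sq) simp_all
    then show ?thesis by (simp add: M.prob_space)
  qed
  have F_nonneg: "F \<omega> \<ge> 0" for \<omega> using m_nonneg by (simp add: F_def)
  have bound: "(\<integral>\<^sup>+\<omega>. ennreal ((D \<omega>)\<^sup>2) \<partial>M) \<le> ennreal (8 * K\<^sup>2 / real N * (\<integral>\<omega>. F \<omega> \<partial>M))"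
  proof (cases "m = 0")
    case True
    have "AE \<omega> in M. (norm (\<eta> \<omega>))\<^sup>2 = 0"
      using True int_sq unfolding m_def by (subst (asm) integral_nonneg_eq_0_iff_AE) simp_all
    then have "AE y in \<nu>. y = 0" unfolding \<nu>_def by (subst AE_distr_iff) simp_all
    from law.chi_square_degenerate[OF this] have "(\<integral>\<^sup>+\<omega>. ennreal ((D \<omega>)\<^sup>2) \<partial>M) \<le> 0"
      using err(2) by (simp add: p_def)
    then show ?thesis by simp
  next
    case False
    then have m: "m > 0" using m_nonneg by simp
    let ?e = "\<lambda>\<omega>. exp ((\<beta> t)\<^sup>2 * (norm (\<eta> \<omega>))\<^sup>2 / v t)"
    have st: "\<sigma> t > 0" "0 \<le> \<beta> t" "\<sigma> t = 1 - \<beta> t" using beta_lt[OF t01(1)] sig[OF t01(2)] by simp_all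
    have rate: "(\<beta> t)\<^sup>2 / v t \<le> \<beta> t / (\<epsilon> * \<sigma> t)"
    proof -
      have "\<epsilon> * \<sigma> t * \<beta> t \<le> v t"
        using st gamma_pos by (simp add: v_def mix_var_def distrib_left)
      from mult_left_mono[OF this st(2)] have "(\<beta> t)\<^sup>2 * (\<epsilon> * \<sigma> t) \<le> \<beta> t * v t"
        by (simp add: power2_eq_square mult_ac)
      then have "(\<beta> t)\<^sup>2 \<le> \<beta> t * v t / (\<epsilon> * \<sigma> t)"
        using st eps_pos by (intro mult_imp_le_div_pos) simp_all
      then show ?thesis using vt by (intro mult_imp_div_pos_le) simp_all
    qed
    have AE_e: "AE \<omega> in M. ?e \<omega> \<le> 3 * K\<^sup>2 * F \<omega> \<and> F \<omega> \<le> exp (\<beta> t * (2 * K\<^sup>2 + m) / (2 * \<epsilon> * \<sigma> t)) / m \<and> ?e \<omega> \<le> exp ((\<beta> t)\<^sup>2 * K\<^sup>2 / v t)"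
      using eta_bound
    proof eventually_elim
      case (elim \<omega>)
      define z where "z = (norm (\<eta> \<omega>))\<^sup>2"
      have z: "0 \<le> z" "z \<le> K\<^sup>2" unfolding z_def using elim by (auto intro: power_mono)
      have "(\<beta> t)\<^sup>2 * z / v t \<le> \<beta> t * (2 * z + m) / (2 * \<epsilon> * \<sigma> t)"
      proof -
        have "(\<beta> t)\<^sup>2 * z / v t \<le> \<beta> t / (\<epsilon> * \<sigma> t) * z"
          using mult_right_mono[OF rate z(1)] by simp
        also have "\<dots> = \<beta> t * (2 * z) / (2 * \<epsilon> * \<sigma> t)" by simp
        also have "\<dots> \<le> \<beta> t * (2 * z + m) / (2 * \<epsilon> * \<sigma> t)"
          using m st eps_pos by (intro divide_right_mono mult_left_mono) simp_all
        finally show ?thesis .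
      qed
      then have "exp ((\<beta> t)\<^sup>2 * z / v t) * (2 * z + m) \<le> exp (\<beta> t * (2 * z + m) / (2 * \<epsilon> * \<sigma> t)) * (3 * K\<^sup>2)"
        using z m m_le by (intro mult_mono) simp_all
      then have 1: "?e \<omega> \<le> 3 * K\<^sup>2 * F \<omega>"
        unfolding F_def z_def[symmetric] using z m by (simp add: pos_le_divide_eq mult.commute)
      have 2: "F \<omega> \<le> exp (\<beta> t * (2 * K\<^sup>2 + m) / (2 * \<epsilon> * \<sigma> t)) / m"
        unfolding F_def z_def[symmetric] using z m st eps_pos
        by (intro frac_le) (auto intro!: divide_right_mono mult_left_mono)
      have "?e \<omega> \<le> exp ((\<beta> t)\<^sup>2 * K\<^sup>2 / v t)"
        unfolding z_def[symmetric] using z vt by (auto intro!: divide_right_mono mult_left_mono)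
      with 1 2 show ?case by simp
    qed
    have iF: "integrable M F"
    proof (rule M.integrable_const_bound)
      show "AE \<omega> in M. norm (F \<omega>) \<le> exp (\<beta> t * (2 * K\<^sup>2 + m) / (2 * \<epsilon> * \<sigma> t)) / m"
        using AE_e F_nonneg by (auto elim: eventually_mono)
      show "F \<in> borel_measurable M" unfolding F_def[abs_def] by measurable
    qed
    have ie: "integrable M ?e"
      using AE_e by (intro M.integrable_const_bound[of _ "exp ((\<beta> t)\<^sup>2 * K\<^sup>2 / v t)"]) (auto elim: eventually_mono)
    have "(\<integral>\<^sup>+\<omega>. ennreal ((D \<omega>)\<^sup>2) \<partial>M) \<le> ennreal (1 / real N) * ennreal (\<integral>y. exp ((\<beta> t)\<^sup>2 * (norm y)\<^sup>2 / v t) \<partial>\<nu>)"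
      using law.chi_square_le[OF vt, of "\<beta> t"] by (intro order_trans[OF err(2)] mult_left_mono) (simp_all add: p_def)
    also have "(\<integral>y. exp ((\<beta> t)\<^sup>2 * (norm y)\<^sup>2 / v t) \<partial>\<nu>) = (\<integral>\<omega>. ?e \<omega> \<partial>M)"
      unfolding \<nu>_def by (subst integral_distr) simp_all
    also have "ennreal (1 / real N) * ennreal (\<integral>\<omega>. ?e \<omega> \<partial>M) = ennreal (1 / real N * (\<integral>\<omega>. ?e \<omega> \<partial>M))"
      by (rule ennreal_mult[symmetric]) simp_all
    also have "\<dots> \<le> ennreal (8 * K\<^sup>2 / real N * (\<integral>\<omega>. F \<omega> \<partial>M))"
    proof (rule ennreal_leI)
      have "(\<integral>\<omega>. ?e \<omega> \<partial>M) \<le> (\<integral>\<omega>. 3 * K\<^sup>2 * F \<omega> \<partial>M)"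
        using AE_e by (intro integral_mono_AE ie integrable_mult_right iF) (auto elim: eventually_mono)
      also have "\<dots> = 3 * (K\<^sup>2 * (\<integral>\<omega>. F \<omega> \<partial>M))" by simp
      also have "\<dots> \<le> 8 * (K\<^sup>2 * (\<integral>\<omega>. F \<omega> \<partial>M))"
        using F_nonneg by (intro mult_right_mono mult_nonneg_nonneg integral_nonneg_AE) simp_all
      finally have "1 / real N * (\<integral>\<omega>. ?e \<omega> \<partial>M) \<le> 1 / real N * (8 * (K\<^sup>2 * (\<integral>\<omega>. F \<omega> \<partial>M)))"
        by (intro mult_left_mono) simp_all
      then show "1 / real N * (\<integral>\<omega>. ?e \<omega> \<partial>M) \<le> 8 * K\<^sup>2 / real N * (\<integral>\<omega>. F \<omega> \<partial>M)" by simp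
    qed
    finally show ?thesis .
  qed
  have iD: "integrable M (\<lambda>\<omega>. (D \<omega>)\<^sup>2)"
    using le_less_trans[OF bound ennreal_less_top] by (intro integrableI_nonneg) simp_all
  moreover have "(\<integral>\<omega>. (D \<omega>)\<^sup>2 \<partial>M) \<le> 8 * K\<^sup>2 / real N * (\<integral>\<omega>. F \<omega> \<partial>M)"
  proof -
    have "0 \<le> 8 * K\<^sup>2 / real N * (\<integral>\<omega>. F \<omega> \<partial>M)"
      using F_nonneg by (intro mult_nonneg_nonneg integral_nonneg_AE) simp_all
    then show ?thesis using bound by (subst (asm) nn_integral_eq_integral[OF iD]) (simp_all add: ennreal_le_iff)
  qed
  ultimately show ?thesis unfolding var_D F_def m_def by simp
qed

end
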